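(* Let $d=2$ and let $w_h\in W_h$ be the solution of $(\nabla w_h,\nabla\chi_h)=(f,\chi_h)$ for all $\chi_h\in W_h$. The discrete method: find $u_{h0}\in V_{h0}$ such that $$\varepsilon^2a_h(u_{h0},v_h)+b_h(u_{h0},v_h)=(\nabla w_h,\nabla_hv_h)\qquad\forall\,v_h\in V_{h0},$$ can be decoupled into two Morley element methods of Poisson equation and one nonconforming $P_1$-$P_0$ element method of Brinkman problem, i.e., it is equivalent to: find $(z_h,\phi_h,p_h,u_{h0})\in V_h\times V_{h0}^{CR}\times\mathcal Q_h\times V_h$ such that $$(\operatorname{curl}_hz_h,\operatorname{curl}_hv_h)=(\nabla w_h,\nabla_hv_h)\qquad\forall\,v_h\in V_h,$$ $$(\phi_h,\psi_h)+\varepsilon^2(\nabla_h\phi_h,\nabla_h\psi_h)+(\operatorname{div}_h\psi_h,p_h)=(\operatorname{curl}_hz_h,\psi_h)\qquad\forall\,\psi_h\in V_{h0}^{CR},$$ $$(\operatorname{div}_h\phi_h,q_h)=0\qquad\forall\,q_h\in\mathcal Q_h,$$ $$(\operatorname{curl}_hu_{h0},\operatorname{curl}_h\chi_h)=(\phi_h,\operatorname{curl}_h\chi_h)\qquad\forall\,\chi_h\in V_h.$$ (Equivalence means: $u_{h0}$ solves the first problem if and only if $u_{h0}$ is the last component of a solution of the decoupled system.)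
   Context: $\Omega\subset\mathbb R^2$ is a convex bounded polygon, $f\in L^2(\Omega)$, $\varepsilon>0$, and $\mathcal T_h$ is a (shape regular) triangulation of $\Omega$. $(\cdot,\cdot)$ is the $L^2(\Omega)$ inner product (scalar, vector or tensor valued); $n$ is the unit outward normal to $\partial\Omega$. $\nabla_h,\nabla_h^2,\operatorname{curl}_h,\operatorname{div}_h$ are the elementwise gradient, Hessian, curl and divergence, where for scalar $v$, $\operatorname{curl}v=(\partial_{2}v,-\partial_{1}v)^{T}$. $a_h(w,v):=(\nabla_h^2w,\nabla_h^2v)$, $b_h(w,v):=(\nabla_hw,\nabla_hv)$. Morley (MWX) spaces: $\widetilde V_h$ is the set of piecewise quadratic functions on $\mathcal T_h$ that are continuous at all vertices and whose normal derivatives are continuous at the midpoint of each edge; $V_h:=\{v\in\widetilde V_h:v=0$ at all vertices on $\partial\Omega\}$; $V_{h0}:=\{v\in V_h:\int_F\partial_nv\,ds=0$ for all edges $F\subset\partial\Omega\}$. Lagrange space: $W_h:=\{v\in H_0^1(\Omega):v|_K\in\mathbb P_\ell(K)\ \forall K\in\mathcal T_h\}$, $\ell\in\{1,2\}$ fixed. $V_h^{CR}$ is the set of $v\in L^2(\Omega;\mathbb R^2)$ with $v|_K\in\mathbb P_1(K;\mathbb R^2)$ for each $K$, such that the jump of $v$ has zero integral on each interior edge and $\int_Fv\cdot n\,ds=0$ on each boundary edge $F$; $V_{h0}^{CR}:=\{v\in V_h^{CR}:\int_Fv\,ds=0$ for each boundary edge $F\}$. $\mathcal Q_h$ is the space of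 piecewise constant functions on $\mathcal T_h$ with vanishing mean over $\Omega$. *)

theory Defs
  imports "HOL-Analysis.Analysis"
begin

section \<open>Lebesgue and Sobolev spaces on a planar domain\<close>

text \<open>Functions are total on the plane and only matter almost everywhere on \<open>\<Omega>\<close>. In particular the
  values of a piecewise polynomial on the edges of the mesh are arbitrary, so integrals are taken
  with respect to the completed measure \<^const>\<open>lebesgue\<close>.\<close>

definition L2_inner ::
  "(real^2) set \<Rightarrow> (real^2 \<Rightarrow> 'b::real_inner) \<Rightarrow> (real^2 \<Rightarrow> 'b) \<Rightarrow> real"
  where "L2_inner \<Omega> u v = (LINT x:\<Omega>|lebesgue. u x \<bullet> v x)"

definition L2 :: "(real^2) set \<Rightarrow> (real^2 \<Rightarrow> 'b::euclidean_space) set"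
  where "L2 \<Omega> = {v. set_borel_measurable lebesgue \<Omega> v \<and>
                    set_integrable lebesgue \<Omega> (\<lambda>x. (norm (v x))\<^sup>2)}"

definition pd :: "2 \<Rightarrow> (real^2 \<Rightarrow> real) \<Rightarrow> real^2 \<Rightarrow> real"
  where "pd i v x = frechet_derivative v (at x) (axis i 1)"

fun iter_pd :: "2 list \<Rightarrow> (real^2 \<Rightarrow> real) \<Rightarrow> real^2 \<Rightarrow> real" where
  "iter_pd [] v = v"
| "iter_pd (i # is) v = pd i (iter_pd is v)"

definition smooth :: "(real^2 \<Rightarrow> real) \<Rightarrow> bool"
  where "smooth v \<longleftrightarrow> (\<forall>is x. iter_pd is v differentiable (at x))"

definition test_functions :: "(real^2) set \<Rightarrow> (real^2 \<Rightarrow> real) set"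
  where "test_functions \<Omega> =
    {\<phi>. smooth \<phi> \<and> compact (closure {x. \<phi> x \<noteq> 0}) \<and> closure {x. \<phi> x \<noteq> 0} \<subseteq> \<Omega>}"

definition is_weak_gradient ::
  "(real^2) set \<Rightarrow> (real^2 \<Rightarrow> real) \<Rightarrow> (real^2 \<Rightarrow> real^2) \<Rightarrow> bool"
  where "is_weak_gradient \<Omega> v g \<longleftrightarrow>
    (\<forall>\<phi>\<in>test_functions \<Omega>. \<forall>i.
       L2_inner \<Omega> v (pd i \<phi>) = - L2_inner \<Omega> (\<lambda>x. g x $ i) \<phi>)"

definition H1 :: "(real^2) set \<Rightarrow> (real^2 \<Rightarrow> real) set"
  where "H1 \<Omega> = {v \<in> L2 \<Omega>. \<exists>g \<in> L2 \<Omega>. is_weak_gradient \<Omega> v g}"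

text \<open>The weak gradient of a function in \<open>H\<^sup>1(\<Omega>)\<close>; it is unique up to null sets.\<close>

definition weak_grad :: "(real^2) set \<Rightarrow> (real^2 \<Rightarrow> real) \<Rightarrow> real^2 \<Rightarrow> real^2"
  where "weak_grad \<Omega> v = (SOME g. g \<in> L2 \<Omega> \<and> is_weak_gradient \<Omega> v g)"

text \<open>\<open>H\<^sup>1\<^sub>0(\<Omega>)\<close> is the closure of the test functions in the norm of \<open>H\<^sup>1(\<Omega>)\<close>.\<close>

definition H10 :: "(real^2) set \<Rightarrow> (real^2 \<Rightarrow> real) set"
  where "H10 \<Omega> = {v \<in> H1 \<Omega>. \<exists>\<phi> :: nat \<Rightarrow> real^2 \<Rightarrow> real. (\<forall>k. \<phi> k \<in> test_functions \<Omega>) \<and>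
    (\<lambda>k. let e = (\<lambda>x. v x - \<phi> k x); d = (\<lambda>x. weak_grad \<Omega> v x - (\<chi> i. pd i (\<phi> k) x))
         in L2_inner \<Omega> e e + L2_inner \<Omega> d d) \<longlonglongrightarrow> 0}"


section \<open>Polygonal domains and meshes\<close>

definition convex_polygon :: "(real^2) set \<Rightarrow> bool"
  where "convex_polygon \<Omega> \<longleftrightarrow> open \<Omega> \<and> \<Omega> \<noteq> {} \<and> convex \<Omega> \<and> polytope (closure \<Omega>)"

text \<open>The elements of a mesh are closed nondegenerate triangles; \<^const>\<open>triangulation\<close> provides
  finiteness and conformity (any two elements meet in a common face, possibly empty).\<close>

definition mesh :: "(real^2) set \<Rightarrow> (real^2) set set \<Rightarrow> bool"
  where "mesh \<Omega> T \<longleftrightarrow> triangulation T \<and> (\<forall>K\<in>T. 2 simplex K) \<and> \<Union>T = closure \<Omega>"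

definition shape_regular :: "real \<Rightarrow> (real^2) set set \<Rightarrow> bool"
  where "shape_regular \<gamma> T \<longleftrightarrow>
    (\<forall>K\<in>T. \<exists>z r. 0 < r \<and> cball z r \<subseteq> K \<and> diameter K \<le> \<gamma> * r)"

text \<open>The unit normal to the segment from \<open>a\<close> to \<open>b\<close> that points out of the convex set \<open>S\<close>, where the
  segment lies on the boundary of \<open>S\<close>.\<close>

definition outward_normal :: "(real^2) set \<Rightarrow> real^2 \<Rightarrow> real^2 \<Rightarrow> real^2"
  where "outward_normal S a b =
    (THE n. norm n = 1 \<and> n \<bullet> (b - a) = 0 \<and> (\<forall>x\<in>S. n \<bullet> (x - a) \<le> 0))"

text \<open>The arc length integral over the segment from \<open>a\<close> to \<open>b\<close>.\<close>

definition seg_integral :: "real^2 \<Rightarrow> real^2 \<Rightarrow> (real^2 \<Rightarrow> 'b::euclidean_space) \<Rightarrow> 'b"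
  where "seg_integral a b g = dist a b *\<^sub>R integral {0..1} (\<lambda>t. g (linepath a b t))"

text \<open>The trace at \<open>x\<close>, possibly on the boundary of \<open>K\<close>, of the restriction of \<open>v\<close> to \<open>K\<close>.\<close>

definition tr :: "(real^2) set \<Rightarrow> (real^2 \<Rightarrow> 'b::t2_space) \<Rightarrow> real^2 \<Rightarrow> 'b"
  where "tr K v x = Lim (at x within interior K) v"


section \<open>Elementwise differential operators\<close>

definition pdh :: "(real^2) set set \<Rightarrow> 2 \<Rightarrow> (real^2 \<Rightarrow> real) \<Rightarrow> real^2 \<Rightarrow> real"
  where "pdh T i v x = (if x \<in> (\<Union>K\<in>T. interior K) then pd i v x else 0)"

definition gradh :: "(real^2) set set \<Rightarrow> (real^2 \<Rightarrow> real) \<Rightarrow> real^2 \<Rightarrow> real^2"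
  where "gradh T v x = (\<chi> i. pdh T i v x)"

definition hessh :: "(real^2) set set \<Rightarrow> (real^2 \<Rightarrow> real) \<Rightarrow> real^2 \<Rightarrow> real^2^2"
  where "hessh T v x = (\<chi> i j. pdh T i (pdh T j v) x)"

definition curlh :: "(real^2) set set \<Rightarrow> (real^2 \<Rightarrow> real) \<Rightarrow> real^2 \<Rightarrow> real^2"
  where "curlh T v x = vector [pdh T 2 v x, - pdh T 1 v x]"

definition vgradh :: "(real^2) set set \<Rightarrow> (real^2 \<Rightarrow> real^2) \<Rightarrow> real^2 \<Rightarrow> real^2^2"
  where "vgradh T v x = (\<chi> i j. pdh T j (\<lambda>y. v y $ i) x)"

definition divh :: "(real^2) set set \<Rightarrow> (real^2 \<Rightarrow> real^2) \<Rightarrow> real^2 \<Rightarrow> real"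
  where "divh T v x = (\<Sum>i\<in>UNIV. pdh T i (\<lambda>y. v y $ i) x)"

definition a_h :: "(real^2) set \<Rightarrow> (real^2) set set \<Rightarrow> (real^2 \<Rightarrow> real) \<Rightarrow> (real^2 \<Rightarrow> real) \<Rightarrow> real"
  where "a_h \<Omega> T w v = L2_inner \<Omega> (hessh T w) (hessh T v)"

definition b_h :: "(real^2) set \<Rightarrow> (real^2) set set \<Rightarrow> (real^2 \<Rightarrow> real) \<Rightarrow> (real^2 \<Rightarrow> real) \<Rightarrow> real"
  where "b_h \<Omega> T w v = L2_inner \<Omega> (gradh T w) (gradh T v)"


section \<open>Finite element spaces\<close>

text \<open>Functions that agree on \<open>S\<close> with a polynomial of total degree at most \<open>k\<close>. It is used with
  \<open>S\<close> the interior of an element.\<close>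

definition Poly_on :: "nat \<Rightarrow> (real^2) set \<Rightarrow> (real^2 \<Rightarrow> real) set"
  where "Poly_on k S =
    {v. \<exists>c. \<forall>x\<in>S. v x = (\<Sum>i\<le>k. \<Sum>j\<le>k - i. c i j * (x $ 1) ^ i * (x $ 2) ^ j)}"

definition Morley_tilde :: "(real^2) set set \<Rightarrow> (real^2 \<Rightarrow> real) set"
  where "Morley_tilde T = {v.
    (\<forall>K\<in>T. v \<in> Poly_on 2 (interior K)) \<and>
    (\<forall>K\<in>T. \<forall>K'\<in>T. \<forall>a. a extreme_point_of K \<and> a extreme_point_of K' \<longrightarrow> tr K v a = tr K' v a) \<and>
    (\<forall>K\<in>T. \<forall>K'\<in>T. \<forall>a b. closed_segment a b edge_of K \<and> closed_segment a b edge_of K' \<longrightarrow>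
       (let dn = (\<lambda>x. gradh T v x \<bullet> outward_normal K a b)
        in tr K dn (midpoint a b) = tr K' dn (midpoint a b)))}"

definition Morley :: "(real^2) set \<Rightarrow> (real^2) set set \<Rightarrow> (real^2 \<Rightarrow> real) set"
  where "Morley \<Omega> T = {v \<in> Morley_tilde T.
    \<forall>K\<in>T. \<forall>a. a extreme_point_of K \<and> a \<in> frontier \<Omega> \<longrightarrow> tr K v a = 0}"

definition Morley0 :: "(real^2) set \<Rightarrow> (real^2) set set \<Rightarrow> (real^2 \<Rightarrow> real) set"
  where "Morley0 \<Omega> T = {v \<in> Morley \<Omega> T.
    \<forall>K\<in>T. \<forall>a b. closed_segment a b edge_of K \<and> closed_segment a b \<subseteq> frontier \<Omega> \<longrightarrow>
      seg_integral a b (tr K (\<lambda>x. gradh T v x \<bullet> outward_normal \<Omega> a b)) = 0}"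

definition Lagrange :: "(real^2) set \<Rightarrow> (real^2) set set \<Rightarrow> nat \<Rightarrow> (real^2 \<Rightarrow> real) set"
  where "Lagrange \<Omega> T l = {v \<in> H10 \<Omega>. \<forall>K\<in>T. v \<in> Poly_on l (interior K)}"

definition CR :: "(real^2) set \<Rightarrow> (real^2) set set \<Rightarrow> (real^2 \<Rightarrow> real^2) set"
  where "CR \<Omega> T = {v \<in> L2 \<Omega>.
    (\<forall>K\<in>T. \<forall>i. (\<lambda>x. v x $ i) \<in> Poly_on 1 (interior K)) \<and>
    (\<forall>K\<in>T. \<forall>K'\<in>T. \<forall>a b. K \<noteq> K' \<and> closed_segment a b edge_of K \<and> closed_segment a b edge_of K' \<longrightarrow>
       seg_integral a b (\<lambda>x. tr K v x - tr K' v x) = 0) \<and>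
    (\<forall>K\<in>T. \<forall>a b. closed_segment a b edge_of K \<and> closed_segment a b \<subseteq> frontier \<Omega> \<longrightarrow>
       seg_integral a b (\<lambda>x. tr K v x \<bullet> outward_normal \<Omega> a b) = 0)}"

definition CR0 :: "(real^2) set \<Rightarrow> (real^2) set set \<Rightarrow> (real^2 \<Rightarrow> real^2) set"
  where "CR0 \<Omega> T = {v \<in> CR \<Omega> T.
    \<forall>K\<in>T. \<forall>a b. closed_segment a b edge_of K \<and> closed_segment a b \<subseteq> frontier \<Omega> \<longrightarrow>
      seg_integral a b (tr K v) = 0}"

definition Qh :: "(real^2) set \<Rightarrow> (real^2) set set \<Rightarrow> (real^2 \<Rightarrow> real) set"
  where "Qh \<Omega> T = {q. (\<forall>K\<in>T. q constant_on interior K) \<and> (LINT x:\<Omega>|lebesgue. q x) = 0}"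

end

theory Submission
  imports Defs
begin

text \<open>The integrals over edges that define the nonconforming spaces are midpoint values, because the
  integrands are affine. In these terms the rotated gradient maps \<^const>\<open>Morley0\<close> onto the fields
  in \<^const>\<open>CR0\<close> with vanishing elementwise divergence: such a field is a rotated gradient of
  quadratics on the elements, whose differences of vertex values agree along common edges; since the
  domain is convex the piecewise affine interpolants glue to a global potential, which is constant on
  the boundary. The rotated gradient of the solution of the original problem is therefore the
  velocity of the Brinkman problem, tested with all divergence-free fields. The existence of the
  pressure and of \<open>z\<close> is linear algebra: a functional that vanishes on the common kernel of finitely
  many functionals lies in their span, and a form of finite rank admits Riesz representation.\<close>

section \<open>Finitely many functionals on a space of functions\<close>

text \<open>Members of the discrete spaces are free on the skeleton of the mesh, so as sets of total
  functions these spaces are infinite-dimensional. The linear algebra therefore counts functionals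
  instead of dimensions, and fields are compared only inside the elements. Morley functions jump
  across edges, so the quadratic pieces themselves cannot be glued. What matches is the difference
  of the endpoint values of an edge: the midpoint rule is exact for the affine gradient, and
  membership in \<open>CR0\<close> means agreement at edge midpoints. In the converse direction the
  last equation fixes only the gradient of \<open>u\<close>. The divergence of \<open>\<phi>\<close>
  has mean zero, so it may be tested with itself and vanishes pointwise; hence \<open>\<phi>\<close>
  has a potential \<open>v0\<close> in \<open>Morley0\<close>. Testing with \<open>u - v0\<close>
  gives equal gradients, and the condition that singles out \<open>Morley0\<close> inside
  \<open>Morley\<close> concerns the gradient alone.\<close>

definition fun_subspace :: "('a \<Rightarrow> 'b::real_vector) set \<Rightarrow> bool"
  where "fun_subspace X \<longleftrightarrow> X \<noteq> {} \<and> (\<forall>u\<in>X. \<forall>v\<in>X. \<forall>c. (\<lambda>x. u x + c *\<^sub>R v x) \<in> X)"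

definition linear_form_on :: "('a \<Rightarrow> 'b::real_vector) set \<Rightarrow> (('a \<Rightarrow> 'b) \<Rightarrow> real) \<Rightarrow> bool"
  where "linear_form_on X f \<longleftrightarrow> (\<forall>u\<in>X. \<forall>v\<in>X. \<forall>c. f (\<lambda>x. u x + c *\<^sub>R v x) = f u + c * f v)"

lemma fun_subspaceD:
  "fun_subspace X \<Longrightarrow> u \<in> X \<Longrightarrow> v \<in> X \<Longrightarrow> (\<lambda>x. u x + c *\<^sub>R v x) \<in> X"
  by (auto simp: fun_subspace_def)

lemma linear_form_onD:
  "linear_form_on X f \<Longrightarrow> u \<in> X \<Longrightarrow> v \<in> X \<Longrightarrow> f (\<lambda>x. u x + c *\<^sub>R v x) = f u + c * f v"
  by (auto simp: linear_form_on_def)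

lemma linear_form_on_zero:
  assumes "linear_form_on X f" "u \<in> X"
  shows "f (\<lambda>x. 0) = 0"
  using linear_form_onD[OF assms(1,2,2), of "-1"] by simp

text \<open>Induction on the functionals: if \<open>G\<close> does not already vanish on the common
  kernel of the others, a multiple of \<open>f j\<close> is subtracted so that it does, and the
  induction hypothesis applies to the difference.\<close>

lemma linear_form_in_span:
  assumes "finite I" "fun_subspace X" "\<forall>i\<in>I. linear_form_on X (f i)" "linear_form_on X G"
    and "\<forall>u\<in>X. (\<forall>i\<in>I. f i u = 0) \<longrightarrow> G u = 0"
  shows "\<exists>c. \<forall>u\<in>X. G u = (\<Sum>i\<in>I. c i * f i u)"
  using assms
proof (induction I arbitrary: G)
  case empty
  then show ?case by auto
next
  case (insert j I)
  show ?case
  proof (cases "\<forall>u\<in>X. (\<forall>i\<in>I. f i u = 0) \<longrightarrow> G u = 0")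
    case True
    then have "\<exists>c. \<forall>u\<in>X. G u = (\<Sum>i\<in>I. c i * f i u)"
      using insert.prems(1-3) by (intro insert.IH) blast+
    then obtain c where c: "\<forall>u\<in>X. G u = (\<Sum>i\<in>I. c i * f i u)" ..
    have "\<forall>u\<in>X. G u = (\<Sum>i\<in>insert j I. (c(j := 0)) i * f i u)"
    proof
      fix u assume "u \<in> X"
      have "(\<Sum>i\<in>I. c i * f i u) = (\<Sum>i\<in>I. (c(j := 0)) i * f i u)"
        by (rule sum.cong) (use insert.hyps in auto)
      then show "G u = (\<Sum>i\<in>insert j I. (c(j := 0)) i * f i u)"
        using c \<open>u \<in> X\<close> insert.hyps by simp
    qed
    then show ?thesis by blast
  next
    case False
    then obtain e where e: "e \<in> X" "\<forall>i\<in>I. f i e = 0" "G e \<noteq> 0" by auto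
    then have fe: "f j e \<noteq> 0" using insert.prems by auto
    \<comment> \<open>\<open>e\<close> lies in the kernel of every functional but
      \<open>f j\<close>, and this multiple of \<open>f j\<close> is the one that makes
      \<open>G'\<close> vanish at \<open>e\<close>.\<close>
    define G' where "G' u = G u - (G e / f j e) * f j u" for u
    have "linear_form_on X G'"
      unfolding linear_form_on_def
    proof (intro ballI allI)
      fix u v c assume "u \<in> X" "v \<in> X"
      then have "G (\<lambda>x. u x + c *\<^sub>R v x) = G u + c * G v"
        "f j (\<lambda>x. u x + c *\<^sub>R v x) = f j u + c * f j v"
        using insert.prems(2,3) by (blast intro: linear_form_onD)+
      then show "G' (\<lambda>x. u x + c *\<^sub>R v x) = G' u + c * G' v"
        unfolding G'_def by (simp only: ring_distribs) (simp add: algebra_simps)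
    qed
    moreover have "G' u = 0" if u: "u \<in> X" "\<forall>i\<in>I. f i u = 0" for u
    proof -
      \<comment> \<open>Projection of \<open>u\<close> along \<open>e\<close> into the kernel of
        \<open>f j\<close>; it stays in the other kernels, so \<open>G r = 0\<close>.\<close>
      define r where "r = (\<lambda>x. u x + (- f j u / f j e) *\<^sub>R e x)"
      have lin: "g r = g u + (- f j u / f j e) * g e" if "linear_form_on X g" for g
        unfolding r_def by (rule linear_form_onD[OF that u(1) e(1)])
      have "r \<in> X" unfolding r_def using insert.prems(1) u(1) e(1) by (rule fun_subspaceD)
      moreover have "f i r = 0" if i: "i \<in> insert j I" for i
      proof -
        have "f i r = f i u + (- f j u / f j e) * f i e"
          using insert.prems(2) i by (intro lin) blast
        then show ?thesis using u e fe i by (cases "i = j") auto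
      qed
      ultimately have "G r = 0" using insert.prems(4) by blast
      moreover have "G r = G u + (- f j u / f j e) * G e" by (rule lin[OF insert.prems(3)])
      ultimately show ?thesis using fe by (simp add: G'_def field_simps)
    qed
    ultimately have "\<exists>c. \<forall>u\<in>X. G' u = (\<Sum>i\<in>I. c i * f i u)"
      using insert.prems(1,2) by (intro insert.IH) blast+
    then obtain c where c: "\<forall>u\<in>X. G' u = (\<Sum>i\<in>I. c i * f i u)" ..
    let ?c = "c(j := G e / f j e)"
    have "\<forall>u\<in>X. G u = (\<Sum>i\<in>insert j I. ?c i * f i u)"
    proof
      fix u assume "u \<in> X"
      have "(\<Sum>i\<in>I. c i * f i u) = (\<Sum>i\<in>I. ?c i * f i u)"
        by (rule sum.cong) (use insert.hyps in auto)
      moreover have "G u = G' u + (G e / f j e) * f j u" by (simp add: G'_def)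
      ultimately show "G u = (\<Sum>i\<in>insert j I. ?c i * f i u)"
        using c \<open>u \<in> X\<close> insert.hyps by simp
    qed
    then show ?thesis by blast
  qed
qed

text \<open>Finite dimension enters only through the finitely many functionals \<open>f i\<close>, whose common
  kernel is contained in the kernel of \<open>A\<close>.\<close>

lemma finite_rank_Riesz:
  assumes "finite I" "fun_subspace X" "\<forall>i\<in>I. linear_form_on X (f i)" "linear_form_on X \<l>"
    and "\<forall>u\<in>X. linear_form_on X (A u)" "\<forall>u\<in>X. \<forall>v\<in>X. A u v = A v u"
    and "\<forall>u\<in>X. (\<forall>i\<in>I. f i u = 0) \<longrightarrow> A u u = 0"
    and "\<forall>u\<in>X. A u u = 0 \<longrightarrow> \<l> u = 0 \<and> (\<forall>v\<in>X. A u v = 0)"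
  shows "\<exists>z\<in>X. \<forall>v\<in>X. A z v = \<l> v"
  using assms
proof (induction I arbitrary: X \<l>)
  case empty
  \<comment> \<open>With no functionals left every element has zero energy, so \<open>A\<close> and
    \<open>\<l>\<close> vanish and any element is a solution.\<close>
  obtain u where u: "u \<in> X" using empty.prems(1) by (auto simp: fun_subspace_def)
  have "\<l> v = 0 \<and> A v v = 0" if v: "v \<in> X" for v
    using bspec[OF empty.prems(6) v] bspec[OF empty.prems(7) v] by blast
  moreover have "\<forall>v\<in>X. A u v = 0"
    using bspec[OF empty.prems(6) u] bspec[OF empty.prems(7) u] by blast
  ultimately have "\<forall>v\<in>X. A u v = \<l> v" by simp
  then show ?case using u by (rule bexI)
next
  case (insert j I)
  note X = insert.prems(1) and f = insert.prems(2) and l = insert.prems(3)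
    and A = insert.prems(4) and sym = insert.prems(5)
  have null_l: "\<forall>u\<in>X. A u u = 0 \<longrightarrow> \<l> u = 0" 
  proof (intro ballI impI)
    fix u assume "u \<in> X" "A u u = 0"
    then show "\<l> u = 0" using bspec[OF insert.prems(7), of u] by blast
  qed
  have null: "A u v = 0" if "A u u = 0" "u \<in> X" "v \<in> X" for u v
    using bspec[OF insert.prems(7) that(2)] that(1,3) by blast
  define Y where "Y = {u\<in>X. f j u = 0}"
  have symD: "A u v = A v u" if "u \<in> X" "v \<in> X" for u v 
    by (rule bspec[OF bspec[OF sym that(1)] that(2)])
  have YX: "Y \<subseteq> X" by (auto simp: Y_def)
  obtain u0 where u0: "u0 \<in> X" using X by (auto simp: fun_subspace_def)
  have fj: "linear_form_on X (f j)" using f by blast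
  have Y: "fun_subspace Y"
    unfolding fun_subspace_def
  proof (intro conjI ballI allI)
    have "(\<lambda>x. u0 x + (-1) *\<^sub>R u0 x) \<in> X" by (rule fun_subspaceD[OF X u0 u0])
    then show "Y \<noteq> {}" using linear_form_on_zero[OF fj u0] by (auto simp: Y_def)
    fix u v c assume "u \<in> Y" "v \<in> Y"
    then have uv: "u \<in> X" "v \<in> X" "f j u = 0" "f j v = 0" by (auto simp: Y_def)
    then have "f j (\<lambda>x. u x + c *\<^sub>R v x) = 0" using linear_form_onD[OF fj uv(1,2)] by simp
    then show "(\<lambda>x. u x + c *\<^sub>R v x) \<in> Y" using fun_subspaceD[OF X uv(1,2)] by (simp add: Y_def)
  qed
  have sub: "linear_form_on Y g" if "linear_form_on X g" for g
    unfolding linear_form_on_def using linear_form_onD[OF that] YX by blast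
  \<comment> \<open>The induction hypothesis on the kernel \<open>Y\<close> of \<open>f j\<close> is
    kept for a general right-hand side because it serves twice: for \<open>\<l>\<close> and for
    \<open>A e\<close>.\<close>
  have ex: "\<exists>z\<in>Y. \<forall>v\<in>Y. A z v = g v"
    if "linear_form_on X g" "\<forall>u\<in>X. A u u = 0 \<longrightarrow> g u = 0" for g
  proof (rule insert.IH[OF Y])
    show "\<forall>i\<in>I. linear_form_on Y (f i)" using f sub by auto
    show "linear_form_on Y g" using sub that by auto
    show "\<forall>u\<in>Y. linear_form_on Y (A u)" using A sub YX by auto
    show "\<forall>u\<in>Y. \<forall>v\<in>Y. A u v = A v u" using symD YX by blast
    show "\<forall>u\<in>Y. (\<forall>i\<in>I. f i u = 0) \<longrightarrow> A u u = 0" using insert.prems(6) by (auto simp: Y_def)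
    show "\<forall>u\<in>Y. A u u = 0 \<longrightarrow> g u = 0 \<and> (\<forall>v\<in>Y. A u v = 0)" 
    proof (intro ballI impI conjI)
      fix u v assume u: "u \<in> Y" "A u u = 0"
      then have uX: "u \<in> X" using YX by blast
      then show "g u = 0" using that(2) u(2) by blast
      fix v assume "v \<in> Y"
      then show "A u v = 0" using null[OF u(2) uX] YX by blast
    qed
  qed
  obtain z0 where z0: "z0 \<in> Y" "\<forall>v\<in>Y. A z0 v = \<l> v" 
    by (rule bexE[OF ex[OF l null_l]])
  show ?case
  proof (cases "\<forall>u\<in>X. f j u = 0")
    case True
    then have "Y = X" by (auto simp: Y_def)
    then show ?thesis using z0 by blast
  next
    case False
    then obtain e where e: "e \<in> X" "f j e \<noteq> 0" by auto
    have "A e u = 0" if "A u u = 0" "u \<in> X" for u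
      unfolding symD[OF e(1) that(2)] using that e(1) by (rule null)
    moreover have "linear_form_on X (A e)" using A e(1) by blast
    ultimately obtain e0 where e0: "e0 \<in> Y" "\<forall>v\<in>Y. A e0 v = A e v" using ex[of "A e"] by blast
    have e0X: "e0 \<in> X" using e0 YX by auto
    \<comment> \<open>Gram-Schmidt: \<open>e\<close> minus its projection onto \<open>Y\<close> is
      \<open>A\<close>-orthogonal to \<open>Y\<close>, so a multiple of \<open>d\<close> can be
      added to \<open>z0\<close> without disturbing the equations on \<open>Y\<close>.\<close>
    define d where "d = (\<lambda>x. e x + (-1) *\<^sub>R e0 x)"
    have dX: "d \<in> X" unfolding d_def by (rule fun_subspaceD[OF X e(1) e0X])
    have fd: "f j d = f j e"
      unfolding d_def linear_form_onD[OF fj e(1) e0X] using e0(1) by (simp add: Y_def)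
    have dY: "A d v = 0" if "v \<in> Y" for v
    proof -
      have v: "v \<in> X" using that YX by auto
      have "A v d = A v e + (-1) * A v e0"
        unfolding d_def by (rule linear_form_onD[OF bspec[OF A v] e(1) e0X])
      then show ?thesis
        using e0(2) that unfolding symD[OF v e(1)] symD[OF v e0X] symD[OF v dX] by simp
    qed
    have decomp: "\<exists>y\<in>Y. v = (\<lambda>x. y x + (f j v / f j e) *\<^sub>R d x)" if v: "v \<in> X" for v
    proof
      let ?y = "\<lambda>x. v x + (- f j v / f j e) *\<^sub>R d x"
      have "f j ?y = f j v + (- f j v / f j e) * f j d"
        by (rule linear_form_onD[OF fj v dX])
      then have "f j ?y = 0" unfolding fd using e(2) by simp
      then show "?y \<in> Y" using fun_subspaceD[OF X v dX] unfolding Y_def by blast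
      show "v = (\<lambda>x. ?y x + (f j v / f j e) *\<^sub>R d x)" by auto
    qed
    define z where "z = (\<lambda>x. z0 x + (\<l> d / A d d) *\<^sub>R d x)"
    have z0X: "z0 \<in> X" using z0 YX by auto
    have zX: "z \<in> X" unfolding z_def by (rule fun_subspaceD[OF X z0X dX])
    have Az: "A z v = A z0 v + (\<l> d / A d d) * A d v" if v: "v \<in> X" for v
    proof -
      have "A v z = A v z0 + (\<l> d / A d d) * A v d"
        unfolding z_def by (rule linear_form_onD[OF bspec[OF A v] z0X dX])
      then show ?thesis
        unfolding symD[OF zX v] symD[OF z0X v] symD[OF dX v] .
    qed
    have "A z0 d = 0" unfolding symD[OF z0X dX] by (rule dY[OF z0(1)])
    \<comment> \<open>If \<open>d\<close> has zero energy, the quotient in \<open>z\<close> is 0 by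
      convention, and the equation at \<open>d\<close> still holds because
      \<open>\<l> d = 0\<close>.\<close>
    moreover have "A d d = 0 \<Longrightarrow> \<l> d = 0" using null_l dX by blast
    ultimately have zd: "A z d = \<l> d" unfolding Az[OF dX] by (cases "A d d = 0") simp_all
    have "A z v = \<l> v" if v: "v \<in> X" for v
    proof (rule bexE[OF decomp[OF v]])
      fix y assume y: "y \<in> Y" and v_eq: "v = (\<lambda>x. y x + (f j v / f j e) *\<^sub>R d x)"
      define t where "t = f j v / f j e"
      have vt: "v = (\<lambda>x. y x + t *\<^sub>R d x)" using v_eq unfolding t_def .
      have yX: "y \<in> X" using y YX by (rule subsetD[rotated])
      have Azlin: "linear_form_on X (A z)" using A zX by (rule bspec)
      have "A z v = A z y + t * A z d"
        unfolding vt by (rule linear_form_onD[OF Azlin yX dX])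
      also have "A z y = \<l> y" unfolding Az[OF yX] dY[OF y] bspec[OF z0(2) y] by simp
      also have "\<l> y + t * A z d = \<l> v"
        unfolding vt linear_form_onD[OF l yX dX] zd ..
      finally show "A z v = \<l> v" .
    qed
    then show ?thesis using zX by blast
  qed
qed

section \<open>Potentials of piecewise constant fields\<close>

text \<open>In \<open>S\<close> the preimage of any set of values is a finite union of closed
  pieces, so \<open>F\<close> is continuous there and has finitely many values. It is applied to
  segments that cross the mesh and to the boundary of the domain.\<close>

lemma constant_on_finite_closed_cover:
  fixes F :: "'a::topological_space \<Rightarrow> real"
  assumes "connected S" "finite \<C>" "\<And>C. C \<in> \<C> \<Longrightarrow> closed C" "S \<subseteq> \<Union>\<C>"
    and const: "\<And>C x y. C \<in> \<C> \<Longrightarrow> x \<in> C \<inter> S \<Longrightarrow> y \<in> C \<inter> S \<Longrightarrow> F x = F y"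
  shows "F constant_on S"
proof (rule continuous_finite_range_constant[OF \<open>connected S\<close>])
  have "\<forall>C\<in>\<C>. \<exists>k. \<forall>x\<in>C \<inter> S. F x = k" using const by blast
  then obtain k where k: "\<And>C x. C \<in> \<C> \<Longrightarrow> x \<in> C \<inter> S \<Longrightarrow> F x = k C" by metis
  have "F ` S \<subseteq> k ` \<C>" using k \<open>S \<subseteq> \<Union>\<C>\<close> by fastforce
  then show "finite (F ` S)" using \<open>finite \<C>\<close> finite_surj by blast
  have "closedin (top_of_set S) {x\<in>S. F x \<in> B}" for B
  proof -
    have "{x\<in>S. F x \<in> B} = S \<inter> \<Union>{C\<in>\<C>. k C \<in> B}" using k \<open>S \<subseteq> \<Union>\<C>\<close> by fastforce
    moreover have "closed (\<Union>{C\<in>\<C>. k C \<in> B})" using assms by (intro closed_Union) auto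
    ultimately show ?thesis by (simp add: closedin_closed_Int)
  qed
  then show "continuous_on S F"
    by (simp add: continuous_on_closed_vimage continuous_closedin_preimage_eq vimage_def Int_def
        conj_commute)
qed

text \<open>Around a point \<open>a\<close> the field has the potential \<open>x \<mapsto> g K \<bullet> (x - a)\<close>. Local potentials differ by
  constants; a Lebesgue number for the neighbourhoods and summation of their increments along
  subdivided segments from a base point glue them on a convex set.\<close>

lemma convex_piecewise_potential:
  fixes g :: "'a::euclidean_space set \<Rightarrow> 'a"
  assumes S: "convex S" "compact S" and T: "finite T" "\<Union>T = S"
    and KT: "\<And>K. K \<in> T \<Longrightarrow> closed K \<and> convex K"
    and compat: "\<And>K K' x y. K \<in> T \<Longrightarrow> K' \<in> T \<Longrightarrow> x \<in> K \<inter> K' \<Longrightarrow> y \<in> K \<inter> K' \<Longrightarrow>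
       g K \<bullet> (y - x) = g K' \<bullet> (y - x)"
  shows "\<exists>F. \<forall>K\<in>T. \<forall>x\<in>K. \<forall>y\<in>K. F y - F x = g K \<bullet> (y - x)"
proof (cases "S = {}")
  case True
  then show ?thesis using T by auto
next
  case False
  then obtain x0 where x0: "x0 \<in> S" by auto
  \<comment> \<open>Finitely many closed elements: a small ball around \<open>a\<close> meets only
    elements that contain \<open>a\<close>.\<close>
  have "\<exists>r>0. \<forall>K\<in>T. K \<inter> ball a r \<noteq> {} \<longrightarrow> a \<in> K" for a
  proof -
    have "closed (\<Union>{K\<in>T. a \<notin> K})" using T KT by (intro closed_Union) auto
    then obtain r where "r > 0" "ball a r \<subseteq> - \<Union>{K\<in>T. a \<notin> K}"
      using openE[of "- \<Union>{K\<in>T. a \<notin> K}" a] by (auto simp: open_closed)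
    then show ?thesis by (intro exI[of _ r]) blast
  qed
  then obtain r where r: "\<And>a. r a > 0" "\<And>a K. K \<in> T \<Longrightarrow> K \<inter> ball a (r a) \<noteq> {} \<Longrightarrow> a \<in> K"
    by metis
  \<comment> \<open>The choice of the element is immaterial in the ball around \<open>a\<close>: all
    candidates contain both \<open>a\<close> and \<open>x\<close>, where compatibility
    applies.\<close>
  define P where "P a x = g (SOME K. K \<in> T \<and> x \<in> K) \<bullet> (x - a)" for a x
  have P: "P a x = g K \<bullet> (x - a)" if "K \<in> T" "x \<in> K" "x \<in> ball a (r a)" for a x K
  proof -
    let ?K = "SOME K. K \<in> T \<and> x \<in> K"
    have "?K \<in> T \<and> x \<in> ?K" by (rule someI[of _ K]) (use that in auto)
    then have "?K \<in> T" "x \<in> K \<inter> ?K" "a \<in> K \<inter> ?K" using that r(2)[of _ a] by blast+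
    then show ?thesis unfolding P_def using compat[of ?K K a x] that by auto
  qed
  have indep: "P a y - P a x = P b y - P b x"
    if xy: "x \<in> S" "y \<in> S" and a: "x \<in> ball a (r a)" "y \<in> ball a (r a)"
      and b: "x \<in> ball b (r b)" "y \<in> ball b (r b)" for a b x y
  proof -
    let ?L = "closed_segment x y"
    have L: "?L \<subseteq> S" "?L \<subseteq> ball a (r a)" "?L \<subseteq> ball b (r b)"
      using xy a b S by (auto simp: closed_segment_subset)
    \<comment> \<open>On one element the difference of the two local potentials does not depend on
      the point. Connectedness carries this along the segment, which convexity keeps inside
      \<open>S\<close> and both balls.\<close>
    have "(\<lambda>x. P a x - P b x) constant_on ?L"
    proof (rule constant_on_finite_closed_cover[of _ T])
      fix K u v assume K: "K \<in> T" "u \<in> K \<inter> ?L" "v \<in> K \<inter> ?L"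
      then have "P a u = g K \<bullet> (u - a)" "P b u = g K \<bullet> (u - b)"
         "P a v = g K \<bullet> (v - a)" "P b v = g K \<bullet> (v - b)"
        using L by (auto intro!: P)
      then show "P a u - P b u = P a v - P b v" by (simp add: inner_diff_right)
    qed (use T KT L in auto)
    then have "P a x - P b x = P a y - P b y" unfolding constant_on_def by force
    then show ?thesis by simp
  qed
  have "S \<subseteq> \<Union>((\<lambda>a. ball a (r a)) ` UNIV)" 
  proof
    fix x :: 'a
    have "x \<in> ball x (r x)" using r(1) by simp
    then show "x \<in> \<Union>((\<lambda>a. ball a (r a)) ` UNIV)" by blast
  qed
  then obtain e where e: "e > 0" "\<forall>x\<in>S. \<exists>G\<in>(\<lambda>a. ball a (r a)) ` UNIV. ball x e \<subseteq> G"
    by (rule Heine_Borel_lemma[OF S(2)]) auto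
  then have "\<exists>\<alpha>. \<forall>x\<in>S. ball x e \<subseteq> ball (\<alpha> x) (r (\<alpha> x))" by (intro bchoice) auto
  then obtain \<alpha> where \<alpha>: "\<And>x. x \<in> S \<Longrightarrow> ball x e \<subseteq> ball (\<alpha> x) (r (\<alpha> x))" by blast
  \<comment> \<open>The increment of any local potential whose ball contains both points; the ball
    that the Lebesgue number assigns to \<open>x\<close> is used as representative.\<close>
  define D where "D x y = P (\<alpha> x) y - P (\<alpha> x) x" for x y
  have D: "D x y = P b y - P b x"
    if "x \<in> S" "y \<in> S" "dist x y < e" "x \<in> ball b (r b)" "y \<in> ball b (r b)" for x y b
  proof -
    have "x \<in> ball (\<alpha> x) (r (\<alpha> x))" "y \<in> ball (\<alpha> x) (r (\<alpha> x))"
      using subsetD[OF \<alpha>[OF that(1)]] that(3) e(1) by auto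
    then show ?thesis unfolding D_def using that by (intro indep) auto
  qed
  have coc: "D x y + D y z = D x z"
    if "x \<in> S" "y \<in> S" "z \<in> S" "dist x y < e" "dist x z < e" "dist y z < e" for x y z
  proof -
    have in_ball: "x \<in> ball (\<alpha> x) (r (\<alpha> x))" "y \<in> ball (\<alpha> x) (r (\<alpha> x))" "z \<in> ball (\<alpha> x) (r (\<alpha> x))"
      using subsetD[OF \<alpha>[OF that(1)]] that(4,5) e(1) by auto
    show ?thesis using D[of x y "\<alpha> x"] D[of y z "\<alpha> x"] D[of x z "\<alpha> x"] that in_ball by simp
  qed
  \<comment> \<open>The added 1 keeps \<open>B\<close> positive when \<open>S\<close> is a single
    point.\<close>
  define B where "B = diameter S + 1"
  have B: "B > 0" "\<And>x y. x \<in> S \<Longrightarrow> y \<in> S \<Longrightarrow> dist x y \<le> B"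
    using diameter_bounded_bound[OF compact_imp_bounded[OF S(2)]] diameter_ge_0[of S] S(2)
    by (auto simp: B_def compact_imp_bounded add_increasing2 intro: add_nonneg_pos)
  \<comment> \<open>The bound \<open>e / 2\<close> lets one step along a segment and one rung
    between two segments add up to a diagonal shorter than \<open>e\<close>, within reach of
    \<open>coc\<close>.\<close>
  obtain N :: nat where N: "N > 0" "B / N < e / 2"
  proof -
    obtain N :: nat where "N > B / (e / 2)" using reals_Archimedean2 by blast
    moreover have "B / (e/2) > 0" using B e by auto
    ultimately have "real N > 0" "B / (e/2) < N" by auto
    then have "N > 0" "B / N < e / 2" using e(1) by (auto simp: field_simps)
    then show ?thesis using that by blast
  qed
  define p where "p x i = x0 + (real i / N) *\<^sub>R (x - x0)" for x i
  have pS: "p x i \<in> S" if "x \<in> S" "i \<le> N" for x i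
  proof -
    have "p x i = (1 - real i / N) *\<^sub>R x0 + (real i / N) *\<^sub>R x"
      by (simp add: p_def algebra_simps)
    then show ?thesis using that x0 S(1) N by (simp add: convexD)
  qed
  have p0: "p x 0 = x0" and pN: "p x N = x" for x using N by (auto simp: p_def)
  have p_step: "dist (p x i) (p x (Suc i)) < e/2" if "x \<in> S" for x i
  proof -
    have "p x (Suc i) - p x i = (1 / N) *\<^sub>R (x - x0)"
      by (simp add: p_def algebra_simps add_divide_distrib scaleR_add_left)
    then have "dist (p x i) (p x (Suc i)) = dist x x0 / N"
      by (metis (no_types) abs_of_nonneg dist_commute dist_norm divide_nonneg_nonneg mult.left_neutral
          norm_scaleR of_nat_0_le_iff times_divide_eq_left zero_le_one)
    also have "\<dots> \<le> B / N" using B that x0 by (intro divide_right_mono) auto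
    finally show ?thesis using N(2) by linarith
  qed
  have p_dist: "dist (p x i) (p y i) \<le> dist x y" if "i \<le> N" for x y i
  proof -
    have "p x i - p y i = (real i / N) *\<^sub>R (x - y)" by (simp add: p_def algebra_simps)
    then have "dist (p x i) (p y i) = (real i / N) * dist x y" by (simp add: dist_norm)
    also have "\<dots> \<le> 1 * dist x y" using that N by (intro mult_right_mono) auto
    finally show ?thesis by simp
  qed
  define F where "F x = (\<Sum>i<N. D (p x i) (p x (Suc i)))" for x
  have F: "F y - F x = D x y" if xy: "x \<in> S" "y \<in> S" "dist x y < e/2" for x y
  proof -
    \<comment> \<open>A diagonal splits each quadrilateral between the segments to \<open>x\<close>
      and to \<open>y\<close> into two triangles that satisfy \<open>coc\<close>. The sum over
      \<open>i\<close> then telescopes to the last rung, the rung at \<open>x0\<close> being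
      0.\<close>
    have "D (p y i) (p y (Suc i)) - D (p x i) (p x (Suc i))
        = D (p x (Suc i)) (p y (Suc i)) - D (p x i) (p y i)" if "i < N" for i
    proof -
      have i: "p x i \<in> S" "p x (Suc i) \<in> S" "p y i \<in> S" "p y (Suc i) \<in> S" using pS xy that by auto
      have d: "dist (p x i) (p y i) < e/2" "dist (p x (Suc i)) (p y (Suc i)) < e/2"
         "dist (p x i) (p x (Suc i)) < e/2" "dist (p y i) (p y (Suc i)) < e/2"
        using p_dist[of i x y] p_dist[of "Suc i" x y] p_step[OF xy(1)] p_step[OF xy(2)] xy(3) that
        by (auto intro: le_less_trans)
      have "dist (p x i) (p y (Suc i)) < e" using d dist_triangle[of "p x i" "p y (Suc i)" "p y i"] by linarith
      then have "D (p x i) (p y i) + D (p y i) (p y (Suc i)) = D (p x i) (p y (Suc i))"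
        using d e(1) by (intro coc[OF i(1,3,4)]) linarith+
      moreover from \<open>dist (p x i) (p y (Suc i)) < e\<close>
      have "D (p x i) (p x (Suc i)) + D (p x (Suc i)) (p y (Suc i)) = D (p x i) (p y (Suc i))"
        using d e(1) by (intro coc[OF i(1,2,4)]) linarith+
      ultimately show ?thesis by linarith
    qed
    then have "F y - F x = (\<Sum>i<N. D (p x (Suc i)) (p y (Suc i)) - D (p x i) (p y i))"
      unfolding F_def sum_subtractf[symmetric] by (intro sum.cong) auto
    also have "\<dots> = D x y - D x0 x0"
      by (subst sum_lessThan_telescope) (simp add: p0 pN)
    finally show ?thesis by (simp add: D_def)
  qed
  have "F y - F x = g K \<bullet> (y - x)" if K: "K \<in> T" "x \<in> K" "y \<in> K" for K x y
  proof -
    have near: "F v - F u = g K \<bullet> (v - u)" if "u \<in> K" "v \<in> K" "dist u v < e/2" for u v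
    proof -
      have S: "u \<in> S" "v \<in> S" using that K T by auto
      have *: "u \<in> ball (\<alpha> u) (r (\<alpha> u))" "v \<in> ball (\<alpha> u) (r (\<alpha> u))" 
        using subsetD[OF \<alpha>[OF S(1)], of u] subsetD[OF \<alpha>[OF S(1)], of v] that(3) e(1) by auto
      have "F v - F u = D u v" using F[OF S] that(3) .
      also have "\<dots> = g K \<bullet> (v - \<alpha> u) - g K \<bullet> (u - \<alpha> u)"
        unfolding D_def using P[OF K(1)] * that(1,2) by simp
      finally show ?thesis by (simp add: inner_diff_right)
    qed
    \<comment> \<open>\<open>near\<close> covers only short increments; connectedness of
      \<open>K\<close> extends them to the whole element.\<close>
    have "(\<lambda>u. F u - g K \<bullet> u) constant_on K"
    proof (rule locally_constant_imp_constant)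
      show "connected K" using KT K convex_connected by blast
      fix a assume a: "a \<in> K"
      have "F x - g K \<bullet> x = F a - g K \<bullet> a" if "x \<in> K \<inter> ball a (e/2)" for x
        using near[OF a, of x] that by (simp add: inner_diff_right)
      moreover have "openin (top_of_set K) (K \<inter> ball a (e/2))" "a \<in> K \<inter> ball a (e/2)"
        using a e(1) by (simp_all add: openin_open_Int)
      ultimately show "\<exists>U. openin (top_of_set K) U \<and> a \<in> U \<and> (\<forall>x\<in>U. F x - g K \<bullet> x = F a - g K \<bullet> a)"
        by blast
    qed
    then have "F x - g K \<bullet> x = F y - g K \<bullet> y" using K(2,3) unfolding constant_on_def by force
    then show ?thesis by (simp add: inner_diff_right)
  qed
  then show ?thesis by blast
qed

section \<open>Triangles in the plane\<close>

definition cross2 :: "real^2 \<Rightarrow> real^2 \<Rightarrow> real"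
  where "cross2 u v = u $ 1 * v $ 2 - u $ 2 * v $ 1"

text \<open>Clockwise quarter turn: it takes the gradient to the curl and also a counterclockwise
  edge vector to an outward normal.\<close>

definition rot :: "real^2 \<Rightarrow> real^2"
  where "rot v = vector [v $ 2, - v $ 1]"

lemma rot_nth [simp]: "rot v $ 1 = v $ 2" "rot v $ 2 = - v $ 1"
  by (simp_all add: rot_def)

lemma inner_2: "(u::real^2) \<bullet> v = u $ 1 * v $ 1 + u $ 2 * v $ 2"
  by (simp add: inner_vec_def sum_2)

lemma rot_inner_rot [simp]: "rot u \<bullet> rot v = u \<bullet> v"
  by (simp add: inner_2)

lemma vec2_eq_iff: "(u::real^2) = v \<longleftrightarrow> u $ 1 = v $ 1 \<and> u $ 2 = v $ 2"
  by (simp add: vec_eq_iff forall_2)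

lemma rot_eq_iff [simp]: "rot u = rot v \<longleftrightarrow> u = v"
  by (auto simp: vec2_eq_iff)

text \<open>\<open>d\<close> and \<open>rot d\<close> form an orthogonal basis of the plane, and
  \<open>n\<close> is a nonzero multiple of \<open>rot d\<close>. This merges a tangential and a
  normal condition at an edge midpoint into one vector equation.\<close>

lemma orthogonal_to_both_eq_0:
  fixes d n v :: "real^2"
  assumes "d \<noteq> 0" "n \<noteq> 0" "n \<bullet> d = 0" "v \<bullet> d = 0" "v \<bullet> n = 0"
  shows "v = 0"
proof -
  have "(d \<bullet> d) *\<^sub>R v = (v \<bullet> d) *\<^sub>R d + (v \<bullet> rot d) *\<^sub>R rot d"
    by (simp add: vec2_eq_iff inner_2 algebra_simps)
  moreover have "(d \<bullet> d) *\<^sub>R n = (n \<bullet> d) *\<^sub>R d + (n \<bullet> rot d) *\<^sub>R rot d"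
    by (simp add: vec2_eq_iff inner_2 algebra_simps)
  ultimately have v: "(d \<bullet> d) *\<^sub>R v = (v \<bullet> rot d) *\<^sub>R rot d"
    and n: "(d \<bullet> d) *\<^sub>R n = (n \<bullet> rot d) *\<^sub>R rot d" using assms by simp_all
  have "n \<bullet> rot d \<noteq> 0" using n assms by auto
  moreover have "(d \<bullet> d) * (v \<bullet> n) = (v \<bullet> rot d) * (n \<bullet> rot d)"
    using arg_cong[OF v, of "\<lambda>x. x \<bullet> n"] by (simp add: inner_commute)
  ultimately have "v \<bullet> rot d = 0" using assms by auto
  then show ?thesis using v assms by simp
qed

text \<open>Justifies the \<open>THE\<close> in the definition. A supporting functional at the
  midpoint attains its minimum over the closure there; as the midpoint is the mean of the endpoints,
  both endpoints attain it as well. The only other unit vector orthogonal to the segment is the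
  negative, and if both qualified, \<open>S\<close> would lie in a line, against its nonempty
  interior.\<close>

lemma outward_normal:
  assumes S: "convex S" "interior S \<noteq> {}" and ab: "a \<noteq> b" "closed_segment a b \<subseteq> frontier S"
  shows "norm (outward_normal S a b) = 1" "outward_normal S a b \<bullet> (b - a) = 0"
proof -
  let ?P = "\<lambda>n. norm n = 1 \<and> n \<bullet> (b - a) = 0 \<and> (\<forall>x\<in>S. n \<bullet> (x - a) \<le> 0)"
  let ?m = "midpoint a b"
  have "?m \<in> frontier S" "a \<in> frontier S" "b \<in> frontier S" using ab by auto
  then have m: "?m \<in> closure S" "a \<in> closure S" "b \<in> closure S" and "?m \<notin> rel_interior S"
    using S by (auto simp: frontier_def rel_interior_nonempty_interior)
  then obtain h where h: "h \<noteq> 0" "\<And>y. y \<in> closure S \<Longrightarrow> h \<bullet> ?m \<le> h \<bullet> y"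
    using supporting_hyperplane_relative_frontier[OF S(1)] by metis
  have "h \<bullet> a + h \<bullet> b = 2 * (h \<bullet> ?m)" by (simp add: midpoint_def inner_add_right)
  moreover have "h \<bullet> ?m \<le> h \<bullet> a" "h \<bullet> ?m \<le> h \<bullet> b" using h m by auto
  ultimately have hab: "h \<bullet> a = h \<bullet> ?m" "h \<bullet> b = h \<bullet> ?m" by linarith+
  have "\<forall>x\<in>S. h \<bullet> a \<le> h \<bullet> x" using h(2) closure_subset[of S] hab by auto
  then have ex: "?P (- (h /\<^sub>R norm h))"
    using h(1) hab by (auto simp: inner_diff_right divide_simps mult_le_cancel_left)
  have uniq: "n = n'" if n: "?P n" and n': "?P n'" for n n'
  proof (rule ccontr)
    assume "n \<noteq> n'"
    obtain x where x: "x \<in> interior S" using S by auto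
    have nz: "n \<noteq> 0" "n' \<noteq> 0" "b - a \<noteq> 0" using n n' ab by auto
    define v where "v = n' - (n' \<bullet> n) *\<^sub>R n"
    have "n \<bullet> n = 1" "n' \<bullet> n' = 1" using n n' by (simp_all add: norm_eq_1)
    have "v = 0"
      by (rule orthogonal_to_both_eq_0[of "b - a" n])
        (use n n' nz \<open>n \<bullet> n = 1\<close> in \<open>auto simp: v_def inner_diff_left\<close>)
    then have n'_eq: "n' = (n' \<bullet> n) *\<^sub>R n" by (simp add: v_def)
    then have "\<bar>n' \<bullet> n\<bar> = 1" using n n' by (metis norm_scaleR mult.right_neutral)
    then have "n' = - n" using n'_eq \<open>n \<noteq> n'\<close> by (cases "n' \<bullet> n \<ge> 0") auto
    then have eq0: "n \<bullet> (y - a) = 0" if "y \<in> S" for y using n n' that by force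
    obtain e where e: "e > 0" "ball x e \<subseteq> S" using x by (meson mem_interior)
    have "x + (e/2) *\<^sub>R n \<in> ball x e" using n e by (simp add: dist_norm)
    then have "n \<bullet> (x + (e/2) *\<^sub>R n - a) = 0" "n \<bullet> (x - a) = 0"
      using eq0 e x interior_subset by blast+
    then show False using e \<open>n \<bullet> n = 1\<close> by (simp add: inner_diff_right inner_add_right)
  qed
  have "?P (outward_normal S a b)"
    unfolding outward_normal_def by (rule theI[of ?P, OF ex uniq[OF _ ex]])
  then show "norm (outward_normal S a b) = 1" "outward_normal S a b \<bullet> (b - a) = 0" by auto
qed

section \<open>Orientation and edges of triangles\<close>

lemma cross2_eq_0_imp_parallel:
  assumes "cross2 u v = 0" "u \<noteq> 0"
  shows "\<exists>t. v = t *\<^sub>R u"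
proof (cases "u $ 1 = 0")
  case True
  then have "u $ 2 \<noteq> 0" using assms by (auto simp: vec2_eq_iff)
  then show ?thesis using assms True
    by (intro exI[of _ "v $ 2 / u $ 2"]) (auto simp: vec2_eq_iff cross2_def field_simps)
next
  case False
  then show ?thesis using assms
    by (intro exI[of _ "v $ 1 / u $ 1"]) (auto simp: vec2_eq_iff cross2_def field_simps)
qed

lemma cross2_affine_independent:
  fixes a b c :: "real^2"
  assumes "\<not> affine_dependent {a, b, c}" "a \<noteq> b" "a \<noteq> c" "b \<noteq> c"
  shows "cross2 (b - a) (c - a) \<noteq> 0"
proof
  assume "cross2 (b - a) (c - a) = 0"
  then obtain t where t: "c - a = t *\<^sub>R (b - a)"
    using cross2_eq_0_imp_parallel assms by (metis right_minus_eq)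
  have "c = (1 - t) *\<^sub>R a + t *\<^sub>R b" using t by (simp add: algebra_simps)
  then have "c \<in> affine hull {a, b}" unfolding affine_hull_2 by force
  moreover have "{a, b, c} - {c} = {a, b}" using assms by auto
  ultimately have "affine_dependent {a, b, c}" unfolding affine_dependent_def by (metis insertCI)
  then show False using assms by simp
qed

text \<open>Interchanging two vertices reverses the sign of the cross product, so a counterclockwise
  labelling always exists.\<close>

lemma triangle_vertices:
  fixes K :: "(real^2) set"
  assumes "2 simplex K"
  obtains a b c where "K = convex hull {a, b, c}" "cross2 (b - a) (c - a) > 0"
    "\<not> affine_dependent {a, b, c}" "\<And>x. x extreme_point_of K \<longleftrightarrow> x \<in> {a, b, c}"
proof -
  obtain C where C: "\<not> affine_dependent C" "int (card C) = 2 + 1" "K = convex hull C"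
    using assms by (auto simp: simplex_def)
  then have "card C = 3" by simp
  then obtain a b c where abc: "C = {a, b, c}" "a \<noteq> b" "a \<noteq> c" "b \<noteq> c"
    by (metis card_3_iff)
  have ext: "x extreme_point_of K \<longleftrightarrow> x \<in> {a, b, c}" for x
    using extreme_point_of_convex_hull_affine_independent[OF C(1)] C(3) abc(1) by simp
  have "cross2 (b - a) (c - a) \<noteq> 0" using cross2_affine_independent C abc by blast
  moreover have "cross2 (c - a) (b - a) = - cross2 (b - a) (c - a)" by (simp add: cross2_def)
  ultimately consider "cross2 (b - a) (c - a) > 0" | "cross2 (c - a) (b - a) > 0" by linarith
  then show thesis
  proof cases
    case 1
    then show thesis using that C abc ext by blast
  next
    case 2
    moreover have "{a, b, c} = {a, c, b}" by auto
    ultimately show thesis using that[of a c b] C abc ext by simp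
  qed
qed

text \<open>The boundary edges of a triangle in counterclockwise orientation.\<close>

definition dedges :: "(real^2) set \<Rightarrow> ((real^2) \<times> (real^2)) set"
  where "dedges K = {(p, q). p extreme_point_of K \<and> q extreme_point_of K \<and> p \<noteq> q \<and>
    (\<forall>x\<in>K. cross2 (q - p) (x - p) \<ge> 0)}"

lemma cross2_cyclic: "cross2 (c - b) (a - b) = cross2 (b - a) (c - a)"
  by (simp add: cross2_def algebra_simps)

lemma cross2_swap: "cross2 (a - b) (c - b) = - cross2 (b - a) (c - a)"
  by (simp add: cross2_def algebra_simps)

lemma cross2_convex_hull_ge_0:
  assumes "cross2 (b - a) (c - a) > 0" "x \<in> convex hull {a, b, c}"
  shows "cross2 (b - a) (x - a) \<ge> 0"
proof -
  obtain u v w where x: "u \<ge> 0" "v \<ge> 0" "w \<ge> 0" "u + v + w = 1" "x = u *\<^sub>R a + v *\<^sub>R b + w *\<^sub>R c"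
    using assms(2) unfolding convex_hull_3 by auto
  have u: "u = 1 - v - w" using x by simp
  then have "cross2 (b - a) (x - a) = w * cross2 (b - a) (c - a)"
    unfolding x(5) u by (simp add: cross2_def algebra_simps)
  then show ?thesis using x assms by simp
qed

lemma dedges_triangle:
  assumes K: "K = convex hull {a, b, c}" and pos: "cross2 (b - a) (c - a) > 0"
    and ext: "\<And>x. x extreme_point_of K \<longleftrightarrow> x \<in> {a, b, c}"
  shows "dedges K = {(a, b), (b, c), (c, a)}" "a \<noteq> b" "b \<noteq> c" "a \<noteq> c"
proof -
  show ne: "a \<noteq> b" "b \<noteq> c" "a \<noteq> c" using pos by (auto simp: cross2_def)
  have pos2: "cross2 (c - b) (a - b) > 0" "cross2 (a - c) (b - c) > 0"
    using pos cross2_cyclic[of c b a] cross2_cyclic[of a c b] by simp_all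
  have sets: "{a, b, c} = {b, c, a}" "{a, b, c} = {c, a, b}" by auto
  have inK: "a \<in> K" "b \<in> K" "c \<in> K" unfolding K by (auto intro: hull_inc)
  have "cross2 (a - b) (c - b) < 0" "cross2 (b - c) (a - c) < 0" "cross2 (c - a) (b - a) < 0"
    using pos pos2 cross2_swap[of a b c] cross2_swap[of b c a] cross2_swap[of c a b] by simp_all
  then have "(b, a) \<notin> dedges K" "(c, b) \<notin> dedges K" "(a, c) \<notin> dedges K"
    using inK unfolding dedges_def by force+
  moreover have "(a, b) \<in> dedges K" "(b, c) \<in> dedges K" "(c, a) \<in> dedges K"
    using ext ne cross2_convex_hull_ge_0[OF pos] cross2_convex_hull_ge_0[OF pos2(1)]
      cross2_convex_hull_ge_0[OF pos2(2)] K sets unfolding dedges_def by auto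
  moreover have "(p, q) \<in> dedges K \<Longrightarrow> p \<in> {a, b, c} \<and> q \<in> {a, b, c} \<and> p \<noteq> q" for p q
    using ext by (auto simp: dedges_def)
  ultimately show "dedges K = {(a, b), (b, c), (c, a)}" by fastforce
qed

lemma extreme_point_in: "a extreme_point_of K \<Longrightarrow> a \<in> K"
  by (simp add: extreme_point_of_def)

lemma closed_segment_diff:
  fixes a b x y :: "'a::real_vector"
  assumes "x \<in> closed_segment a b" "y \<in> closed_segment a b"
  obtains s where "y - x = s *\<^sub>R (b - a)"
proof -
  obtain u w where x_eq: "x = (1 - u) *\<^sub>R a + u *\<^sub>R b" and y_eq: "y = (1 - w) *\<^sub>R a + w *\<^sub>R b"
    using assms by (auto simp: closed_segment_def)
  have "y - x = (w - u) *\<^sub>R (b - a)" unfolding x_eq y_eq by (simp add: algebra_simps)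
  then show thesis by (rule that)
qed

lemma aff_dim_closed_segment: "aff_dim (closed_segment a b) = (if a = b then 0 else 1)"
  for a b :: "'a::euclidean_space"
  by (simp add: segment_convex_hull aff_dim_convex_hull aff_dim_2)

lemma edge_endpoints:
  fixes K :: "'a::euclidean_space set"
  assumes "closed_segment a b edge_of K"
  shows "a \<noteq> b" "a extreme_point_of K" "b extreme_point_of K"
proof -
  have ab: "closed_segment a b face_of K" "aff_dim (closed_segment a b) = 1"
    using assms by (auto simp: edge_of_def)
  then show "a \<noteq> b" by (auto simp: aff_dim_closed_segment)
  show "a extreme_point_of K" "b extreme_point_of K"
    using extreme_point_of_face[OF ab(1)] extreme_point_of_segment by blast+
qed

lemma triangle_edge:
  fixes K :: "(real^2) set"
  assumes "2 simplex K" "p extreme_point_of K" "q extreme_point_of K" "p \<noteq> q"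
  shows "closed_segment p q edge_of K"
proof -
  obtain a b c where abc: "K = convex hull {a, b, c}" "\<not> affine_dependent {a, b, c}"
    "\<And>x. x extreme_point_of K \<longleftrightarrow> x \<in> {a, b, c}" using triangle_vertices[OF assms(1)] by metis
  have "{p, q} \<subseteq> {a, b, c}" using abc(3) assms by blast
  then have "convex hull {p, q} face_of K"
    using face_of_convex_hull_affine_independent[OF abc(2)] abc(1) by blast
  then show ?thesis using assms(4) unfolding edge_of_def
    by (simp add: segment_convex_hull[symmetric] aff_dim_closed_segment)
qed

lemma edge_dedges:
  fixes K :: "(real^2) set"
  assumes "2 simplex K" "closed_segment p q edge_of K"
  shows "(p, q) \<in> dedges K \<or> (q, p) \<in> dedges K"
proof -
  obtain a b c where abc: "K = convex hull {a, b, c}" "cross2 (b - a) (c - a) > 0"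
    "\<And>x. x extreme_point_of K \<longleftrightarrow> x \<in> {a, b, c}" using triangle_vertices[OF assms(1)] by metis
  show ?thesis
    using edge_endpoints[OF assms(2)] abc(3) unfolding dedges_triangle(1)[OF abc] by auto
qed

lemma dedges_edge:
  "2 simplex K \<Longrightarrow> (p, q) \<in> dedges K \<Longrightarrow> closed_segment p q edge_of K"
  using triangle_edge by (auto simp: dedges_def)

lemma dedges_apex:
  assumes "2 simplex K" "(p, q) \<in> dedges K"
  obtains r where "K = convex hull {p, q, r}" "cross2 (q - p) (r - p) > 0"
proof -
  obtain a b c where abc: "K = convex hull {a, b, c}" "cross2 (b - a) (c - a) > 0"
    "\<And>x. x extreme_point_of K \<longleftrightarrow> x \<in> {a, b, c}" using triangle_vertices[OF assms(1)] by metis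
  have pos2: "cross2 (c - b) (a - b) > 0" "cross2 (a - c) (b - c) > 0"
    using abc(2) cross2_cyclic[of c b a] cross2_cyclic[of a c b] by simp_all
  have sets: "{a, b, c} = {b, c, a}" "{a, b, c} = {c, a, b}" by auto
  consider "p = a" "q = b" | "p = b" "q = c" | "p = c" "q = a"
    using assms(2) unfolding dedges_triangle(1)[OF abc] by auto
  then show thesis
    using that[of c] that[of a] that[of b] abc pos2 sets by cases auto
qed

lemma triangleI:
  "0 \<le> u \<Longrightarrow> 0 \<le> v \<Longrightarrow> 0 \<le> w \<Longrightarrow> u + v + w = 1 \<Longrightarrow>
    u *\<^sub>R a + v *\<^sub>R b + w *\<^sub>R c \<in> convex hull {a, b, c}"
  unfolding convex_hull_3 by blast

text \<open>A short way from the midpoint of the edge towards \<open>r\<close> the point is still in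
  the triangle with apex \<open>r'\<close>, because \<open>r\<close> has a positive barycentric
  coordinate at \<open>r'\<close>.\<close>

lemma triangles_same_side_overlap:
  assumes "cross2 (q - p) (r - p) > 0" "cross2 (q - p) (r' - p) > 0"
  shows "\<exists>x \<in> convex hull {p, q, r} \<inter> convex hull {p, q, r'}. cross2 (q - p) (x - p) > 0"
proof -
  \<comment> \<open>Cramer's rule: \<open>\<beta>\<close> and \<open>\<gamma>\<close> are the
    barycentric coordinates of \<open>r\<close> at \<open>q\<close> and \<open>r'\<close> with
    respect to \<open>p\<close>, \<open>q\<close>, \<open>r'\<close>.\<close>
  define D where "D = cross2 (q - p) (r' - p)"
  define \<gamma> where "\<gamma> = cross2 (q - p) (r - p) / D"
  define \<beta> where "\<beta> = cross2 (r - p) (r' - p) / D"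
  have D: "D > 0" and \<gamma>: "\<gamma> > 0" using assms by (simp_all add: D_def \<gamma>_def)
  have "D *\<^sub>R (r - p) = cross2 (r - p) (r' - p) *\<^sub>R (q - p) + cross2 (q - p) (r - p) *\<^sub>R (r' - p)"
    by (simp add: D_def vec2_eq_iff cross2_def algebra_simps)
  then have "(1/D) *\<^sub>R (D *\<^sub>R (r - p)) = \<beta> *\<^sub>R (q - p) + \<gamma> *\<^sub>R (r' - p)"
    by (simp only: scaleR_add_right) (simp add: \<beta>_def \<gamma>_def)
  then have r: "r - p = \<beta> *\<^sub>R (q - p) + \<gamma> *\<^sub>R (r' - p)" using D by simp
  define \<alpha> where "\<alpha> = 1 - \<beta> - \<gamma>"
  have r: "r = \<alpha> *\<^sub>R p + \<beta> *\<^sub>R q + \<gamma> *\<^sub>R r'" using r by (simp add: \<alpha>_def algebra_simps)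
  \<comment> \<open>Small enough for the weight \<open>(1 - s)/2\<close> at \<open>p\<close> and at
    \<open>q\<close> to absorb negative values of \<open>s * \<alpha>\<close> and
    \<open>s * \<beta>\<close>.\<close>
  define s where "s = 1 / (1 + 2 * \<bar>\<alpha>\<bar> + 2 * \<bar>\<beta>\<bar>)"
  have s: "s > 0" "s \<le> 1" "s * (1 + 2 * \<bar>\<alpha>\<bar> + 2 * \<bar>\<beta>\<bar>) = 1"
    by (simp_all add: s_def divide_simps add_nonneg_eq_0_iff)
  have "(1 - s)/2 = s * \<bar>\<alpha>\<bar> + s * \<bar>\<beta>\<bar>" using s(3) by (simp add: field_simps)
  then have "(1 - s)/2 + s * \<alpha> = s * (\<bar>\<alpha>\<bar> + \<alpha>) + s * \<bar>\<beta>\<bar>"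
    "(1 - s)/2 + s * \<beta> = s * (\<bar>\<beta>\<bar> + \<beta>) + s * \<bar>\<alpha>\<bar>" by (simp_all add: algebra_simps)
  moreover have "s * (\<bar>\<alpha>\<bar> + \<alpha>) + s * \<bar>\<beta>\<bar> \<ge> 0" "s * (\<bar>\<beta>\<bar> + \<beta>) + s * \<bar>\<alpha>\<bar> \<ge> 0"
    using s(1) abs_ge_minus_self[of \<alpha>] abs_ge_minus_self[of \<beta>]
    by (auto intro!: add_nonneg_nonneg mult_nonneg_nonneg simp: add.commute)
  ultimately have nonneg: "(1 - s)/2 + s * \<alpha> \<ge> 0" "(1 - s)/2 + s * \<beta> \<ge> 0" by simp_all
  define x where "x = ((1 - s)/2) *\<^sub>R p + ((1 - s)/2) *\<^sub>R q + s *\<^sub>R r"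
  have "x \<in> convex hull {p, q, r}"
    unfolding x_def by (rule triangleI) (use s in auto)
  moreover have x': "x = ((1 - s)/2 + s * \<alpha>) *\<^sub>R p + ((1 - s)/2 + s * \<beta>) *\<^sub>R q + (s * \<gamma>) *\<^sub>R r'"
    unfolding x_def r by (simp add: algebra_simps)
  have "x \<in> convex hull {p, q, r'}"
    unfolding x'
  proof (rule triangleI[OF nonneg])
    show "0 \<le> s * \<gamma>" using s \<gamma> by simp
    have "s * \<alpha> + s * \<beta> + s * \<gamma> = s" unfolding \<alpha>_def by (simp add: algebra_simps)
    then show "(1 - s)/2 + s * \<alpha> + ((1 - s)/2 + s * \<beta>) + s * \<gamma> = 1" by (simp add: field_simps)
  qed
  moreover have "cross2 (q - p) (x - p) = s * cross2 (q - p) (r - p)"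
  proof -
    define h where "h = (1 - s)/2"
    have s_eq: "s = 1 - 2 * h" and x_eq: "x = h *\<^sub>R p + h *\<^sub>R q + s *\<^sub>R r"
      by (simp_all add: h_def x_def field_simps)
    show ?thesis unfolding x_eq s_eq by (simp add: cross2_def algebra_simps)
  qed
  then have "cross2 (q - p) (x - p) > 0" using s assms by simp
  ultimately show ?thesis by blast
qed

text \<open>Dimension count: a proper face has dimension below 2 and two distinct points force at
  least 1; a compact convex collinear set is a segment.\<close>

lemma proper_face_is_edge:
  fixes K :: "(real^2) set"
  assumes "2 simplex K" "C face_of K" "C \<noteq> K" "x \<in> C" "y \<in> C" "x \<noteq> y"
  obtains a b where "C = closed_segment a b" "closed_segment a b edge_of K"
proof -
  have K: "convex K" "compact K" "aff_dim K = 2"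
    using assms(1) simplex_imp_polytope polytope_imp_convex polytope_imp_compact aff_dim_simplex
    by blast+
  have "aff_dim C < 2" using face_of_aff_dim_lt[OF K(1) assms(2,3)] K by simp
  moreover have "aff_dim {x, y} \<le> aff_dim C" using assms by (intro aff_dim_subset) auto
  ultimately have dim: "aff_dim C = 1" using assms(6) by (simp add: aff_dim_2)
  then have "collinear C" by (simp add: collinear_aff_dim)
  moreover have "convex C" "compact C"
    using assms(2) K face_of_imp_convex face_of_imp_compact by blast+
  ultimately obtain a b where "C = closed_segment a b"
    using compact_convex_collinear_segment assms(4) by blast
  then show thesis using that assms(2) dim by (simp add: edge_of_def)
qed

section \<open>Meshes\<close>

locale polygon_mesh =
  fixes \<Omega> :: "(real^2) set" and T :: "(real^2) set set"
  assumes polygon: "convex_polygon \<Omega>" and mesh: "mesh \<Omega> T"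
begin

lemma finite_T [simp]: "finite T"
  using mesh by (simp add: mesh_def triangulation_def)

lemma simplex_T: "K \<in> T \<Longrightarrow> 2 simplex K"
  using mesh by (simp add: mesh_def)

lemma Union_T: "\<Union>T = closure \<Omega>"
  using mesh by (simp add: mesh_def)

lemma face_Int_T: "K \<in> T \<Longrightarrow> K' \<in> T \<Longrightarrow> K \<inter> K' face_of K"
  using mesh by (simp add: mesh_def triangulation_def)

lemma open_\<Omega>: "open \<Omega>" and convex_\<Omega>: "convex \<Omega>" and \<Omega>_nonempty: "\<Omega> \<noteq> {}"
  using polygon by (auto simp: convex_polygon_def)

lemma compact_closure_\<Omega>: "compact (closure \<Omega>)"
  using polygon polytope_imp_compact unfolding convex_polygon_def by blast

lemma bounded_\<Omega>: "bounded \<Omega>"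
  by (rule bounded_subset[OF compact_imp_bounded[OF compact_closure_\<Omega>] closure_subset])

lemma interior_closure_\<Omega>: "interior (closure \<Omega>) = \<Omega>"
  using open_\<Omega> convex_\<Omega> by (simp add: convex_interior_closure interior_open)

lemma frontier_\<Omega>: "frontier \<Omega> = closure \<Omega> - \<Omega>"
  using open_\<Omega> by (simp add: frontier_def interior_open)

lemma T_props:
  assumes "K \<in> T"
  shows "convex K" "compact K" "closed K" "K \<subseteq> closure \<Omega>" "aff_dim K = 2" "interior K \<noteq> {}"
    "closure (interior K) = K" "interior K \<subseteq> \<Omega>"
proof -
  have "polytope K" using simplex_T[OF assms] simplex_imp_polytope by blast
  then show K: "convex K" "compact K" "closed K"
    by (auto simp: polytope_imp_convex polytope_imp_compact polytope_imp_closed)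
  show "K \<subseteq> closure \<Omega>" using Union_T assms by blast
  then show "interior K \<subseteq> \<Omega>" using interior_mono interior_closure_\<Omega> by blast
  show dim: "aff_dim K = 2" using simplex_T[OF assms] aff_dim_simplex by blast
  then have "K \<noteq> {}" by auto
  with dim show int: "interior K \<noteq> {}"
    using rel_interior_eq_empty[OF K(1)] interior_rel_interior[of K] by auto
  show "closure (interior K) = K" using convex_closure_interior[OF K(1) int] K(3) by simp
qed

text \<open>A common face that meets the interior of \<open>K\<close> is all of \<open>K\<close>;
  then \<open>K\<close> would be a proper face of \<open>K'\<close>, of smaller dimension.\<close>

lemma interior_disjoint:
  assumes "K \<in> T" "K' \<in> T" "K \<noteq> K'"
  shows "interior K \<inter> K' = {}"
proof (rule ccontr)
  assume ne: "interior K \<inter> K' \<noteq> {}"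
  have "K \<inter> K' = K"
    using face_of_disjoint_interior[OF face_Int_T[OF assms(1,2)]] ne interior_subset by blast
  then have "K face_of K'" using face_Int_T[OF assms(2,1)] by (simp add: Int_commute)
  then have "aff_dim K < aff_dim K'"
    using face_of_aff_dim_lt T_props(1)[OF assms(2)] assms(3) by blast
  then show False using T_props(5) assms by simp
qed

lemma face_Int_T_proper:
  assumes "K \<in> T" "K' \<in> T" "K \<noteq> K'"
  shows "K \<inter> K' \<noteq> K"
  using interior_disjoint[OF assms] T_props(6)[OF assms(1)] interior_subset by blast

lemma common_edge:
  assumes K: "K \<in> T" "K' \<in> T" "K \<noteq> K'" and xy: "x \<in> K \<inter> K'" "y \<in> K \<inter> K'" "x \<noteq> y"
  obtains a b where "K \<inter> K' = closed_segment a b" "closed_segment a b edge_of K"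
    "closed_segment a b edge_of K'"
proof -
  obtain a b where ab: "K \<inter> K' = closed_segment a b" "closed_segment a b edge_of K"
    by (rule proper_face_is_edge[OF simplex_T[OF K(1)] face_Int_T[OF K(1,2)] face_Int_T_proper[OF K] xy])
  moreover have "closed_segment a b edge_of K'"
    using ab face_Int_T[OF K(2,1)] by (simp add: edge_of_def Int_commute[of K' K])
  ultimately show thesis using that by blast
qed

lemma edge_subset_frontier:
  assumes "K \<in> T" "closed_segment a b edge_of K"
  shows "closed_segment a b \<subseteq> frontier K"
proof -
  have "closed_segment a b face_of K" "aff_dim (closed_segment a b) = 1"
    using assms(2) by (auto simp: edge_of_def)
  moreover from this have "closed_segment a b \<noteq> K" using T_props(5)[OF assms(1)] by auto
  ultimately have "closed_segment a b \<inter> interior K = {}" "closed_segment a b \<subseteq> K"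
    by (simp_all add: face_of_disjoint_interior face_of_imp_subset)
  then show ?thesis using T_props(3)[OF assms(1)] by (auto simp: frontier_def)
qed

lemma outward_normal_edge:
  assumes "K \<in> T" "closed_segment a b edge_of K"
  shows "norm (outward_normal K a b) = 1" "outward_normal K a b \<bullet> (b - a) = 0"
  using outward_normal[OF T_props(1,6)[OF assms(1)] edge_endpoints(1)[OF assms(2)]
      edge_subset_frontier[OF assms]] by auto

lemma outward_normal_boundary:
  assumes "a \<noteq> b" "closed_segment a b \<subseteq> frontier \<Omega>"
  shows "norm (outward_normal \<Omega> a b) = 1" "outward_normal \<Omega> a b \<bullet> (b - a) = 0"
  using outward_normal[OF convex_\<Omega> _ assms] open_\<Omega> \<Omega>_nonempty by (auto simp: interior_open)

text \<open>There are no hanging nodes: a face with a relative interior point of the edge contains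
  the edge. The common face is itself an edge, and \<open>p\<close>, \<open>q\<close> are extreme in
  \<open>K\<close>, hence they are its endpoints.\<close>

lemma edge_in_common_face:
  assumes K: "K \<in> T" "K' \<in> T" "K \<noteq> K'" and e: "closed_segment p q edge_of K"
    and x: "x \<in> open_segment p q" "x \<in> K'"
  shows "K \<inter> K' = closed_segment p q"
proof -
  have pq: "p \<noteq> q" using edge_endpoints(1)[OF e] .
  have "x \<in> rel_interior (closed_segment p q)" using x(1) pq by (simp add: rel_interior_closed_segment)
  moreover have sub: "closed_segment p q \<subseteq> K" using e edge_of_imp_subset by blast
  moreover have "x \<in> K \<inter> K'"
    using x sub by (auto simp: open_segment_def)
  ultimately have "closed_segment p q \<subseteq> K \<inter> K'"
    using subset_of_face_of[OF face_Int_T[OF K(1,2)] sub] by blast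
  then have pqC: "p \<in> K \<inter> K'" "q \<in> K \<inter> K'" by auto
  obtain a b where ab: "K \<inter> K' = closed_segment a b" "closed_segment a b edge_of K"
    by (rule common_edge[OF K pqC pq])
  have "p extreme_point_of closed_segment a b" "q extreme_point_of closed_segment a b"
    using edge_endpoints[OF e] extreme_point_of_face[of "closed_segment a b" K] ab pqC
    by (auto simp: edge_of_def)
  then have "p = a \<and> q = b \<or> p = b \<and> q = a"
    using pq by (auto simp: extreme_point_of_segment)
  then show ?thesis using ab(1) by (auto simp: closed_segment_commute)
qed

text \<open>The orientation determines the side: both triangles lie to the left of the edge and
  overlap off it, while distinct elements with this edge would share nothing else.\<close>

lemma dedges_unique:
  assumes K: "K \<in> T" "K' \<in> T" and e: "e \<in> dedges K" "e \<in> dedges K'"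
  shows "K = K'"
proof (rule ccontr)
  assume ne: "K \<noteq> K'"
  obtain p q where pq: "e = (p, q)" by fastforce
  obtain r where r: "K = convex hull {p, q, r}" "cross2 (q - p) (r - p) > 0"
    by (rule dedges_apex[OF simplex_T[OF K(1)] e(1)[unfolded pq]])
  obtain r' where r': "K' = convex hull {p, q, r'}" "cross2 (q - p) (r' - p) > 0"
    by (rule dedges_apex[OF simplex_T[OF K(2)] e(2)[unfolded pq]])
  obtain x where x: "x \<in> K \<inter> K'" "cross2 (q - p) (x - p) > 0"
    using triangles_same_side_overlap[OF r(2) r'(2)] r r' by blast
  have edge: "closed_segment p q edge_of K" using dedges_edge[OF simplex_T[OF K(1)]] e pq by blast
  have "midpoint p q \<in> open_segment p q" using edge_endpoints(1)[OF edge] by simp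
  moreover have "midpoint p q \<in> K'"
    using e(2) pq dedges_edge[OF simplex_T[OF K(2)]] edge_of_imp_subset midpoint_in_closed_segment by blast
  ultimately have "x \<in> closed_segment p q"
    using edge_in_common_face[OF K ne edge] x by blast
  then obtain u where x_eq: "x = (1 - u) *\<^sub>R p + u *\<^sub>R q" by (auto simp: closed_segment_def)
  have "cross2 (q - p) (x - p) = 0" unfolding x_eq by (simp add: cross2_def algebra_simps)
  then show False using x by simp
qed

text \<open>The mesh does not provide neighbours explicitly. Points just across an interior edge
  still lie in the domain, hence in other elements, whose finite union is closed and therefore
  contains the edge point itself.\<close>

lemma dedges_neighbour:
  assumes K: "K \<in> T" and e: "(p, q) \<in> dedges K" and nb: "\<not> closed_segment p q \<subseteq> frontier \<Omega>"
  obtains K' where "K' \<in> T" "K' \<noteq> K" "closed_segment p q edge_of K'" "(q, p) \<in> dedges K'"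
proof -
  have edge: "closed_segment p q edge_of K" using dedges_edge[OF simplex_T[OF K] e] .
  have pq: "p \<noteq> q" using edge_endpoints(1)[OF edge] .
  have sub: "closed_segment p q \<subseteq> K" using edge edge_of_imp_subset by blast
  \<comment> \<open>If the open segment avoided the domain it would lie in the frontier, and so
    would its closure, the whole edge.\<close>
  have "\<exists>x\<in>open_segment p q. x \<in> \<Omega>"
  proof (rule ccontr)
    assume "\<not> ?thesis"
    then have "open_segment p q \<subseteq> frontier \<Omega>"
      using sub T_props(4)[OF K] segment_open_subset_closed[of p q] unfolding frontier_\<Omega> by blast
    then have "closure (open_segment p q) \<subseteq> frontier \<Omega>" by (rule closure_minimal) simp
    then show False using nb unfolding closure_open_segment using pq by simp
  qed
  then obtain x where x: "x \<in> open_segment p q" "x \<in> \<Omega>" by blast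
  have xK: "x \<in> K" using x sub segment_open_subset_closed by blast
  have "x \<in> closure (\<Union>(T - {K}))"
    unfolding closure_approachable
  proof (intro allI impI)
    fix \<epsilon> :: real assume \<epsilon>: "\<epsilon> > 0"
    obtain \<delta> where \<delta>: "\<delta> > 0" "ball x \<delta> \<subseteq> \<Omega>" using open_\<Omega> x by (meson openE)
    \<comment> \<open>\<open>n\<close> points to the right of the directed edge, away from
      \<open>K\<close>; \<open>t\<close> puts \<open>y\<close> at half the smaller of the two radii
      from \<open>x\<close>.\<close>
    define n where "n = rot (q - p)"
    have n: "n \<noteq> 0" using pq by (auto simp: n_def vec2_eq_iff)
    define t where "t = min \<epsilon> \<delta> / (2 * norm n)"
    define y where "y = x + t *\<^sub>R n"
    have t: "t > 0" using \<epsilon> \<delta> n by (simp add: t_def)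
    have d: "dist y x = min \<epsilon> \<delta> / 2" using t n \<epsilon> \<delta> by (simp add: y_def dist_norm t_def)
    then have "y \<in> \<Omega>" using \<delta> \<epsilon> by (auto simp: dist_commute subset_iff)
    then have "y \<in> \<Union>T" using Union_T closure_subset by blast
    moreover have "y \<notin> K"
    proof
      assume "y \<in> K"
      then have "cross2 (q - p) (y - p) \<ge> 0" using e by (auto simp: dedges_def)
      moreover obtain u where x_eq: "x = (1 - u) *\<^sub>R p + u *\<^sub>R q"
        using x by (auto simp: open_segment_def closed_segment_def)
      have "cross2 (q - p) (y - p) = - (t * (n \<bullet> n))"
        unfolding y_def n_def x_eq by (simp add: cross2_def inner_2 algebra_simps)
      moreover have "t * (n \<bullet> n) > 0" using t n by simp
      ultimately show False by linarith
    qed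
    ultimately show "\<exists>y\<in>\<Union>(T - {K}). dist y x < \<epsilon>" using d \<epsilon> \<delta> by (intro bexI[of _ y]) auto
  qed
  moreover have "closed (\<Union>(T - {K}))" using T_props(3) by (intro closed_Union) auto
  ultimately obtain K' where K': "K' \<in> T" "K' \<noteq> K" "x \<in> K'" by (auto simp: closure_closed)
  have "K \<inter> K' = closed_segment p q" using edge_in_common_face[OF K K'(1) _ edge x(1)] K' by auto
  then have edge': "closed_segment p q edge_of K'"
    using edge face_Int_T[OF K'(1) K] by (simp add: edge_of_def Int_commute[of K' K])
  then have "(p, q) \<in> dedges K' \<or> (q, p) \<in> dedges K'" using edge_dedges simplex_T K' by blast
  moreover have "(p, q) \<notin> dedges K'" using dedges_unique[OF K K'(1) e] K' by blast
  ultimately show thesis using that K' edge' by blast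
qed

text \<open>Passing to the opposite edge of the neighbour is an involution on the interior directed
  edges that reverses the sign of \<open>M\<close>, so the sum equals its own negative.\<close>

lemma sum_dedges_eq_0:
  fixes M :: "(real^2) set \<Rightarrow> real^2 \<Rightarrow> real^2 \<Rightarrow> real"
  assumes bd: "\<And>K p q. K \<in> T \<Longrightarrow> (p, q) \<in> dedges K \<Longrightarrow> closed_segment p q \<subseteq> frontier \<Omega> \<Longrightarrow> M K p q = 0"
    and int: "\<And>K K' p q. K \<in> T \<Longrightarrow> K' \<in> T \<Longrightarrow> K \<noteq> K' \<Longrightarrow> (p, q) \<in> dedges K \<Longrightarrow> (q, p) \<in> dedges K' \<Longrightarrow>
      M K p q = - M K' q p"
  shows "(\<Sum>K\<in>T. \<Sum>(p, q)\<in>dedges K. M K p q) = 0"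
proof -
  have fin: "finite (dedges K)" if K: "K \<in> T" for K
  proof -
    obtain a b c where "K = convex hull {a, b, c}" "cross2 (b - a) (c - a) > 0"
      "\<And>x. x extreme_point_of K \<longleftrightarrow> x \<in> {a, b, c}" using triangle_vertices[OF simplex_T[OF K]] by metis
    then show ?thesis by (simp add: dedges_triangle(1))
  qed
  define I where "I = {(K, p, q). K \<in> T \<and> (p, q) \<in> dedges K \<and> \<not> closed_segment p q \<subseteq> frontier \<Omega>}"
  define N where "N = (\<lambda>(K, p, q). M K p q)"
  have "\<exists>K'. K' \<in> T \<and> K' \<noteq> K \<and> (q, p) \<in> dedges K'" if "(K, p, q) \<in> I" for K p q
  proof -
    from that have "K \<in> T" "(p, q) \<in> dedges K" "\<not> closed_segment p q \<subseteq> frontier \<Omega>"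
      by (auto simp: I_def)
    then show ?thesis by (rule dedges_neighbour) blast
  qed
  then have "\<forall>i\<in>I. \<exists>K'. case i of (K, p, q) \<Rightarrow> K' \<in> T \<and> K' \<noteq> K \<and> (q, p) \<in> dedges K'"
    by fastforce
  then obtain \<kappa> where "\<forall>i\<in>I. case i of (K, p, q) \<Rightarrow> \<kappa> i \<in> T \<and> \<kappa> i \<noteq> K \<and> (q, p) \<in> dedges (\<kappa> i)"
    by (rule bchoice[THEN exE])
  then have \<kappa>: "\<kappa> (K, p, q) \<in> T \<and> \<kappa> (K, p, q) \<noteq> K \<and> (q, p) \<in> dedges (\<kappa> (K, p, q))"
    if "(K, p, q) \<in> I" for K p q using that by fastforce
  define s where "s = (\<lambda>(K, p, q). (\<kappa> (K, p, q), q, p))"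
  have sI: "s i \<in> I" if "i \<in> I" for i
    using that \<kappa> by (auto simp: s_def I_def closed_segment_commute)
  \<comment> \<open>The neighbour \<open>\<kappa>\<close> is merely chosen; that two passages lead
    back rests on \<open>dedges_unique\<close>.\<close>
  have ss: "s (s i) = i" if "i \<in> I" for i
  proof -
    obtain K p q where i: "i = (K, p, q)" by (metis surj_pair)
    have "(\<kappa> (K, p, q), q, p) \<in> I" using sI[OF that] by (simp add: i s_def)
    then have "\<kappa> (\<kappa> (K, p, q), q, p) = K"
      using \<kappa> dedges_unique that unfolding i I_def by blast
    then show ?thesis by (simp add: i s_def)
  qed
  have Ns: "N (s i) = - N i" if i: "i \<in> I" for i
  proof -
    obtain K p q where i': "i = (K, p, q)" by (metis surj_pair)
    have "M K p q = - M (\<kappa> (K, p, q)) q p"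
      by (rule int) (use i i' \<kappa>[of K p q] in \<open>auto simp: I_def\<close>)
    then show ?thesis by (simp add: i' s_def N_def)
  qed
  have "sum N I = sum (N \<circ> s) I"
    by (rule sum.reindex_bij_witness[of I s s]) (use sI ss in auto)
  also have "\<dots> = - sum N I" using Ns by (simp add: sum_negf)
  finally have "sum N I = 0" by simp
  moreover have "sum N (Sigma T dedges) = sum N I"
    by (rule sum.mono_neutral_right) (use fin bd in \<open>auto simp: I_def N_def\<close>)
  moreover have "(\<Sum>K\<in>T. \<Sum>(p, q)\<in>dedges K. M K p q) = sum N (Sigma T dedges)"
    using fin by (subst sum.Sigma) (auto simp: N_def intro!: sum.cong)
  ultimately show ?thesis by simp
qed

end

section \<open>Piecewise polynomials in coordinates\<close>

definition quad :: "(nat \<Rightarrow> real) \<Rightarrow> real^2 \<Rightarrow> real"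
  where "quad c x = c 0 + c 1 * x $ 1 + c 2 * x $ 2 + c 3 * (x $ 1)\<^sup>2 + c 4 * x $ 1 * x $ 2 + c 5 * (x $ 2)\<^sup>2"

definition vaff :: "(nat \<Rightarrow> real) \<Rightarrow> real^2 \<Rightarrow> real^2"
  where "vaff c x = vector [c 0 + c 1 * x $ 1 + c 2 * x $ 2, c 3 + c 4 * x $ 1 + c 5 * x $ 2]"

text \<open>The coefficients of the gradient of \<^term>\<open>quad c\<close>, of \<^term>\<open>\<lambda>x. rot (vaff c x)\<close>, and of a
  quadratic whose rotated gradient is the divergence-free field \<^term>\<open>vaff c\<close>.\<close>

definition gcoef :: "(nat \<Rightarrow> real) \<Rightarrow> nat \<Rightarrow> real"
  where "gcoef c = (!) [c 1, 2 * c 3, c 4, c 2, c 4, 2 * c 5]"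

definition rcoef :: "(nat \<Rightarrow> real) \<Rightarrow> nat \<Rightarrow> real"
  where "rcoef c = (!) [c 3, c 4, c 5, - c 0, - c 1, - c 2]"

definition pcoef :: "(nat \<Rightarrow> real) \<Rightarrow> nat \<Rightarrow> real"
  where "pcoef c = (!) [0, - c 3, c 0, - c 4 / 2, c 1, c 2 / 2]"

lemma vaff_nth [simp]:
  "vaff c x $ 1 = c 0 + c 1 * x $ 1 + c 2 * x $ 2" "vaff c x $ 2 = c 3 + c 4 * x $ 1 + c 5 * x $ 2"
  by (simp_all add: vaff_def)

lemma coef_simps [simp]:
  "gcoef c 0 = c 1" "gcoef c (Suc 0) = 2 * c 3" "gcoef c 2 = c 4" "gcoef c 3 = c 2" "gcoef c 4 = c 4"
  "gcoef c 5 = 2 * c 5"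
  "rcoef c 0 = c 3" "rcoef c (Suc 0) = c 4" "rcoef c 2 = c 5" "rcoef c 3 = - c 0"
  "rcoef c 4 = - c (Suc 0)" "rcoef c 5 = - c 2"
  by (simp_all add: gcoef_def rcoef_def)

lemma rot_vaff: "rot (vaff c x) = vaff (rcoef c) x"
  by (simp add: vec2_eq_iff)

text \<open>The mixed coefficient of the potential is prescribed twice, as \<open>c 1\<close> and as
  \<open>- c 5\<close>; the vanishing divergence makes both agree.\<close>

lemma vaff_pcoef:
  assumes "c 1 + c 5 = 0"
  shows "vaff (rcoef (gcoef (pcoef c))) x = vaff c x"
proof -
  have "c (Suc 0) = - c 5" using assms by simp
  then show ?thesis by (simp add: vec2_eq_iff pcoef_def)
qed

lemma vaff_affine:
  "vaff c ((1 - t) *\<^sub>R a + t *\<^sub>R b) = (1 - t) *\<^sub>R vaff c a + t *\<^sub>R vaff c b"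
  by (simp add: vec2_eq_iff algebra_simps)

lemma vaff_midpoint: "vaff c (midpoint a b) = (1/2) *\<^sub>R (vaff c a + vaff c b)"
  by (simp add: vec2_eq_iff midpoint_def algebra_simps)

lemma quad_linear: "quad (\<lambda>k. c k + t * d k) x = quad c x + t * quad d x"
  by (simp add: quad_def algebra_simps)

lemma vaff_linear: "vaff (\<lambda>k. c k + t * d k) x = vaff c x + t *\<^sub>R vaff d x"
  by (simp add: vec2_eq_iff algebra_simps)

lemma vaff_gcoef_linear:
  "vaff (gcoef (\<lambda>k. c k + t * d k)) x = vaff (gcoef c) x + t *\<^sub>R vaff (gcoef d) x"
  by (simp add: vec2_eq_iff algebra_simps)

text \<open>The gradient is integrated along the segment, and the midpoint rule is exact for an
  affine integrand. This is the bridge between the vertex values of Morley functions and the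
  midpoint values of nonconforming fields.\<close>

lemma quad_diff_midpoint: "quad c b - quad c a = vaff (gcoef c) (midpoint a b) \<bullet> (b - a)"
  by (simp add: quad_def inner_2 midpoint_def power2_eq_square field_simps)

lemma vec_nth_has_derivative [derivative_intros]:
  "((\<lambda>x. x $ i) has_derivative (\<lambda>h. h $ i)) (at (x :: real^2))"
  by (rule bounded_linear_imp_has_derivative[OF bounded_linear_vec_nth])

lemma quad_has_derivative: "(quad c has_derivative (\<lambda>h. vaff (gcoef c) x \<bullet> h)) (at x)"
  unfolding quad_def
  by (auto intro!: derivative_eq_intros simp: fun_eq_iff inner_2 algebra_simps)

lemma vaff_has_derivative:
  "((\<lambda>x. vaff c x $ 1) has_derivative (\<lambda>h. c 1 * h $ 1 + c 2 * h $ 2)) (at x)"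
  "((\<lambda>x. vaff c x $ 2) has_derivative (\<lambda>h. c 4 * h $ 1 + c 5 * h $ 2)) (at x)"
  unfolding vaff_nth by (auto intro!: derivative_eq_intros simp: fun_eq_iff algebra_simps)

lemma continuous_on_quad: "continuous_on A (quad c)"
  unfolding quad_def by (intro continuous_intros)

lemma continuous_on_vaff: "continuous_on A (vaff c)"
proof -
  have "vaff c = (\<lambda>x. (c 0 + c 1 * x $ 1 + c 2 * x $ 2) *\<^sub>R axis 1 1 + (c 3 + c 4 * x $ 1 + c 5 * x $ 2) *\<^sub>R axis 2 1)"
    by (auto simp: fun_eq_iff vec2_eq_iff axis_def)
  then show ?thesis by (simp only:) (intro continuous_intros)
qed

lemma axis_nth_2 [simp]: "(axis 1 1 :: real^2) $ 1 = 1" "(axis 1 1 :: real^2) $ 2 = 0"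
  "(axis 2 1 :: real^2) $ 1 = 0" "(axis 2 1 :: real^2) $ 2 = 1"
  by (simp_all add: axis_def)

lemma Poly_on_2_iff: "v \<in> Poly_on 2 S \<longleftrightarrow> (\<exists>c. \<forall>x\<in>S. v x = quad c x)"
proof -
  have eq: "(\<Sum>i\<le>2. \<Sum>j\<le>2 - i. d i j * (x $ 1) ^ i * (x $ 2) ^ j) =
      d 0 0 + d 1 0 * x $ 1 + d 0 1 * x $ 2 + d 2 0 * (x $ 1)\<^sup>2 + d 1 1 * x $ 1 * x $ 2 + d 0 2 * (x $ 2)\<^sup>2"
    for d :: "nat \<Rightarrow> nat \<Rightarrow> real" and x :: "real^2"
    by (simp add: numeral_2_eq_2 algebra_simps)
  show ?thesis
  proof
    assume "v \<in> Poly_on 2 S"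
    then obtain d where d: "\<forall>x\<in>S. v x = (\<Sum>i\<le>2. \<Sum>j\<le>2 - i. d i j * (x $ 1) ^ i * (x $ 2) ^ j)"
      by (auto simp: Poly_on_def)
    have "\<forall>x\<in>S. v x = quad ((!) [d 0 0, d 1 0, d 0 1, d 2 0, d 1 1, d 0 2]) x"
      using d unfolding eq by (simp add: quad_def)
    then show "\<exists>c. \<forall>x\<in>S. v x = quad c x" by blast
  next
    assume "\<exists>c. \<forall>x\<in>S. v x = quad c x"
    then obtain c where c: "\<forall>x\<in>S. v x = quad c x" by blast
    define d where "d = (\<lambda>i j::nat. if i = (0::nat) then [c 0, c 2, c 5] ! j else if i = 1 then [c 1, c 4] ! j else c (3::nat))"
    have "\<forall>x\<in>S. v x = (\<Sum>i\<le>2. \<Sum>j\<le>2 - i. d i j * (x $ 1) ^ i * (x $ 2) ^ j)"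
      using c unfolding eq by (simp add: quad_def d_def)
    then show "v \<in> Poly_on 2 S" unfolding Poly_on_def by blast
  qed
qed

lemma Poly_on_1_iff: "v \<in> Poly_on 1 S \<longleftrightarrow> (\<exists>a b c. \<forall>x\<in>S. v x = a + b * x $ 1 + c * x $ 2)"
proof -
  have eq: "(\<Sum>i\<le>1. \<Sum>j\<le>1 - i. d i j * (x $ 1) ^ i * (x $ 2) ^ j) =
      d 0 0 + d 1 0 * x $ 1 + d 0 1 * x $ 2"
    for d :: "nat \<Rightarrow> nat \<Rightarrow> real" and x :: "real^2"
    by (simp add: algebra_simps)
  show ?thesis
  proof
    assume "v \<in> Poly_on 1 S"
    then obtain d where d: "\<forall>x\<in>S. v x = (\<Sum>i\<le>1. \<Sum>j\<le>1 - i. d i j * (x $ 1) ^ i * (x $ 2) ^ j)"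
      by (auto simp: Poly_on_def)
    then show "\<exists>a b c. \<forall>x\<in>S. v x = a + b * x $ 1 + c * x $ 2" unfolding eq by blast
  next
    assume "\<exists>a b c. \<forall>x\<in>S. v x = a + b * x $ 1 + c * x $ 2"
    then obtain a b c where c: "\<forall>x\<in>S. v x = a + b * x $ 1 + c * x $ 2" by blast
    define d where "d = (\<lambda>i j::nat. if i = (0::nat) then if j = 0 then a else c else b)"
    have "\<forall>x\<in>S. v x = (\<Sum>i\<le>1. \<Sum>j\<le>1 - i. d i j * (x $ 1) ^ i * (x $ 2) ^ j)"
      using c unfolding eq by (simp add: d_def)
    then show "v \<in> Poly_on 1 S" unfolding Poly_on_def by blast
  qed
qed

lemma Poly_on_1_vec_iff:
  "(\<forall>i. (\<lambda>x. \<phi> x $ i) \<in> Poly_on 1 S) \<longleftrightarrow> (\<exists>c. \<forall>x\<in>S. \<phi> x = vaff c x)"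
proof
  assume "\<forall>i. (\<lambda>x. \<phi> x $ i) \<in> Poly_on 1 S"
  then obtain a b c a' b' c' where "\<forall>x\<in>S. \<phi> x $ 1 = a + b * x $ 1 + c * x $ 2"
    "\<forall>x\<in>S. \<phi> x $ 2 = a' + b' * x $ 1 + c' * x $ 2"
    unfolding Poly_on_1_iff forall_2 by blast
  then have "\<forall>x\<in>S. \<phi> x = vaff ((!) [a, b, c, a', b', c']) x" by (simp add: vec2_eq_iff)
  then show "\<exists>c. \<forall>x\<in>S. \<phi> x = vaff c x" by blast
next
  assume "\<exists>c. \<forall>x\<in>S. \<phi> x = vaff c x"
  then obtain c where "\<forall>x\<in>S. \<phi> x = vaff c x" by blast
  then show "\<forall>i. (\<lambda>x. \<phi> x $ i) \<in> Poly_on 1 S" unfolding Poly_on_1_iff forall_2 by simp blast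
qed

lemma seg_integral_affine:
  assumes "\<And>t. t \<in> {0..1} \<Longrightarrow> f (linepath a b t) = (1 - t) *\<^sub>R A + t *\<^sub>R B"
  shows "seg_integral a b f = dist a b *\<^sub>R ((1/2) *\<^sub>R (A + B))"
proof -
  \<comment> \<open>The values at 1 and 0 of the antiderivative
    \<open>(t - t\<^sup>2/2) *\<^sub>R A + (t\<^sup>2/2) *\<^sub>R B\<close>, left unsimplified to
    match the fundamental theorem.\<close>
  have "((\<lambda>t. (1 - t) *\<^sub>R A + t *\<^sub>R B) has_integral
      (1 - 1\<^sup>2/2) *\<^sub>R A + (1\<^sup>2/2) *\<^sub>R B - ((0 - 0\<^sup>2/2) *\<^sub>R A + (0\<^sup>2/2) *\<^sub>R B)) {0..1::real}"
    by (rule fundamental_theorem_of_calculus) (auto intro!: derivative_eq_intros simp: algebra_simps)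
  then have "integral {0..1} (\<lambda>t. (1 - t) *\<^sub>R A + t *\<^sub>R B) = (1/2) *\<^sub>R (A + B)"
    by (simp add: integral_unique scaleR_add_right)
  moreover have "integral {0..1} (\<lambda>t. f (linepath a b t)) = integral {0..1} (\<lambda>t. (1 - t) *\<^sub>R A + t *\<^sub>R B)"
    by (rule integral_cong) (use assms in auto)
  ultimately show ?thesis by (simp add: seg_integral_def)
qed

lemma curlh_eq: "curlh T v x = rot (gradh T v x)"
  by (simp add: curlh_def gradh_def vec2_eq_iff)

context polygon_mesh
begin

section \<open>Elementwise derivatives, traces and edge integrals\<close>

lemma pdh_eq:
  assumes K: "K \<in> T" "x \<in> interior K" and v: "\<And>y. y \<in> interior K \<Longrightarrow> v y = g y"
    and g: "(g has_derivative g') (at x)"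
  shows "pdh T i v x = g' (axis i 1)"
proof -
  have "(v has_derivative g') (at x)"
    by (rule has_derivative_transform_within_open[OF g open_interior K(2)]) (use v in simp)
  then have "frechet_derivative v (at x) = g'" by (rule frechet_derivative_at[symmetric])
  then show ?thesis using K unfolding pdh_def pd_def by auto
qed

lemma gradh_quad:
  assumes K: "K \<in> T" "x \<in> interior K" and v: "\<And>y. y \<in> interior K \<Longrightarrow> v y = quad c y"
  shows "gradh T v x = vaff (gcoef c) x"
  using pdh_eq[OF K v quad_has_derivative] by (simp add: gradh_def vec2_eq_iff inner_2)

lemma vgradh_vaff:
  assumes K: "K \<in> T" "x \<in> interior K" and \<phi>: "\<And>y. y \<in> interior K \<Longrightarrow> \<phi> y = vaff c y"
  shows "vgradh T \<phi> x = vector [vector [c 1, c 2], vector [c 4, c 5]]"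
proof -
  have "pdh T j (\<lambda>y. \<phi> y $ 1) x = c 1 * axis j 1 $ 1 + c 2 * axis j 1 $ 2" for j
    by (rule pdh_eq[OF K _ vaff_has_derivative(1)]) (use \<phi> in simp)
  moreover have "pdh T j (\<lambda>y. \<phi> y $ 2) x = c 4 * axis j 1 $ 1 + c 5 * axis j 1 $ 2" for j
    by (rule pdh_eq[OF K _ vaff_has_derivative(2)]) (use \<phi> in simp)
  ultimately show ?thesis by (simp add: vgradh_def vec_eq_iff forall_2)
qed

lemma divh_trace: "divh T \<phi> x = vgradh T \<phi> x $ 1 $ 1 + vgradh T \<phi> x $ 2 $ 2"
  by (simp add: divh_def vgradh_def sum_2)

lemma divh_vaff:
  assumes "K \<in> T" "x \<in> interior K" "\<And>y. y \<in> interior K \<Longrightarrow> \<phi> y = vaff c y"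
  shows "divh T \<phi> x = c 1 + c 5"
  using vgradh_vaff[OF assms] by (simp add: divh_trace)

text \<open>The transposition reconciles two conventions: \<open>hessh\<close> has the outer
  derivative in the first index, \<open>vgradh\<close> in the second.\<close>

lemma hessh_eq: "hessh T v x = (\<chi> i j. vgradh T (gradh T v) x $ j $ i)"
  by (simp add: hessh_def vgradh_def gradh_def vec_eq_iff)

text \<open>\<open>K\<close> is the closure of its interior, so each of its points is a limit of
  interior points and the \<open>Lim\<close> in the trace is unique, on the boundary too.\<close>

lemma tr_eq:
  assumes "K \<in> T" "x \<in> K" "continuous_on UNIV g" "\<And>y. y \<in> interior K \<Longrightarrow> v y = g y"
  shows "tr K v x = g x"
proof -
  have "x islimpt interior K"
  proof (cases "x \<in> interior K")
    case True
    then show ?thesis using interior_limit_point[of x "interior K"] by simp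
  next
    case False
    then show ?thesis using assms(2) T_props(7)[OF assms(1)] unfolding closure_def by blast
  qed
  then have "\<not> trivial_limit (at x within interior K)" by (simp add: trivial_limit_within)
  moreover have "(g \<longlongrightarrow> g x) (at x within interior K)"
    using assms(3) by (meson UNIV_I continuous_on_def tendsto_within_subset subset_UNIV)
  then have "(v \<longlongrightarrow> g x) (at x within interior K)"
    by (rule Lim_transform_eventually) (use assms(4) in \<open>auto simp: eventually_at_filter\<close>)
  ultimately show ?thesis unfolding tr_def by (simp add: tendsto_Lim)
qed

lemma linepath_in_edge: "closed_segment a b edge_of K \<Longrightarrow> t \<in> {0..1} \<Longrightarrow> linepath a b t \<in> K"
  using edge_of_imp_subset linepath_in_path by blast

lemma midpoint_in_edge: "closed_segment a b edge_of K \<Longrightarrow> midpoint a b \<in> K"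
  using edge_of_imp_subset midpoint_in_closed_segment by blast

lemma seg_integral_jump:
  assumes "K \<in> T" "K' \<in> T" "closed_segment a b edge_of K" "closed_segment a b edge_of K'"
    and "\<And>y. y \<in> interior K \<Longrightarrow> \<phi> y = vaff c y" "\<And>y. y \<in> interior K' \<Longrightarrow> \<phi> y = vaff c' y"
  shows "seg_integral a b (\<lambda>x. tr K \<phi> x - tr K' \<phi> x) =
    dist a b *\<^sub>R (vaff c (midpoint a b) - vaff c' (midpoint a b))"
proof -
  have "seg_integral a b (\<lambda>x. tr K \<phi> x - tr K' \<phi> x) =
      dist a b *\<^sub>R ((1/2) *\<^sub>R ((vaff c a - vaff c' a) + (vaff c b - vaff c' b)))"
  proof (rule seg_integral_affine)
    fix t :: real assume t: "t \<in> {0..1}"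
    have "tr K \<phi> (linepath a b t) = vaff c (linepath a b t)"
      by (rule tr_eq[OF assms(1) linepath_in_edge[OF assms(3) t] continuous_on_vaff assms(5)])
    moreover have "tr K' \<phi> (linepath a b t) = vaff c' (linepath a b t)"
      by (rule tr_eq[OF assms(2) linepath_in_edge[OF assms(4) t] continuous_on_vaff assms(6)])
    ultimately have "tr K \<phi> (linepath a b t) - tr K' \<phi> (linepath a b t) =
        vaff c (linepath a b t) - vaff c' (linepath a b t)" by simp
    then show "tr K \<phi> (linepath a b t) - tr K' \<phi> (linepath a b t) =
        (1 - t) *\<^sub>R (vaff c a - vaff c' a) + t *\<^sub>R (vaff c b - vaff c' b)"
      unfolding linepath_def vaff_affine by (simp add: algebra_simps)
  qed
  then show ?thesis by (simp add: vaff_midpoint algebra_simps)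
qed

lemma seg_integral_trace:
  assumes "K \<in> T" "closed_segment a b edge_of K" "\<And>y. y \<in> interior K \<Longrightarrow> \<phi> y = vaff c y"
  shows "seg_integral a b (tr K \<phi>) = dist a b *\<^sub>R vaff c (midpoint a b)"
    "seg_integral a b (\<lambda>x. tr K \<phi> x \<bullet> n) = dist a b * (vaff c (midpoint a b) \<bullet> n)"
    "seg_integral a b (tr K (\<lambda>x. \<phi> x \<bullet> n)) = dist a b * (vaff c (midpoint a b) \<bullet> n)"
proof -
  have tr: "tr K \<phi> (linepath a b t) = (1 - t) *\<^sub>R vaff c a + t *\<^sub>R vaff c b" if "t \<in> {0..1}" for t
    using tr_eq[OF assms(1) linepath_in_edge[OF assms(2) that] continuous_on_vaff assms(3)]
    by (simp only: linepath_def vaff_affine)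
  have trn: "tr K (\<lambda>x. \<phi> x \<bullet> n) (linepath a b t) = vaff c (linepath a b t) \<bullet> n" if "t \<in> {0..1}" for t
    by (rule tr_eq[OF assms(1) linepath_in_edge[OF assms(2) that]])
      (use assms(3) in \<open>auto intro!: continuous_intros continuous_on_vaff\<close>)
  show "seg_integral a b (tr K \<phi>) = dist a b *\<^sub>R vaff c (midpoint a b)"
    unfolding vaff_midpoint by (rule seg_integral_affine) (rule tr)
  have "seg_integral a b (\<lambda>x. tr K \<phi> x \<bullet> n) = dist a b *\<^sub>R ((1/2) *\<^sub>R (vaff c a \<bullet> n + vaff c b \<bullet> n))"
    by (rule seg_integral_affine) (simp add: tr inner_add_left)
  then show "seg_integral a b (\<lambda>x. tr K \<phi> x \<bullet> n) = dist a b * (vaff c (midpoint a b) \<bullet> n)"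
    by (simp add: vaff_midpoint inner_add_left)
  have "seg_integral a b (tr K (\<lambda>x. \<phi> x \<bullet> n)) = dist a b *\<^sub>R ((1/2) *\<^sub>R (vaff c a \<bullet> n + vaff c b \<bullet> n))"
    by (rule seg_integral_affine, subst trn) (simp_all add: linepath_def vaff_affine inner_add_left)
  then show "seg_integral a b (tr K (\<lambda>x. \<phi> x \<bullet> n)) = dist a b * (vaff c (midpoint a b) \<bullet> n)"
    by (simp add: vaff_midpoint inner_add_left)
qed

end

section \<open>Integrals of piecewise continuous functions\<close>

lemma L2_inner_commute: "L2_inner \<Omega> u v = L2_inner \<Omega> v u"
  by (simp add: L2_inner_def inner_commute)

lemma L2_set_integrable_inner:
  fixes u v :: "real^2 \<Rightarrow> 'b::euclidean_space"
  assumes "u \<in> L2 \<Omega>" "v \<in> L2 \<Omega>"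
  shows "set_integrable lebesgue \<Omega> (\<lambda>x. u x \<bullet> v x)"
proof (rule set_integrable_bound)
  show "set_integrable lebesgue \<Omega> (\<lambda>x. (norm (u x))\<^sup>2 + (norm (v x))\<^sup>2)"
    using assms by (intro set_integral_add) (auto simp: L2_def)
  have "(\<lambda>x. (indicator \<Omega> x *\<^sub>R u x) \<bullet> (indicator \<Omega> x *\<^sub>R v x)) \<in> borel_measurable lebesgue"
    using assms by (intro borel_measurable_inner) (auto simp: L2_def set_borel_measurable_def)
  moreover have "(\<lambda>x. (indicator \<Omega> x *\<^sub>R u x) \<bullet> (indicator \<Omega> x *\<^sub>R v x)) =
      (\<lambda>x. indicat_real \<Omega> x *\<^sub>R (u x \<bullet> v x))"
    by (auto simp: fun_eq_iff indicator_def)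
  ultimately show "set_borel_measurable lebesgue \<Omega> (\<lambda>x. u x \<bullet> v x)"
    by (simp add: set_borel_measurable_def)
  have "norm (u x \<bullet> v x) \<le> norm ((norm (u x))\<^sup>2 + (norm (v x))\<^sup>2)" for x
  proof -
    have "norm (u x \<bullet> v x) \<le> norm (u x) * norm (v x)" by (simp add: Cauchy_Schwarz_ineq2)
    moreover have "2 * (norm (u x) * norm (v x)) \<le> (norm (u x))\<^sup>2 + (norm (v x))\<^sup>2"
      using sum_squares_bound[of "norm (u x)" "norm (v x)"] by simp
    moreover have "norm (u x) * norm (v x) \<ge> 0" by simp
    ultimately show ?thesis by (simp only: real_norm_def)
  qed
  then show "AE x in lebesgue. x \<in> \<Omega> \<longrightarrow> norm (u x \<bullet> v x) \<le> norm ((norm (u x))\<^sup>2 + (norm (v x))\<^sup>2)"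
    by simp
qed

lemma L2_inner_linear_right:
  fixes u v v' :: "real^2 \<Rightarrow> 'b::euclidean_space"
  assumes "u \<in> L2 \<Omega>" "v \<in> L2 \<Omega>" "v' \<in> L2 \<Omega>"
  shows "L2_inner \<Omega> u (\<lambda>x. v x + c *\<^sub>R v' x) = L2_inner \<Omega> u v + c * L2_inner \<Omega> u v'"
proof -
  have "L2_inner \<Omega> u (\<lambda>x. v x + c *\<^sub>R v' x) = (LINT x:\<Omega>|lebesgue. u x \<bullet> v x + c * (u x \<bullet> v' x))"
    by (simp add: L2_inner_def inner_add_right)
  also have "\<dots> = (LINT x:\<Omega>|lebesgue. u x \<bullet> v x) + (LINT x:\<Omega>|lebesgue. c * (u x \<bullet> v' x))"
    using L2_set_integrable_inner[OF assms(1,2)] L2_set_integrable_inner[OF assms(1,3)]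
    by (intro set_integral_add(2)) auto
  finally show ?thesis by (simp add: L2_inner_def)
qed

context polygon_mesh
begin

text \<open>The pieces must extend continuously to the plane: boundedness on the compact elements
  then yields square integrability. The values on the skeleton, a null set, stay free.\<close>

definition pw_continuous :: "(real^2 \<Rightarrow> 'b::euclidean_space) \<Rightarrow> bool"
  where "pw_continuous v \<longleftrightarrow> (\<forall>K\<in>T. \<exists>g. continuous_on UNIV g \<and> (\<forall>x\<in>interior K. v x = g x))"

lemma pw_continuousI:
  "(\<And>K. K \<in> T \<Longrightarrow> continuous_on UNIV (g K)) \<Longrightarrow>
   (\<And>K x. K \<in> T \<Longrightarrow> x \<in> interior K \<Longrightarrow> v x = g K x) \<Longrightarrow> pw_continuous v"
  unfolding pw_continuous_def by blast

lemma pw_continuousE: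
  assumes "pw_continuous v"
  obtains g where "\<forall>K\<in>T. continuous_on UNIV (g K)"
    "\<forall>K\<in>T. \<forall>x\<in>interior K. v x = g K x"
proof -
  have "\<exists>g. \<forall>K\<in>T. continuous_on UNIV (g K) \<and> (\<forall>x\<in>interior K. v x = g K x)"
    using assms unfolding pw_continuous_def by (rule bchoice)
  then show thesis using that by blast
qed

lemma pw_continuous_inner:
  assumes "pw_continuous u" "pw_continuous v"
  shows "pw_continuous (\<lambda>x. u x \<bullet> v x)"
proof -
  obtain g where g: "\<forall>K\<in>T. continuous_on UNIV (g K)"
    "\<forall>K\<in>T. \<forall>x\<in>interior K. u x = g K x" by (rule pw_continuousE[OF assms(1)])
  obtain h where h: "\<forall>K\<in>T. continuous_on UNIV (h K)"
    "\<forall>K\<in>T. \<forall>x\<in>interior K. v x = h K x" by (rule pw_continuousE[OF assms(2)])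
  show ?thesis
    by (rule pw_continuousI[of "\<lambda>K x. g K x \<bullet> h K x"])
      (use g h in \<open>auto intro!: continuous_on_inner\<close>)
qed

lemma negligible_skeleton: "negligible (\<Omega> - (\<Union>K\<in>T. interior K))"
proof -
  have "\<Omega> - (\<Union>K\<in>T. interior K) \<subseteq> (\<Union>K\<in>T. frontier K)"
  proof
    fix x assume x: "x \<in> \<Omega> - (\<Union>K\<in>T. interior K)"
    then have "x \<in> \<Union>T" using Union_T closure_subset by blast
    then obtain K where "K \<in> T" "x \<in> K" by blast
    moreover from this have "x \<in> frontier K"
      using x T_props(3)[of K] by (simp add: frontier_def)
    ultimately show "x \<in> (\<Union>K\<in>T. frontier K)" by blast
  qed
  moreover have "negligible (\<Union>K\<in>T. frontier K)"
    using T_props(1) negligible_convex_frontier by (intro negligible_Union) auto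
  ultimately show ?thesis using negligible_subset by blast
qed

lemma absolutely_integrable_on_element:
  assumes K: "K \<in> T" and g: "continuous_on UNIV g" "\<And>x. x \<in> interior K \<Longrightarrow> v x = g x"
  shows "v absolutely_integrable_on interior K"
proof -
  have int: "integrable lborel (\<lambda>x. indicator K x *\<^sub>R g x)"
    using borel_integrable_compact[OF T_props(2)[OF K]] g(1) continuous_on_subset by blast
  then have "set_integrable lebesgue K g"
    unfolding set_integrable_def by (subst integrable_completion) auto
  then have "set_integrable lebesgue (interior K) g"
    by (rule set_integrable_subset) (auto simp: interior_subset)
  then show ?thesis
    using set_integrable_cong[of lebesgue lebesgue "interior K" "interior K" v g] g(2) by auto
qed

lemma pw_continuous_integral:
  assumes v: "pw_continuous v"
  shows "v absolutely_integrable_on \<Omega>" "(LINT x:\<Omega>|lebesgue. v x) = (\<Sum>K\<in>T. integral (interior K) v)"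
proof -
  obtain g where g: "\<forall>K\<in>T. continuous_on UNIV (g K)"
    "\<forall>K\<in>T. \<forall>x\<in>interior K. v x = g K x" by (rule pw_continuousE[OF v])
  let ?U = "\<Union>K\<in>T. interior K"
  have K: "v absolutely_integrable_on interior K" if "K \<in> T" for K
    using absolutely_integrable_on_element[OF that] g that by blast
  have "v absolutely_integrable_on ?U" using K by (intro set_integrable_UN) auto
  moreover have neg: "negligible {x \<in> ?U - \<Omega>. v x \<noteq> 0}" "negligible {x \<in> \<Omega> - ?U. v x \<noteq> 0}"
  proof -
    have "{x \<in> ?U - \<Omega>. v x \<noteq> 0} = {}" using T_props(8) by blast
    then show "negligible {x \<in> ?U - \<Omega>. v x \<noteq> 0}" by (simp only: negligible_empty)
    show "negligible {x \<in> \<Omega> - ?U. v x \<noteq> 0}" by (rule negligible_subset[OF negligible_skeleton]) auto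
  qed
  ultimately show int: "v absolutely_integrable_on \<Omega>" by (rule absolutely_integrable_spike_set)
  have "(v has_integral (\<Sum>K\<in>T. integral (interior K) v)) ?U"
  proof (rule has_integral_UN)
    show "(v has_integral integral (interior K) v) (interior K)" if "K \<in> T" for K
      using set_lebesgue_integral_eq_integral(1)[OF K[OF that]] by (rule integrable_integral)
    show "pairwise (\<lambda>K K'. negligible (interior K \<inter> interior K')) T"
    proof (rule pairwiseI)
      fix K K' assume "K \<in> T" "K' \<in> T" "K \<noteq> K'"
      then have "interior K \<inter> interior K' = {}" using interior_disjoint interior_subset by blast
      then show "negligible (interior K \<inter> interior K')" by simp
    qed
  qed simp
  then have "integral ?U v = (\<Sum>K\<in>T. integral (interior K) v)" by (rule integral_unique)
  moreover have "integral ?U v = integral \<Omega> v" using neg by (rule integral_spike_set)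
  ultimately show "(LINT x:\<Omega>|lebesgue. v x) = (\<Sum>K\<in>T. integral (interior K) v)"
    using set_lebesgue_integral_eq_integral(2)[OF int] by simp
qed

lemma L2_inner_pw_continuous:
  assumes "pw_continuous u" "pw_continuous v"
  shows "L2_inner \<Omega> u v = (\<Sum>K\<in>T. integral (interior K) (\<lambda>x. u x \<bullet> v x))"
  unfolding L2_inner_def by (rule pw_continuous_integral(2)[OF pw_continuous_inner[OF assms]])

lemma pw_continuous_L2:
  assumes "pw_continuous v"
  shows "v \<in> L2 \<Omega>"
proof -
  have "set_borel_measurable lebesgue \<Omega> v"
    using pw_continuous_integral(1)[OF assms] unfolding set_integrable_def set_borel_measurable_def
    by (rule borel_measurable_integrable)
  moreover have "set_integrable lebesgue \<Omega> (\<lambda>x. v x \<bullet> v x)"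
    by (rule pw_continuous_integral(1)[OF pw_continuous_inner[OF assms assms]])
  ultimately show ?thesis by (simp add: L2_def power2_norm_eq_inner)
qed

lemma L2_inner_cong_elements:
  assumes "pw_continuous u" "pw_continuous v" "pw_continuous u'" "pw_continuous v'"
    and eq: "\<And>K x. K \<in> T \<Longrightarrow> x \<in> interior K \<Longrightarrow> u x \<bullet> v x = u' x \<bullet> v' x"
  shows "L2_inner \<Omega> u v = L2_inner \<Omega> u' v'"
  unfolding L2_inner_pw_continuous[OF assms(1,2)] L2_inner_pw_continuous[OF assms(3,4)]
  by (intro sum.cong integral_cong) (use eq in auto)

text \<open>Inside an element the set where the continuous extension is nonzero is open and null,
  hence empty. This turns vanishing energies into pointwise identities.\<close>

lemma L2_inner_self_eq_0:
  assumes v: "pw_continuous v" and 0: "L2_inner \<Omega> v v = 0" and x: "K \<in> T" "x \<in> interior K"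
  shows "v x = 0"
proof -
  obtain g where g: "\<forall>K\<in>T. continuous_on UNIV (g K)"
    "\<forall>K\<in>T. \<forall>x\<in>interior K. v x = g K x" by (rule pw_continuousE[OF v])
  have "integrable lebesgue (\<lambda>x. indicat_real \<Omega> x *\<^sub>R (v x \<bullet> v x))"
    using pw_continuous_integral(1)[OF pw_continuous_inner[OF v v]] by (simp add: set_integrable_def)
  moreover have "AE x in lebesgue. 0 \<le> indicat_real \<Omega> x *\<^sub>R (v x \<bullet> v x)" by simp
  ultimately have "AE x in lebesgue. indicat_real \<Omega> x *\<^sub>R (v x \<bullet> v x) = 0"
    using 0 integral_nonneg_eq_0_iff_AE unfolding L2_inner_def set_lebesgue_integral_def by blast
  then have "AE x in lebesgue. \<not> (x \<in> \<Omega> \<and> v x \<noteq> 0)" by (rule eventually_mono) auto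
  then obtain N where "N \<in> null_sets lebesgue" "{x. \<not> \<not> (x \<in> \<Omega> \<and> v x \<noteq> 0)} \<subseteq> N"
    by (auto simp: eventually_ae_filter)
  then have neg: "negligible {x \<in> \<Omega>. v x \<noteq> 0}"
    by (auto simp: negligible_iff_null_sets[symmetric] intro: negligible_subset)
  let ?N = "interior K \<inter> (- (g K -` {0}))"
  have "?N \<subseteq> {x \<in> \<Omega>. v x \<noteq> 0}" using g(2) T_props(8)[OF x(1)] x(1) by auto
  then have "negligible ?N" using neg negligible_subset by blast
  moreover have "open ?N"
    using bspec[OF g(1) x(1)] by (intro open_Int open_Compl closed_vimage) auto
  ultimately have "?N = {}" using open_not_negligible by blast
  then show ?thesis using bspec[OF bspec[OF g(2) x(1)] x(2)] x(2) by auto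
qed

definition area :: "(real^2) set \<Rightarrow> real"
  where "area K = measure lebesgue (interior K)"

lemma interior_lmeasurable: "K \<in> T \<Longrightarrow> interior K \<in> lmeasurable"
  using T_props(2) compact_imp_bounded bounded_interior lmeasurable_open by blast

lemma area_pos: "K \<in> T \<Longrightarrow> area K > 0"
  using negligible_iff_measure0[OF interior_lmeasurable] open_not_negligible[OF open_interior, of K] T_props(6)[of K]
  unfolding area_def by (metis measure_nonneg order_le_less)

lemma area_triangle:
  assumes "K \<in> T" "K = convex hull {a, b, c}" "cross2 (b - a) (c - a) > 0"
  shows "area K = cross2 (b - a) (c - a) / 2"
proof -
  have "area K = measure lebesgue K"
    unfolding area_def
    by (rule measure_interior) (use T_props[OF assms(1)] in \<open>auto simp: compact_imp_bounded negligible_convex_frontier\<close>)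
  also have "\<dots> = measure lborel K" using T_props(3)[OF assms(1)] by simp
  also have "\<dots> = \<bar>- cross2 (b - a) (c - a)\<bar> / 2"
    unfolding assms(2) content_triangle by (simp add: cross2_def algebra_simps)
  finally show ?thesis using assms(3) by simp
qed

lemma L2_inner_pw_constant:
  fixes u v :: "real^2 \<Rightarrow> real"
  assumes u: "\<And>K x. K \<in> T \<Longrightarrow> x \<in> interior K \<Longrightarrow> u x = \<alpha> K"
    and v: "\<And>K x. K \<in> T \<Longrightarrow> x \<in> interior K \<Longrightarrow> v x = \<beta> K"
  shows "L2_inner \<Omega> u v = (\<Sum>K\<in>T. area K * (\<alpha> K * \<beta> K))"
proof -
  have "pw_continuous u" "pw_continuous v"
    by (rule pw_continuousI[of "\<lambda>K x. \<alpha> K"]; use u in simp)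
       (rule pw_continuousI[of "\<lambda>K x. \<beta> K"]; use v in simp)
  then have "L2_inner \<Omega> u v = (\<Sum>K\<in>T. integral (interior K) (\<lambda>x. u x \<bullet> v x))"
    by (rule L2_inner_pw_continuous)
  also have "\<dots> = (\<Sum>K\<in>T. area K * (\<alpha> K * \<beta> K))"
  proof (rule sum.cong)
    fix K assume K: "K \<in> T"
    have "integral (interior K) (\<lambda>x. u x \<bullet> v x) = integral (interior K) (\<lambda>x. (\<alpha> K * \<beta> K) * 1)"
      by (rule integral_cong) (use u v K in simp)
    then show "integral (interior K) (\<lambda>x. u x \<bullet> v x) = area K * (\<alpha> K * \<beta> K)"
      unfolding integral_mult_right area_def lmeasure_integral[OF interior_lmeasurable[OF K]] by simp
  qed simp
  finally show ?thesis .
qed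

end

section \<open>The discrete Stokes complex\<close>

context polygon_mesh
begin

section \<open>The nonconforming spaces in terms of edge midpoints\<close>

lemma Morley_coeffs:
  assumes "v \<in> Morley \<Omega> T"
  obtains C where "\<forall>K\<in>T. \<forall>y\<in>interior K. v y = quad (C K) y"
proof -
  have "\<forall>K\<in>T. \<exists>c. \<forall>x\<in>interior K. v x = quad c x"
    using assms by (simp add: Morley_def Morley_tilde_def Poly_on_2_iff)
  then have "\<exists>C. \<forall>K\<in>T. \<forall>x\<in>interior K. v x = quad (C K) x" by (rule bchoice)
  then show thesis using that by blast
qed

lemma CR0_coeffs:
  assumes "\<phi> \<in> CR0 \<Omega> T"
  obtains D where "\<forall>K\<in>T. \<forall>y\<in>interior K. \<phi> y = vaff (D K) y"
proof -
  have "\<forall>K\<in>T. \<exists>c. \<forall>x\<in>interior K. \<phi> x = vaff c x"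
    unfolding Poly_on_1_vec_iff[symmetric] using assms by (simp add: CR0_def CR_def)
  then have "\<exists>D. \<forall>K\<in>T. \<forall>x\<in>interior K. \<phi> x = vaff (D K) x" by (rule bchoice)
  then show thesis using that by blast
qed

text \<open>Agreement at the endpoints of a common edge fixes, by \<open>quad_diff_midpoint\<close>,
  the tangential component of the gradient at the midpoint; with the normal derivative added, the
  whole gradient agrees there.\<close>

lemma Morley_iff:
  assumes v0: "\<forall>K\<in>T. \<forall>y\<in>interior K. v y = quad (C K) y"
  shows "v \<in> Morley \<Omega> T \<longleftrightarrow>
    (\<forall>K\<in>T. \<forall>K'\<in>T. \<forall>a. a extreme_point_of K \<and> a extreme_point_of K' \<longrightarrow> quad (C K) a = quad (C K') a) \<and>
    (\<forall>K\<in>T. \<forall>K'\<in>T. \<forall>a b. closed_segment a b edge_of K \<and> closed_segment a b edge_of K' \<longrightarrow>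
       vaff (gcoef (C K)) (midpoint a b) = vaff (gcoef (C K')) (midpoint a b)) \<and>
    (\<forall>K\<in>T. \<forall>a. a extreme_point_of K \<and> a \<in> frontier \<Omega> \<longrightarrow> quad (C K) a = 0)"
    (is "_ \<longleftrightarrow> ?V \<and> ?E \<and> ?B")
proof -
  let ?G = "\<lambda>K. vaff (gcoef (C K))"
  have v: "v y = quad (C K) y" if "K \<in> T" "y \<in> interior K" for K y using v0 that by blast
  have trv: "tr K v a = quad (C K) a" if "K \<in> T" "a extreme_point_of K" for K a
    by (rule tr_eq[OF that(1) extreme_point_in[OF that(2)] continuous_on_quad v[OF that(1)]])
  have trn: "tr K (\<lambda>x. gradh T v x \<bullet> n) (midpoint a b) = ?G K (midpoint a b) \<bullet> n"
    if "K \<in> T" "closed_segment a b edge_of K" for K a b n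
    by (rule tr_eq[OF that(1) midpoint_in_edge[OF that(2)]])
      (use gradh_quad[OF that(1) _ v[OF that(1)]] in \<open>auto intro!: continuous_intros continuous_on_vaff\<close>)
  have V: "(\<forall>K\<in>T. \<forall>K'\<in>T. \<forall>a. a extreme_point_of K \<and> a extreme_point_of K' \<longrightarrow> tr K v a = tr K' v a) \<longleftrightarrow> ?V"
    by (intro ball_cong refl all_cong1 imp_cong) (use trv in auto)
  have B: "(\<forall>K\<in>T. \<forall>a. a extreme_point_of K \<and> a \<in> frontier \<Omega> \<longrightarrow> tr K v a = 0) \<longleftrightarrow> ?B"
    by (intro ball_cong refl all_cong1 imp_cong) (use trv in auto)
  let ?E' = "\<forall>K\<in>T. \<forall>K'\<in>T. \<forall>a b. closed_segment a b edge_of K \<and> closed_segment a b edge_of K' \<longrightarrow>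
       tr K (\<lambda>x. gradh T v x \<bullet> outward_normal K a b) (midpoint a b) =
       tr K' (\<lambda>x. gradh T v x \<bullet> outward_normal K a b) (midpoint a b)"
  \<comment> \<open>The two edge conditions are shown equivalent in the presence of vertex
    continuity; if that fails, both sides of the claim are false.\<close>
  have E: "?E' \<longleftrightarrow> ?E" if "?V"
  proof (intro ball_cong refl all_cong1 imp_cong)
    fix K K' a b
    assume K: "K \<in> T" "K' \<in> T" and e: "closed_segment a b edge_of K \<and> closed_segment a b edge_of K'"
    let ?n = "outward_normal K a b" and ?\<delta> = "?G K (midpoint a b) - ?G K' (midpoint a b)"
    have n: "norm ?n = 1" "?n \<bullet> (b - a) = 0" using outward_normal_edge K e by auto
    have ab: "a \<noteq> b" "a extreme_point_of K" "b extreme_point_of K" "a extreme_point_of K'" "b extreme_point_of K'"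
      using e edge_endpoints by blast+
    then have "quad (C K) a = quad (C K') a" "quad (C K) b = quad (C K') b" using that K by blast+
    then have tangential: "?\<delta> \<bullet> (b - a) = 0"
      unfolding inner_diff_left quad_diff_midpoint[symmetric] by simp
    have "?n \<noteq> 0" using n(1) by auto
    then have "?\<delta> \<bullet> ?n = 0 \<longleftrightarrow> ?\<delta> = 0"
      using orthogonal_to_both_eq_0[of "b - a" ?n ?\<delta>] n ab(1) tangential by auto
    then show "tr K (\<lambda>x. gradh T v x \<bullet> ?n) (midpoint a b) = tr K' (\<lambda>x. gradh T v x \<bullet> ?n) (midpoint a b) \<longleftrightarrow>
        ?G K (midpoint a b) = ?G K' (midpoint a b)"
      using trn K e by (simp add: inner_diff_left)
  qed
  have P: "\<forall>K\<in>T. v \<in> Poly_on 2 (interior K)" unfolding Poly_on_2_iff using v by blast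
  have eq: "v \<in> Morley \<Omega> T \<longleftrightarrow> ?V \<and> ?E' \<and> ?B"
    unfolding Morley_def Morley_tilde_def mem_Collect_eq Let_def V B eqTrueI[OF P] simp_thms conj_assoc ..
  show ?thesis
  proof (cases ?V)
    case True
    show ?thesis unfolding eq E[OF True] ..
  next
    case False
    show ?thesis unfolding eq iffD2[OF eq_False False] simp_thms ..
  qed
qed

text \<open>Zero values at both ends of a boundary edge make the tangential derivative vanish at the
  midpoint, and the edge mean of the affine normal derivative is its midpoint value.\<close>

lemma Morley0_iff:
  assumes v0: "\<forall>K\<in>T. \<forall>y\<in>interior K. v y = quad (C K) y"
  shows "v \<in> Morley0 \<Omega> T \<longleftrightarrow> v \<in> Morley \<Omega> T \<and>
    (\<forall>K\<in>T. \<forall>a b. closed_segment a b edge_of K \<and> closed_segment a b \<subseteq> frontier \<Omega> \<longrightarrow>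
       vaff (gcoef (C K)) (midpoint a b) = 0)"
proof -
  have v: "v y = quad (C K) y" if "K \<in> T" "y \<in> interior K" for K y using v0 that by blast
  have "(\<forall>K\<in>T. \<forall>a b. closed_segment a b edge_of K \<and> closed_segment a b \<subseteq> frontier \<Omega> \<longrightarrow>
      seg_integral a b (tr K (\<lambda>x. gradh T v x \<bullet> outward_normal \<Omega> a b)) = 0) \<longleftrightarrow>
    (\<forall>K\<in>T. \<forall>a b. closed_segment a b edge_of K \<and> closed_segment a b \<subseteq> frontier \<Omega> \<longrightarrow>
       vaff (gcoef (C K)) (midpoint a b) = 0)" if "v \<in> Morley \<Omega> T"
  proof (intro ball_cong refl all_cong1 imp_cong)
    fix K a b
    assume K: "K \<in> T" and e: "closed_segment a b edge_of K \<and> closed_segment a b \<subseteq> frontier \<Omega>"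
    let ?n = "outward_normal \<Omega> a b" and ?g = "vaff (gcoef (C K)) (midpoint a b)"
    have ab: "a \<noteq> b" "a extreme_point_of K" "b extreme_point_of K" using e edge_endpoints by blast+
    have "a \<in> frontier \<Omega>" "b \<in> frontier \<Omega>" using e by auto
    then have "quad (C K) a = 0" "quad (C K) b = 0"
      using that ab K unfolding Morley_iff[OF v0] by blast+
    then have "?g \<bullet> (b - a) = 0" unfolding quad_diff_midpoint[symmetric] by simp
    moreover have n: "norm ?n = 1" "?n \<bullet> (b - a) = 0" using outward_normal_boundary[of a b] e ab(1) by blast+
    moreover have "?n \<noteq> 0" using n(1) by auto
    ultimately have "?g \<bullet> ?n = 0 \<longleftrightarrow> ?g = 0"
      using orthogonal_to_both_eq_0[of "b - a" ?n ?g] ab(1) by auto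
    moreover have "seg_integral a b (tr K (\<lambda>x. gradh T v x \<bullet> ?n)) = dist a b * (?g \<bullet> ?n)"
      using e gradh_quad[OF K _ v[OF K]] by (intro seg_integral_trace(3)[OF K]) auto
    ultimately show "seg_integral a b (tr K (\<lambda>x. gradh T v x \<bullet> ?n)) = 0 \<longleftrightarrow> ?g = 0"
      using ab(1) by simp
  qed
  then show ?thesis unfolding Morley0_def mem_Collect_eq by blast
qed

lemma pw_continuous_vaff:
  "(\<And>K x. K \<in> T \<Longrightarrow> x \<in> interior K \<Longrightarrow> \<phi> x = vaff (D K) x) \<Longrightarrow> pw_continuous \<phi>"
  by (rule pw_continuousI[OF continuous_on_vaff])

text \<open>Traces and jumps are affine along an edge, so their integrals are the length times the
  midpoint value. For \<open>K = K'\<close> the midpoint equation is trivial, which permits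
  quantification over all pairs.\<close>

lemma CR0_iff:
  assumes \<phi>0: "\<forall>K\<in>T. \<forall>y\<in>interior K. \<phi> y = vaff (D K) y"
  shows "\<phi> \<in> CR0 \<Omega> T \<longleftrightarrow>
    (\<forall>K\<in>T. \<forall>K'\<in>T. \<forall>a b. closed_segment a b edge_of K \<and> closed_segment a b edge_of K' \<longrightarrow>
       vaff (D K) (midpoint a b) = vaff (D K') (midpoint a b)) \<and>
    (\<forall>K\<in>T. \<forall>a b. closed_segment a b edge_of K \<and> closed_segment a b \<subseteq> frontier \<Omega> \<longrightarrow>
       vaff (D K) (midpoint a b) = 0)" (is "_ \<longleftrightarrow> ?J \<and> ?B")
proof -
  have \<phi>: "\<phi> y = vaff (D K) y" if "K \<in> T" "y \<in> interior K" for K y using \<phi>0 that by blast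
  have L2: "\<phi> \<in> L2 \<Omega>" by (rule pw_continuous_L2[OF pw_continuous_vaff[OF \<phi>]])
  have P: "\<forall>K\<in>T. \<forall>i. (\<lambda>x. \<phi> x $ i) \<in> Poly_on 1 (interior K)"
    unfolding Poly_on_1_vec_iff using \<phi> by blast
  have J: "(\<forall>K\<in>T. \<forall>K'\<in>T. \<forall>a b. K \<noteq> K' \<and> closed_segment a b edge_of K \<and> closed_segment a b edge_of K' \<longrightarrow>
       seg_integral a b (\<lambda>x. tr K \<phi> x - tr K' \<phi> x) = 0) \<longleftrightarrow> ?J"
  proof (intro ball_cong refl all_cong1)
    fix K K' a b
    assume K: "K \<in> T" "K' \<in> T"
    let ?e = "closed_segment a b edge_of K \<and> closed_segment a b edge_of K'"
    let ?i = "seg_integral a b (\<lambda>x. tr K \<phi> x - tr K' \<phi> x)"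
    show "(K \<noteq> K' \<and> ?e \<longrightarrow> ?i = 0) \<longleftrightarrow>
        (?e \<longrightarrow> vaff (D K) (midpoint a b) = vaff (D K') (midpoint a b))"
    proof (cases "K \<noteq> K' \<and> ?e")
      case True
      then have "a \<noteq> b" using edge_endpoints by blast
      then have "?i = 0 \<longleftrightarrow> vaff (D K) (midpoint a b) = vaff (D K') (midpoint a b)"
        using seg_integral_jump[OF K _ _ \<phi>[OF K(1)] \<phi>[OF K(2)]] True by simp
      then show ?thesis using True by blast
    qed auto
  qed
  have B: "(\<forall>K\<in>T. \<forall>a b. closed_segment a b edge_of K \<and> closed_segment a b \<subseteq> frontier \<Omega> \<longrightarrow>
      seg_integral a b (tr K \<phi>) = 0) \<longleftrightarrow> ?B"
  proof (intro ball_cong refl all_cong1 imp_cong)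
    fix K a b
    assume K: "K \<in> T" and e: "closed_segment a b edge_of K \<and> closed_segment a b \<subseteq> frontier \<Omega>"
    then have "a \<noteq> b" using edge_endpoints by blast
    then show "seg_integral a b (tr K \<phi>) = 0 \<longleftrightarrow> vaff (D K) (midpoint a b) = 0"
      using seg_integral_trace(1)[OF K _ \<phi>[OF K]] e by simp
  qed
  let ?N = "\<forall>K\<in>T. \<forall>a b. closed_segment a b edge_of K \<and> closed_segment a b \<subseteq> frontier \<Omega> \<longrightarrow>
      seg_integral a b (\<lambda>x. tr K \<phi> x \<bullet> outward_normal \<Omega> a b) = 0"
  have N: ?N if "?B"
  proof (intro ballI allI impI)
    fix K a b
    assume K: "K \<in> T" and e: "closed_segment a b edge_of K \<and> closed_segment a b \<subseteq> frontier \<Omega>"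
    then have "vaff (D K) (midpoint a b) = 0" using that by blast
    then show "seg_integral a b (\<lambda>x. tr K \<phi> x \<bullet> outward_normal \<Omega> a b) = 0"
      using seg_integral_trace(2)[OF K _ \<phi>[OF K]] e by simp
  qed
  have eq: "\<phi> \<in> CR0 \<Omega> T \<longleftrightarrow> ?J \<and> ?N \<and> ?B"
    unfolding CR0_def CR_def mem_Collect_eq J B eqTrueI[OF L2] eqTrueI[OF P] simp_thms conj_assoc ..
  show ?thesis
  proof (cases ?B)
    case True
    show ?thesis unfolding eq eqTrueI[OF True] eqTrueI[OF N[OF True]] simp_thms ..
  next
    case False
    show ?thesis unfolding eq iffD2[OF eq_False False] simp_thms ..
  qed
qed

lemma curlh_quad:
  assumes "K \<in> T" "x \<in> interior K" "\<And>y. y \<in> interior K \<Longrightarrow> v y = quad c y"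
  shows "curlh T v x = vaff (rcoef (gcoef c)) x"
  using gradh_quad[OF assms] by (simp add: curlh_eq rot_vaff)

text \<open>In midpoint form the edge conditions of the two spaces coincide up to
  \<open>rot\<close>, which is injective.\<close>

lemma curlh_Morley0_in_CR0:
  assumes "v \<in> Morley0 \<Omega> T"
  shows "curlh T v \<in> CR0 \<Omega> T"
proof -
  have "v \<in> Morley \<Omega> T" using assms by (simp add: Morley0_def)
  then obtain C where C: "\<forall>K\<in>T. \<forall>y\<in>interior K. v y = quad (C K) y" by (rule Morley_coeffs)
  have curl: "\<forall>K\<in>T. \<forall>y\<in>interior K. curlh T v y = vaff (rcoef (gcoef (C K))) y"
    using curlh_quad C by blast
  have "rot 0 = 0" by (simp add: vec2_eq_iff)
  then have rot0: "rot x = 0 \<longleftrightarrow> x = 0" for x by (metis rot_eq_iff)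
  from assms show ?thesis
    unfolding CR0_iff[OF curl] Morley0_iff[OF C] Morley_iff[OF C] rot_vaff[symmetric] rot_eq_iff rot0
    by (elim conjE) (intro conjI)
qed

section \<open>Exactness: potentials of divergence-free fields\<close>

lemma affine_interpolation:
  fixes h :: "real^2 \<Rightarrow> real"
  assumes "K \<in> T"
  shows "\<exists>g. \<forall>p q. p extreme_point_of K \<and> q extreme_point_of K \<longrightarrow> g \<bullet> (q - p) = h q - h p"
proof -
  obtain a b c where abc: "cross2 (b - a) (c - a) > 0" "\<And>x. x extreme_point_of K \<longleftrightarrow> x \<in> {a, b, c}"
    using triangle_vertices[OF simplex_T[OF assms]] by metis
  define D where "D = cross2 (b - a) (c - a)"
  \<comment> \<open>The gradient of the affine interpolant of \<open>h\<close>, by Cramer's rule: up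
    to the factors \<open>D\<close> and \<open>- D\<close>, \<open>rot (c - a)\<close> and
    \<open>rot (b - a)\<close> are dual to the edge vectors.\<close>
  define g where "g = (1/D) *\<^sub>R ((h b - h a) *\<^sub>R rot (c - a) - (h c - h a) *\<^sub>R rot (b - a))"
  have D: "D > 0" using abc D_def by simp
  have "rot (c - a) \<bullet> (b - a) = D" "rot (b - a) \<bullet> (c - a) = - D"
    "rot (b - a) \<bullet> (b - a) = 0" "rot (c - a) \<bullet> (c - a) = 0"
    by (simp_all add: D_def inner_2 cross2_def algebra_simps)
  then have "g \<bullet> (b - a) = h b - h a" "g \<bullet> (c - a) = h c - h a"
    unfolding g_def inner_scaleR_left inner_diff_left using D by simp_all
  then have L: "g \<bullet> b - h b = g \<bullet> a - h a" "g \<bullet> c - h c = g \<bullet> a - h a"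
    by (simp_all add: inner_diff_right)
  have "g \<bullet> (q - p) = h q - h p" if "p extreme_point_of K" "q extreme_point_of K" for p q
  proof -
    have "g \<bullet> p - h p = g \<bullet> a - h a" "g \<bullet> q - h q = g \<bullet> a - h a" using that abc(2) L by auto
    then show ?thesis by (simp add: inner_diff_right)
  qed
  then show ?thesis by blast
qed

text \<open>The dimension decides: a bounded convex set of dimension 2 has a connected relative
  frontier, whereas that of a segment is two points.\<close>

lemma connected_frontier_\<Omega>: "connected (frontier \<Omega>)"
proof -
  have "aff_dim \<Omega> = 2" using aff_dim_open[OF open_\<Omega> \<Omega>_nonempty] by simp
  then have "connected (rel_frontier \<Omega>)"
    by (intro connected_sphere_gen convex_\<Omega> bounded_\<Omega>) simp
  then show ?thesis by (simp add: rel_frontier_def frontier_\<Omega> rel_interior_open open_\<Omega>)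
qed

text \<open>A supporting hyperplane at \<open>x\<close> cuts an element containing \<open>x\<close>
  in a face, and it misses the open domain, where the functional is strictly larger.\<close>

lemma frontier_face:
  assumes "x \<in> frontier \<Omega>"
  obtains K C where "K \<in> T" "C face_of K" "C \<subseteq> frontier \<Omega>" "x \<in> C"
proof -
  have x: "x \<in> closure \<Omega>" "x \<notin> rel_interior \<Omega>"
    using assms by (auto simp: frontier_\<Omega> rel_interior_open open_\<Omega>)
  obtain h where h: "\<And>y. y \<in> closure \<Omega> \<Longrightarrow> h \<bullet> x \<le> h \<bullet> y" "\<And>y. y \<in> rel_interior \<Omega> \<Longrightarrow> h \<bullet> x < h \<bullet> y"
    using supporting_hyperplane_relative_frontier[OF convex_\<Omega> x] by metis
  obtain K where K: "K \<in> T" "x \<in> K" using x(1) Union_T by blast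
  let ?C = "K \<inter> {y. h \<bullet> y = h \<bullet> x}"
  have "?C face_of K"
    using h(1) T_props(4)[OF K(1)] by (intro face_of_Int_supporting_hyperplane_ge T_props(1)[OF K(1)]) auto
  moreover have "?C \<subseteq> frontier \<Omega>"
    using h(2) T_props(4)[OF K(1)] by (fastforce simp: frontier_\<Omega> rel_interior_open open_\<Omega>)
  ultimately show thesis using that K by blast
qed

text \<open>The boundary is covered by finitely many faces of elements, vertices or edges. The
  potential is constant on each of them, and connectedness of the boundary joins the values.\<close>

lemma potential_constant_on_frontier:
  fixes F :: "real^2 \<Rightarrow> real"
  assumes F: "\<And>K x y. K \<in> T \<Longrightarrow> x \<in> K \<Longrightarrow> y \<in> K \<Longrightarrow> F y - F x = g K \<bullet> (y - x)"
    and bd: "\<And>K a b. K \<in> T \<Longrightarrow> closed_segment a b edge_of K \<Longrightarrow> closed_segment a b \<subseteq> frontier \<Omega> \<Longrightarrow>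
      g K \<bullet> (b - a) = 0"
  shows "F constant_on frontier \<Omega>"
proof (rule constant_on_finite_closed_cover[OF connected_frontier_\<Omega>])
  let ?\<C> = "{C. \<exists>K\<in>T. C face_of K \<and> C \<subseteq> frontier \<Omega>}"
  have "?\<C> \<subseteq> (\<Union>K\<in>T. {C. C face_of K})" by blast
  moreover have "finite (\<Union>K\<in>T. {C. C face_of K})"
    using simplex_T simplex_imp_polytope finite_polytope_faces by (intro finite_UN_I finite_T) blast
  ultimately show "finite ?\<C>" by (rule finite_subset)
  show "closed C" if "C \<in> ?\<C>" for C
    using that T_props(1,2) face_of_imp_compact compact_imp_closed by blast
  show "frontier \<Omega> \<subseteq> \<Union>?\<C>"
  proof
    fix x assume "x \<in> frontier \<Omega>"
    then obtain K C where "K \<in> T" "C face_of K" "C \<subseteq> frontier \<Omega>" "x \<in> C" by (rule frontier_face)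
    then show "x \<in> \<Union>?\<C>" by blast
  qed
  fix C x y assume C: "C \<in> ?\<C>" and xy: "x \<in> C \<inter> frontier \<Omega>" "y \<in> C \<inter> frontier \<Omega>"
  then obtain K where K: "K \<in> T" "C face_of K" "C \<subseteq> frontier \<Omega>" by blast
  show "F x = F y"
  proof (cases "x = y")
    case False
    have "C \<noteq> K"
      using K(3) T_props(6,8)[OF K(1)] interior_subset[of K] frontier_\<Omega> by blast
    then obtain a b where ab: "C = closed_segment a b" "closed_segment a b edge_of K"
      using proper_face_is_edge[OF simplex_T[OF K(1)] K(2)] xy False by (metis IntD1)
    obtain s where s: "y - x = s *\<^sub>R (b - a)" by (rule closed_segment_diff[of x a b y]) (use xy ab in auto)
    have "x \<in> K" "y \<in> K" using xy K(2) face_of_imp_subset by blast+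
    then have "F y - F x = s * (g K \<bullet> (b - a))" using F[OF K(1)] s by simp
    then show ?thesis using bd[OF K(1) ab(2)] K(3) ab(1) by simp
  qed simp
qed

text \<open>Exactness of the complex at \<open>CR0\<close>. Each element carries a quadratic with
  the prescribed rotated gradient, determined up to a constant; the glued potential \<open>F\<close>
  of the interpolants serves to choose these constants consistently.\<close>

lemma Morley0_curl_potential:
  assumes \<phi>: "\<phi> \<in> CR0 \<Omega> T" and div0: "\<And>K x. K \<in> T \<Longrightarrow> x \<in> interior K \<Longrightarrow> divh T \<phi> x = 0"
  shows "\<exists>v\<in>Morley0 \<Omega> T. \<forall>K\<in>T. \<forall>x\<in>interior K. curlh T v x = \<phi> x"
proof -
  obtain D where D0: "\<forall>K\<in>T. \<forall>y\<in>interior K. \<phi> y = vaff (D K) y"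
    using \<phi> by (rule CR0_coeffs)
  then have D: "\<phi> y = vaff (D K) y" if "K \<in> T" "y \<in> interior K" for K y using that by blast
  define C where "C K = pcoef (D K)" for K
  let ?G = "\<lambda>K. vaff (gcoef (C K))"
  have rotG: "rot (?G K x) = vaff (D K) x" if K: "K \<in> T" for K x
  proof -
    obtain y where y: "y \<in> interior K" using T_props(6)[OF K] by blast
    then have "D K 1 + D K 5 = 0" using div0[OF K y] divh_vaff[OF K y D[OF K]] by simp
    then show ?thesis unfolding rot_vaff C_def by (rule vaff_pcoef)
  qed
  have J: "?G K (midpoint a b) = ?G K' (midpoint a b)"
    if "K \<in> T" "K' \<in> T" "closed_segment a b edge_of K" "closed_segment a b edge_of K'" for K K' a b
  proof -
    have "rot (?G K (midpoint a b)) = rot (?G K' (midpoint a b))"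
      unfolding rotG[OF that(1)] rotG[OF that(2)] using \<phi> that unfolding CR0_iff[OF D0] by blast
    then show ?thesis by simp
  qed
  have B: "?G K (midpoint a b) = 0"
    if "K \<in> T" "closed_segment a b edge_of K" "closed_segment a b \<subseteq> frontier \<Omega>" for K a b
  proof -
    have "rot (?G K (midpoint a b)) = 0"
      unfolding rotG[OF that(1)] using \<phi> that unfolding CR0_iff[OF D0] by blast
    then show ?thesis by (simp add: vec2_eq_iff)
  qed
  have "\<forall>K\<in>T. \<exists>g. \<forall>p q. p extreme_point_of K \<and> q extreme_point_of K \<longrightarrow>
      g \<bullet> (q - p) = quad (C K) q - quad (C K) p"
    using affine_interpolation by blast
  then have "\<exists>g. \<forall>K\<in>T. \<forall>p q. p extreme_point_of K \<and> q extreme_point_of K \<longrightarrow>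
      g K \<bullet> (q - p) = quad (C K) q - quad (C K) p" by (rule bchoice)
  then obtain g where g: "\<And>K p q. K \<in> T \<Longrightarrow> p extreme_point_of K \<Longrightarrow> q extreme_point_of K \<Longrightarrow>
      g K \<bullet> (q - p) = quad (C K) q - quad (C K) p" by blast
  have g_edge: "g K \<bullet> (b - a) = ?G K (midpoint a b) \<bullet> (b - a)"
    if "K \<in> T" "closed_segment a b edge_of K" for K a b
    unfolding quad_diff_midpoint[symmetric] using g[OF that(1)] edge_endpoints[OF that(2)] by blast
  \<comment> \<open>The quadratics may differ in the interior of a common edge, but the slopes of
    their interpolants along it are tangential midpoint gradients, which agree.\<close>
  have compat: "g K \<bullet> (y - x) = g K' \<bullet> (y - x)"
    if K: "K \<in> T" "K' \<in> T" and xy: "x \<in> K \<inter> K'" "y \<in> K \<inter> K'" for K K' x y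
  proof (cases "K = K' \<or> x = y")
    case False
    then obtain a b where ab: "K \<inter> K' = closed_segment a b" "closed_segment a b edge_of K"
      "closed_segment a b edge_of K'" using common_edge[OF K _ xy] by blast
    obtain s where "y - x = s *\<^sub>R (b - a)" by (rule closed_segment_diff[of x a b y]) (use xy ab in auto)
    then show ?thesis using g_edge[OF K(1) ab(2)] g_edge[OF K(2) ab(3)] J[OF K ab(2,3)] by simp
  qed auto
  have "\<exists>F. \<forall>K\<in>T. \<forall>x\<in>K. \<forall>y\<in>K. F y - F x = g K \<bullet> (y - x)"
    by (rule convex_piecewise_potential[OF convex_closure[OF convex_\<Omega>] compact_closure_\<Omega> finite_T Union_T])
      (use T_props(1,3) in blast, rule compat)
  then obtain F where F: "\<And>K x y. K \<in> T \<Longrightarrow> x \<in> K \<Longrightarrow> y \<in> K \<Longrightarrow> F y - F x = g K \<bullet> (y - x)" by blast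
  have "F constant_on frontier \<Omega>"
    using F by (rule potential_constant_on_frontier) (use g_edge B in auto)
  then obtain f0 where f0: "\<And>x. x \<in> frontier \<Omega> \<Longrightarrow> F x = f0" unfolding constant_on_def by blast
  have "\<forall>K\<in>T. \<exists>e. e extreme_point_of K" using triangle_vertices simplex_T by (metis insertI1)
  then have "\<exists>e. \<forall>K\<in>T. e K extreme_point_of K" by (rule bchoice)
  then obtain e where e: "\<And>K. K \<in> T \<Longrightarrow> e K extreme_point_of K" by blast
  \<comment> \<open>Only the constant coefficient moves: the value at one vertex \<open>e K\<close>
    becomes \<open>F (e K) - f0\<close>, and the other vertices follow because \<open>F\<close> and
    the quadratic have the same vertex differences. Subtracting \<open>f0\<close> gives zero
    boundary values.\<close>
  define C' where "C' K = (C K)(0 := C K 0 + (F (e K) - f0 - quad (C K) (e K)))" for K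
  have quadC': "quad (C' K) x = quad (C K) x + (F (e K) - f0 - quad (C K) (e K))" for K x
    by (simp add: quad_def C'_def)
  have gC': "gcoef (C' K) = gcoef (C K)" for K by (simp add: gcoef_def C'_def)
  have ext: "quad (C' K) a = F a - f0" if "K \<in> T" "a extreme_point_of K" for K a
    using g[OF that(1) e[OF that(1)] that(2)] F[OF that(1), of "e K" a] e that extreme_point_in
    unfolding quadC' by fastforce
  define v where "v x = quad (C' (SOME K. K \<in> T \<and> x \<in> interior K)) x" for x
  have v: "v y = quad (C' K) y" if "K \<in> T" "y \<in> interior K" for K y
  proof -
    let ?K = "SOME K. K \<in> T \<and> y \<in> interior K"
    have "?K \<in> T \<and> y \<in> interior ?K" by (rule someI[of _ K]) (use that in auto)
    then have "?K = K" using interior_disjoint[of ?K K] that interior_subset[of K] by blast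
    then show ?thesis by (simp add: v_def)
  qed
  then have v0: "\<forall>K\<in>T. \<forall>y\<in>interior K. v y = quad (C' K) y" by blast
  have "v \<in> Morley0 \<Omega> T"
    unfolding Morley0_iff[OF v0] Morley_iff[OF v0] gC'
  proof (intro conjI)
    show "\<forall>K\<in>T. \<forall>K'\<in>T. \<forall>a. a extreme_point_of K \<and> a extreme_point_of K' \<longrightarrow> quad (C' K) a = quad (C' K') a"
      using ext by simp
    show "\<forall>K\<in>T. \<forall>a. a extreme_point_of K \<and> a \<in> frontier \<Omega> \<longrightarrow> quad (C' K) a = 0"
      using ext f0 by simp
  qed (use J B in blast)+
  moreover have "curlh T v x = \<phi> x" if "K \<in> T" "x \<in> interior K" for K x
    using curlh_quad[OF that v[OF that(1)]] rotG[OF that(1)] D[OF that] by (simp add: gC' rot_vaff)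
  ultimately show ?thesis by blast
qed

text \<open>The vector \<^term>\<open>rot (q - p)\<close> is the outward normal scaled by the length of the edge.\<close>

lemma triangle_divergence:
  assumes "K \<in> T"
  shows "(\<Sum>(p, q)\<in>dedges K. vaff c (midpoint p q) \<bullet> rot (q - p)) = area K * (c 1 + c 5)"
proof -
  obtain a b d where abd: "K = convex hull {a, b, d}" "cross2 (b - a) (d - a) > 0"
    "\<And>x. x extreme_point_of K \<longleftrightarrow> x \<in> {a, b, d}" using triangle_vertices[OF simplex_T[OF assms]] by metis
  note ded = dedges_triangle[OF abd]
  have "(\<Sum>(p, q)\<in>dedges K. vaff c (midpoint p q) \<bullet> rot (q - p)) =
      vaff c (midpoint a b) \<bullet> rot (b - a) + vaff c (midpoint b d) \<bullet> rot (d - b) + vaff c (midpoint d a) \<bullet> rot (a - d)"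
    unfolding ded(1) using ded(2-4) by simp
  also have "\<dots> = cross2 (b - a) (d - a) / 2 * (c 1 + c 5)"
    by (simp add: inner_2 cross2_def midpoint_def) (simp add: field_simps)
  finally show ?thesis unfolding area_triangle[OF assms abd(1,2)] .
qed

text \<open>Divergence theorem: agreement at midpoints cancels the fluxes across interior edges, and
  boundary fluxes vanish. Both the normalisation of the pressure and \<open>divh_CR0_in_Qh\<close>
  rest on it.\<close>

lemma CR0_mean_divergence:
  assumes \<phi>: "\<phi> \<in> CR0 \<Omega> T" and D0: "\<forall>K\<in>T. \<forall>y\<in>interior K. \<phi> y = vaff (D K) y"
  shows "(\<Sum>K\<in>T. area K * (D K 1 + D K 5)) = 0"
proof -
  have "(\<Sum>K\<in>T. \<Sum>(p, q)\<in>dedges K. vaff (D K) (midpoint p q) \<bullet> rot (q - p)) = 0"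
  proof (rule sum_dedges_eq_0)
    fix K p q assume K: "K \<in> T" "(p, q) \<in> dedges K" "closed_segment p q \<subseteq> frontier \<Omega>"
    then have "vaff (D K) (midpoint p q) = 0"
      using \<phi> dedges_edge[OF simplex_T[OF K(1)] K(2)] unfolding CR0_iff[OF D0] by blast
    then show "vaff (D K) (midpoint p q) \<bullet> rot (q - p) = 0" by simp
  next
    fix K K' p q
    assume K: "K \<in> T" "K' \<in> T" "K \<noteq> K'" and pq: "(p, q) \<in> dedges K" "(q, p) \<in> dedges K'"
    have "closed_segment p q edge_of K" "closed_segment p q edge_of K'"
      using dedges_edge[OF simplex_T[OF K(1)] pq(1)] dedges_edge[OF simplex_T[OF K(2)] pq(2)]
      by (simp_all add: closed_segment_commute)
    then have "vaff (D K) (midpoint p q) = vaff (D K') (midpoint p q)"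
      using \<phi> K unfolding CR0_iff[OF D0] by blast
    moreover have "rot (q - p) = - rot (p - q)" by (simp add: vec2_eq_iff)
    ultimately show "vaff (D K) (midpoint p q) \<bullet> rot (q - p) = - (vaff (D K') (midpoint q p) \<bullet> rot (p - q))"
      by (simp add: midpoint_sym)
  qed
  then show ?thesis using triangle_divergence by simp
qed

end

section \<open>Discrete Poisson and Brinkman problems\<close>

context polygon_mesh
begin

lemma gradh_outside: "x \<notin> (\<Union>K\<in>T. interior K) \<Longrightarrow> gradh T v x = 0"
  by (simp add: gradh_def pdh_def vec_eq_iff)

lemma vgradh_outside: "x \<notin> (\<Union>K\<in>T. interior K) \<Longrightarrow> vgradh T \<phi> x = 0"
  by (simp add: vgradh_def pdh_def vec_eq_iff)

lemma divh_outside: "x \<notin> (\<Union>K\<in>T. interior K) \<Longrightarrow> divh T \<phi> x = 0"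
  by (simp add: divh_def pdh_def)

section \<open>Linearity and piecewise continuity of the elementwise operators\<close>

lemma Morley_combination:
  assumes C: "\<forall>K\<in>T. \<forall>y\<in>interior K. u y = quad (C K) y" "\<forall>K\<in>T. \<forall>y\<in>interior K. v y = quad (D K) y"
  shows "\<forall>K\<in>T. \<forall>y\<in>interior K. u y + t *\<^sub>R v y = quad (\<lambda>k. C K k + t * D K k) y"
  using C by (simp add: quad_linear)

lemma fun_subspace_Morley: "fun_subspace (Morley \<Omega> T)"
  unfolding fun_subspace_def
proof (intro conjI ballI allI)
  have "\<forall>K\<in>T. \<forall>y\<in>interior K. 0 = quad (\<lambda>k. 0) y" by (simp add: quad_def)
  from Morley_iff[OF this] have "(\<lambda>x. 0) \<in> Morley \<Omega> T" by (simp add: quad_def)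
  then show "Morley \<Omega> T \<noteq> {}" by blast
  fix u v t assume uv: "u \<in> Morley \<Omega> T" "v \<in> Morley \<Omega> T"
  obtain C where C: "\<forall>K\<in>T. \<forall>y\<in>interior K. u y = quad (C K) y" using uv(1) by (rule Morley_coeffs)
  obtain D where D: "\<forall>K\<in>T. \<forall>y\<in>interior K. v y = quad (D K) y" using uv(2) by (rule Morley_coeffs)
  note uv = uv(1)[unfolded Morley_iff[OF C]] uv(2)[unfolded Morley_iff[OF D]]
  note V = uv[THEN conjunct1, rule_format] and E = uv[THEN conjunct2, THEN conjunct1, rule_format]
    and B = uv[THEN conjunct2, THEN conjunct2, rule_format]
  show "(\<lambda>x. u x + t *\<^sub>R v x) \<in> Morley \<Omega> T"
    unfolding Morley_iff[OF Morley_combination[OF C D]] quad_linear vaff_gcoef_linear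
  proof (intro conjI ballI allI impI)
    fix K K' a assume K: "K \<in> T" "K' \<in> T" "a extreme_point_of K \<and> a extreme_point_of K'"
    have "quad (C K) a = quad (C K') a" "quad (D K) a = quad (D K') a" using V(1)[OF K] V(2)[OF K] .
    then show "quad (C K) a + t * quad (D K) a = quad (C K') a + t * quad (D K') a" by simp
  next
    fix K K' a b assume K: "K \<in> T" "K' \<in> T" "closed_segment a b edge_of K \<and> closed_segment a b edge_of K'"
    have "vaff (gcoef (C K)) (midpoint a b) = vaff (gcoef (C K')) (midpoint a b)"
      "vaff (gcoef (D K)) (midpoint a b) = vaff (gcoef (D K')) (midpoint a b)" using E(1)[OF K] E(2)[OF K] .
    then show "vaff (gcoef (C K)) (midpoint a b) + t *\<^sub>R vaff (gcoef (D K)) (midpoint a b) =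
        vaff (gcoef (C K')) (midpoint a b) + t *\<^sub>R vaff (gcoef (D K')) (midpoint a b)" by simp
  next
    fix K a assume K: "K \<in> T" "a extreme_point_of K \<and> a \<in> frontier \<Omega>"
    have "quad (C K) a = 0" "quad (D K) a = 0" using B(1)[OF K] B(2)[OF K] .
    then show "quad (C K) a + t * quad (D K) a = 0" by simp
  qed
qed

lemma fun_subspace_CR0: "fun_subspace (CR0 \<Omega> T)"
  unfolding fun_subspace_def
proof (intro conjI ballI allI)
  have 0: "vaff (\<lambda>k. 0) y = 0" for y by (simp add: vec2_eq_iff)
  have "\<forall>K\<in>T. \<forall>y\<in>interior K. 0 = vaff (\<lambda>k. 0) y" by (simp add: 0)
  from CR0_iff[OF this] have "(\<lambda>x. 0) \<in> CR0 \<Omega> T" by (simp add: 0)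
  then show "CR0 \<Omega> T \<noteq> {}" by blast
  fix u v t assume uv: "u \<in> CR0 \<Omega> T" "v \<in> CR0 \<Omega> T"
  obtain C where C: "\<forall>K\<in>T. \<forall>y\<in>interior K. u y = vaff (C K) y" using uv(1) by (rule CR0_coeffs)
  obtain D where D: "\<forall>K\<in>T. \<forall>y\<in>interior K. v y = vaff (D K) y" using uv(2) by (rule CR0_coeffs)
  have CD: "\<forall>K\<in>T. \<forall>y\<in>interior K. u y + t *\<^sub>R v y = vaff (\<lambda>k. C K k + t * D K k) y"
    using C D by (simp add: vaff_linear)
  note uv = uv(1)[unfolded CR0_iff[OF C]] uv(2)[unfolded CR0_iff[OF D]]
  show "(\<lambda>x. u x + t *\<^sub>R v x) \<in> CR0 \<Omega> T"
    unfolding CR0_iff[OF CD] vaff_linear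
  proof (intro conjI ballI allI impI)
    fix K K' a b assume "K \<in> T" "K' \<in> T" "closed_segment a b edge_of K \<and> closed_segment a b edge_of K'"
    then have "vaff (C K) (midpoint a b) = vaff (C K') (midpoint a b)"
      "vaff (D K) (midpoint a b) = vaff (D K') (midpoint a b)" using uv by blast+
    then show "vaff (C K) (midpoint a b) + t *\<^sub>R vaff (D K) (midpoint a b) =
        vaff (C K') (midpoint a b) + t *\<^sub>R vaff (D K') (midpoint a b)" by simp
  next
    fix K a b assume "K \<in> T" "closed_segment a b edge_of K \<and> closed_segment a b \<subseteq> frontier \<Omega>"
    then have "vaff (C K) (midpoint a b) = 0" "vaff (D K) (midpoint a b) = 0" using uv by blast+
    then show "vaff (C K) (midpoint a b) + t *\<^sub>R vaff (D K) (midpoint a b) = 0" by simp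
  qed
qed

text \<open>The default value 0 outside the open elements makes this an identity of functions, so it
  can be rewritten inside inner products.\<close>

lemma gradh_linear:
  assumes "u \<in> Morley \<Omega> T" "v \<in> Morley \<Omega> T"
  shows "gradh T (\<lambda>x. u x + t * v x) = (\<lambda>x. gradh T u x + t *\<^sub>R gradh T v x)"
proof
  fix x show "gradh T (\<lambda>x. u x + t * v x) x = gradh T u x + t *\<^sub>R gradh T v x"
  proof (cases "x \<in> (\<Union>K\<in>T. interior K)")
    case True
    then obtain K where K: "K \<in> T" "x \<in> interior K" by blast
    obtain C where C: "\<forall>K\<in>T. \<forall>y\<in>interior K. u y = quad (C K) y" using assms(1) by (rule Morley_coeffs)
    obtain D where D: "\<forall>K\<in>T. \<forall>y\<in>interior K. v y = quad (D K) y" using assms(2) by (rule Morley_coeffs)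
    have "gradh T (\<lambda>x. u x + t * v x) x = vaff (gcoef (\<lambda>k. C K k + t * D K k)) x"
      by (rule gradh_quad[OF K]) (use Morley_combination[OF C D, of t] K in simp)
    moreover have "gradh T u x = vaff (gcoef (C K)) x" "gradh T v x = vaff (gcoef (D K)) x"
      using gradh_quad[OF K] C D K(1) by blast+
    ultimately show ?thesis by (simp add: vaff_gcoef_linear)
  qed (simp add: gradh_outside)
qed

lemma vgradh_linear:
  assumes "\<phi> \<in> CR0 \<Omega> T" "\<psi> \<in> CR0 \<Omega> T"
  shows "vgradh T (\<lambda>x. \<phi> x + t *\<^sub>R \<psi> x) = (\<lambda>x. vgradh T \<phi> x + t *\<^sub>R vgradh T \<psi> x)"
proof
  fix x show "vgradh T (\<lambda>x. \<phi> x + t *\<^sub>R \<psi> x) x = vgradh T \<phi> x + t *\<^sub>R vgradh T \<psi> x"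
  proof (cases "x \<in> (\<Union>K\<in>T. interior K)")
    case True
    then obtain K where K: "K \<in> T" "x \<in> interior K" by blast
    obtain C where C: "\<forall>K\<in>T. \<forall>y\<in>interior K. \<phi> y = vaff (C K) y" using assms(1) by (rule CR0_coeffs)
    obtain D where D: "\<forall>K\<in>T. \<forall>y\<in>interior K. \<psi> y = vaff (D K) y" using assms(2) by (rule CR0_coeffs)
    have "\<phi> y + t *\<^sub>R \<psi> y = vaff (\<lambda>k. C K k + t * D K k) y" if "y \<in> interior K" for y
      using C D K(1) that by (simp add: vaff_linear)
    note vgradh_vaff[OF K this]
    moreover have "vgradh T \<phi> x = vector [vector [C K 1, C K 2], vector [C K 4, C K 5]]"
      "vgradh T \<psi> x = vector [vector [D K 1, D K 2], vector [D K 4, D K 5]]"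
      using vgradh_vaff[OF K] C D K(1) by blast+
    ultimately show ?thesis by (simp add: vec_eq_iff forall_2)
  qed (simp add: vgradh_outside)
qed

lemma divh_linear:
  assumes "\<phi> \<in> CR0 \<Omega> T" "\<psi> \<in> CR0 \<Omega> T"
  shows "divh T (\<lambda>x. \<phi> x + t *\<^sub>R \<psi> x) x = divh T \<phi> x + t * divh T \<psi> x"
  using vgradh_linear[OF assms] by (simp add: divh_trace algebra_simps)

lemma pw_continuous_gradh:
  assumes "v \<in> Morley \<Omega> T"
  shows "pw_continuous (gradh T v)"
proof -
  obtain C where C: "\<forall>K\<in>T. \<forall>y\<in>interior K. v y = quad (C K) y" using assms by (rule Morley_coeffs)
  show ?thesis
    by (rule pw_continuous_vaff[of _ "\<lambda>K. gcoef (C K)"]) (use gradh_quad C in blast)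
qed

lemma pw_continuous_curlh:
  assumes "v \<in> Morley \<Omega> T"
  shows "pw_continuous (curlh T v)"
proof -
  obtain C where C: "\<forall>K\<in>T. \<forall>y\<in>interior K. v y = quad (C K) y" using assms by (rule Morley_coeffs)
  show ?thesis
    by (rule pw_continuous_vaff[of _ "\<lambda>K. rcoef (gcoef (C K))"]) (use curlh_quad C in blast)
qed

lemma pw_continuous_CR0:
  assumes "\<phi> \<in> CR0 \<Omega> T"
  shows "pw_continuous \<phi>" "pw_continuous (vgradh T \<phi>)" "pw_continuous (divh T \<phi>)"
proof -
  obtain D where D: "\<forall>K\<in>T. \<forall>y\<in>interior K. \<phi> y = vaff (D K) y" using assms by (rule CR0_coeffs)
  show "pw_continuous \<phi>" by (rule pw_continuous_vaff) (use D in blast)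
  show "pw_continuous (vgradh T \<phi>)"
    by (rule pw_continuousI[of "\<lambda>K x. vector [vector [D K 1, D K 2], vector [D K 4, D K 5]]"])
      (simp, use vgradh_vaff D in blast)
  show "pw_continuous (divh T \<phi>)"
    by (rule pw_continuousI[of "\<lambda>K x. D K 1 + D K 5"]) (simp, use divh_vaff D in blast)
qed

lemma vgradh_cong:
  assumes "\<phi> \<in> CR0 \<Omega> T" "K \<in> T" "x \<in> interior K" "\<And>y. y \<in> interior K \<Longrightarrow> \<psi> y = \<phi> y"
  shows "vgradh T \<psi> x = vgradh T \<phi> x"
proof -
  obtain D where D: "\<forall>K\<in>T. \<forall>y\<in>interior K. \<phi> y = vaff (D K) y" using assms(1) by (rule CR0_coeffs)
  have "\<phi> y = vaff (D K) y" "\<psi> y = vaff (D K) y" if "y \<in> interior K" for y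
    using D assms(2,4) that by simp_all
  then show ?thesis using vgradh_vaff[OF assms(2,3)] by metis
qed

text \<open>Both diagonal entries are the mixed second derivative, with opposite signs.\<close>

lemma divh_curlh:
  assumes "v \<in> Morley \<Omega> T"
  shows "divh T (curlh T v) x = 0"
proof (cases "x \<in> (\<Union>K\<in>T. interior K)")
  case True
  then obtain K where K: "K \<in> T" "x \<in> interior K" by blast
  obtain C where C: "\<forall>K\<in>T. \<forall>y\<in>interior K. v y = quad (C K) y" using assms by (rule Morley_coeffs)
  have "divh T (curlh T v) x = rcoef (gcoef (C K)) 1 + rcoef (gcoef (C K)) 5"
    by (rule divh_vaff[OF K]) (use curlh_quad C K(1) in blast)
  then show ?thesis by simp
qed (simp add: divh_outside)

lemma L2_inner_curlh: "L2_inner \<Omega> (curlh T u) (curlh T v) = b_h \<Omega> T u v"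
  by (simp add: L2_inner_def b_h_def curlh_eq)

text \<open>\<open>rot\<close> swaps the rows of the derivative of the gradient and changes the sign
  of one, which preserves the Frobenius product; so does the transposition in
  \<open>hessh_eq\<close>.\<close>

lemma a_h_eq_vgradh_curlh:
  assumes "u \<in> Morley \<Omega> T" "v \<in> Morley \<Omega> T"
  shows "a_h \<Omega> T u v = L2_inner \<Omega> (vgradh T (curlh T u)) (vgradh T (curlh T v))"
proof -
  have "hessh T u x \<bullet> hessh T v x = vgradh T (curlh T u) x \<bullet> vgradh T (curlh T v) x" for x
  proof (cases "x \<in> (\<Union>K\<in>T. interior K)")
    case True
    then obtain K where K: "K \<in> T" "x \<in> interior K" by blast
    obtain C where C: "\<forall>K\<in>T. \<forall>y\<in>interior K. u y = quad (C K) y" using assms(1) by (rule Morley_coeffs)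
    obtain D where D: "\<forall>K\<in>T. \<forall>y\<in>interior K. v y = quad (D K) y" using assms(2) by (rule Morley_coeffs)
    have g: "gradh T u y = vaff (gcoef (C K)) y" "gradh T v y = vaff (gcoef (D K)) y"
      "curlh T u y = vaff (rcoef (gcoef (C K))) y" "curlh T v y = vaff (rcoef (gcoef (D K))) y"
      if "y \<in> interior K" for y
      using gradh_quad[OF K(1) that] curlh_quad[OF K(1) that] C D K(1) by blast+
    have "vgradh T (gradh T u) x = vector [vector [gcoef (C K) 1, gcoef (C K) 2], vector [gcoef (C K) 4, gcoef (C K) 5]]"
      by (rule vgradh_vaff[OF K g(1)])
    moreover have "vgradh T (gradh T v) x = vector [vector [gcoef (D K) 1, gcoef (D K) 2], vector [gcoef (D K) 4, gcoef (D K) 5]]"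
      by (rule vgradh_vaff[OF K g(2)])
    moreover have "vgradh T (curlh T u) x = vector [vector [gcoef (C K) 4, gcoef (C K) 5], vector [- gcoef (C K) 1, - gcoef (C K) 2]]"
      using vgradh_vaff[OF K, of "curlh T u" "rcoef (gcoef (C K))"] g(3) by simp
    moreover have "vgradh T (curlh T v) x = vector [vector [gcoef (D K) 4, gcoef (D K) 5], vector [- gcoef (D K) 1, - gcoef (D K) 2]]"
      using vgradh_vaff[OF K, of "curlh T v" "rcoef (gcoef (D K))"] g(4) by simp
    ultimately show ?thesis by (simp add: hessh_eq inner_vec_def sum_2 algebra_simps)
  next
    case False
    then show ?thesis by (simp add: hessh_eq vgradh_outside inner_vec_def)
  qed
  then show ?thesis by (simp add: a_h_def L2_inner_def)
qed

section \<open>Solvability of the discrete Poisson problem and existence of the pressure\<close>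

lemma gradh_eq_0:
  assumes "v \<in> Morley \<Omega> T" "b_h \<Omega> T v v = 0"
  shows "gradh T v x = 0"
proof (cases "x \<in> (\<Union>K\<in>T. interior K)")
  case True
  then show ?thesis
    using L2_inner_self_eq_0[OF pw_continuous_gradh[OF assms(1)]] assms(2) by (auto simp: b_h_def)
qed (rule gradh_outside)

text \<open>Three noncollinear points determine an affine field. They supply the finitely many
  functionals for \<open>finite_rank_Riesz\<close>.\<close>

lemma vaff_determining_points:
  assumes "K \<in> T"
  shows "\<exists>P. finite P \<and> P \<subseteq> interior K \<and> (\<forall>c. (\<forall>x\<in>P. vaff c x = 0) \<longrightarrow> (\<forall>x. vaff c x = 0))"
proof -
  obtain y where "y \<in> interior K" using T_props(6)[OF assms] by blast
  then obtain \<delta> where \<delta>: "\<delta> > 0" "cball y \<delta> \<subseteq> interior K"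
    by (meson open_interior open_contains_cball)
  let ?P = "{y, y + \<delta> *\<^sub>R axis 1 1, y + \<delta> *\<^sub>R axis 2 1}"
  have "?P \<subseteq> cball y \<delta>" using \<delta>(1) by (auto simp: dist_norm norm_axis_1)
  moreover have "\<forall>x. vaff c x = 0" if "\<forall>x\<in>?P. vaff c x = 0" for c
  proof -
    have y: "vaff c y = 0" "vaff c (y + \<delta> *\<^sub>R axis 1 1) = 0" "vaff c (y + \<delta> *\<^sub>R axis 2 1) = 0"
      using that by blast+
    have "c (Suc 0) * \<delta> = vaff c (y + \<delta> *\<^sub>R axis 1 1) $ 1 - vaff c y $ 1"
      "c 4 * \<delta> = vaff c (y + \<delta> *\<^sub>R axis 1 1) $ 2 - vaff c y $ 2"
      "c 2 * \<delta> = vaff c (y + \<delta> *\<^sub>R axis 2 1) $ 1 - vaff c y $ 1"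
      "c 5 * \<delta> = vaff c (y + \<delta> *\<^sub>R axis 2 1) $ 2 - vaff c y $ 2"
      by (simp_all add: algebra_simps)
    then have c: "c (Suc 0) = 0" "c 2 = 0" "c 4 = 0" "c 5 = 0" unfolding y using \<delta>(1) by auto
    have "c 0 = vaff c y $ 1" "c 3 = vaff c y $ 2" using c by simp_all
    then have "c 0 = 0" "c 3 = 0" unfolding y by simp_all
    then show ?thesis using c by (simp add: vec2_eq_iff)
  qed
  moreover have "finite ?P" by simp
  ultimately show ?thesis using \<delta>(2) by (meson order_trans)
qed

text \<open>Riesz representation for \<open>b_h\<close>, with gradient values at the determining
  points as functionals. The form is degenerate on total functions, but its null elements have zero
  gradient everywhere, so the right-hand side vanishes on them.\<close>

lemma Morley_Poisson_solution:
  assumes g: "g \<in> L2 \<Omega>"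
  shows "\<exists>z\<in>Morley \<Omega> T. \<forall>v\<in>Morley \<Omega> T. b_h \<Omega> T z v = L2_inner \<Omega> g (gradh T v)"
proof -
  have "\<exists>P. \<forall>K\<in>T. finite (P K) \<and> P K \<subseteq> interior K \<and>
      (\<forall>c. (\<forall>x\<in>P K. vaff c x = 0) \<longrightarrow> (\<forall>x. vaff c x = 0))"
    using vaff_determining_points by (intro bchoice) blast
  then obtain P where P0: "\<forall>K\<in>T. finite (P K) \<and> P K \<subseteq> interior K \<and>
      (\<forall>c. (\<forall>x\<in>P K. vaff c x = 0) \<longrightarrow> (\<forall>x. vaff c x = 0))" by (rule exE)
  have P: "finite (P K)" "P K \<subseteq> interior K" "\<forall>x\<in>P K. vaff c x = 0 \<Longrightarrow> vaff c x = 0"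
    if "K \<in> T" for K c x using bspec[OF P0 that] by simp_all
  let ?I = "(\<Union>K\<in>T. P K) \<times> (UNIV :: 2 set)"
  have L2: "gradh T v \<in> L2 \<Omega>" if "v \<in> Morley \<Omega> T" for v
    by (rule pw_continuous_L2[OF pw_continuous_gradh[OF that]])
  have lin: "linear_form_on (Morley \<Omega> T) (\<lambda>v. L2_inner \<Omega> h (gradh T v))" if "h \<in> L2 \<Omega>" for h
    unfolding linear_form_on_def using that L2
    by (simp add: gradh_linear L2_inner_linear_right)
  show ?thesis
  proof (rule finite_rank_Riesz[where I = ?I and f = "\<lambda>(x, i) v. gradh T v x $ i"])
    show "finite ?I" using P(1) by simp
    show "fun_subspace (Morley \<Omega> T)" by (rule fun_subspace_Morley)
    show "\<forall>i\<in>?I. linear_form_on (Morley \<Omega> T) ((\<lambda>(x, i) v. gradh T v x $ i) i)"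
      by (auto simp: linear_form_on_def gradh_linear)
    show "linear_form_on (Morley \<Omega> T) (\<lambda>v. L2_inner \<Omega> g (gradh T v))" using lin[OF g] .
    show "\<forall>u\<in>Morley \<Omega> T. linear_form_on (Morley \<Omega> T) (b_h \<Omega> T u)"
      using lin L2 unfolding b_h_def by blast
    show "\<forall>u\<in>Morley \<Omega> T. \<forall>v\<in>Morley \<Omega> T. b_h \<Omega> T u v = b_h \<Omega> T v u"
      by (simp add: b_h_def L2_inner_commute)
    show "\<forall>u\<in>Morley \<Omega> T. b_h \<Omega> T u u = 0 \<longrightarrow>
        L2_inner \<Omega> g (gradh T u) = 0 \<and> (\<forall>v\<in>Morley \<Omega> T. b_h \<Omega> T u v = 0)"
    proof (intro ballI impI)
      fix u assume "u \<in> Morley \<Omega> T" "b_h \<Omega> T u u = 0"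
      then have "gradh T u = (\<lambda>x. 0)" using gradh_eq_0 by (intro ext)
      then show "L2_inner \<Omega> g (gradh T u) = 0 \<and> (\<forall>v\<in>Morley \<Omega> T. b_h \<Omega> T u v = 0)"
        by (simp add: b_h_def L2_inner_def set_lebesgue_integral_def)
    qed
    show "\<forall>u\<in>Morley \<Omega> T. (\<forall>i\<in>?I. (case i of (x, i) \<Rightarrow> \<lambda>v. gradh T v x $ i) u = 0) \<longrightarrow> b_h \<Omega> T u u = 0"
    proof (intro ballI impI)
      fix u assume u: "u \<in> Morley \<Omega> T"
        and 0: "\<forall>i\<in>?I. (case i of (x, i) \<Rightarrow> \<lambda>v. gradh T v x $ i) u = 0"
      obtain C where C: "\<forall>K\<in>T. \<forall>y\<in>interior K. u y = quad (C K) y" using u by (rule Morley_coeffs)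
      have "gradh T u x = 0" for x
      proof (cases "x \<in> (\<Union>K\<in>T. interior K)")
        case True
        then obtain K where K: "K \<in> T" "x \<in> interior K" by blast
        have G: "gradh T u y = vaff (gcoef (C K)) y" if "y \<in> interior K" for y
          using gradh_quad[OF K(1) that] C K(1) by blast
        have "vaff (gcoef (C K)) y = 0" if "y \<in> P K" for y
        proof -
          have "gradh T u y $ i = 0" for i using 0 K(1) that by auto
          then show ?thesis using G P(2)[OF K(1)] that by (metis subsetD vec_eq_iff zero_index)
        qed
        then show ?thesis using P(3)[OF K(1)] G[OF K(2)] by simp
      qed (rule gradh_outside)
      then show "b_h \<Omega> T u u = 0" by (simp add: b_h_def L2_inner_def set_lebesgue_integral_def)
    qed
  qed
qed

text \<open>No inf-sup condition is needed for existence: a functional that vanishes on the discretely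
  divergence-free fields is a combination of the finitely many element divergences.\<close>

lemma discrete_pressure:
  assumes lin: "linear_form_on (CR0 \<Omega> T) G"
    and ker: "\<And>\<psi>. \<psi> \<in> CR0 \<Omega> T \<Longrightarrow> (\<And>K x. K \<in> T \<Longrightarrow> x \<in> interior K \<Longrightarrow> divh T \<psi> x = 0) \<Longrightarrow> G \<psi> = 0"
  shows "\<exists>p\<in>Qh \<Omega> T. \<forall>\<psi>\<in>CR0 \<Omega> T. L2_inner \<Omega> (divh T \<psi>) p = G \<psi>"
proof -
  \<comment> \<open>A sample point \<open>m K\<close> reads off the divergence, which is constant on
    the open element.\<close>
  have "\<forall>K\<in>T. \<exists>x. x \<in> interior K" using T_props(6) by blast
  then have "\<exists>m. \<forall>K\<in>T. m K \<in> interior K" by (rule bchoice)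
  then obtain m where m: "\<And>K. K \<in> T \<Longrightarrow> m K \<in> interior K" by blast
  have const: "divh T \<psi> x = divh T \<psi> (m K)" if \<psi>: "\<psi> \<in> CR0 \<Omega> T" and K: "K \<in> T" "x \<in> interior K" for \<psi> K x
  proof -
    obtain D where D: "\<forall>K\<in>T. \<forall>y\<in>interior K. \<psi> y = vaff (D K) y" using \<psi> by (rule CR0_coeffs)
    show ?thesis using divh_vaff[OF K] divh_vaff[OF K(1) m[OF K(1)]] D K(1) by (metis)
  qed
  have mean0: "(\<Sum>K\<in>T. area K * divh T \<psi> (m K)) = 0" if \<psi>: "\<psi> \<in> CR0 \<Omega> T" for \<psi>
  proof -
    obtain D where D: "\<forall>K\<in>T. \<forall>y\<in>interior K. \<psi> y = vaff (D K) y" using \<psi> by (rule CR0_coeffs)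
    have "divh T \<psi> (m K) = D K 1 + D K 5" if "K \<in> T" for K
      using divh_vaff[OF that m[OF that]] D that by blast
    then show ?thesis using CR0_mean_divergence[OF \<psi> D] by simp
  qed
  have "\<exists>c. \<forall>\<psi>\<in>CR0 \<Omega> T. G \<psi> = (\<Sum>K\<in>T. c K * divh T \<psi> (m K))"
  proof (rule linear_form_in_span[OF finite_T fun_subspace_CR0 _ lin])
    show "\<forall>K\<in>T. linear_form_on (CR0 \<Omega> T) (\<lambda>\<psi>. divh T \<psi> (m K))"
      by (simp add: linear_form_on_def divh_linear)
    show "\<forall>\<psi>\<in>CR0 \<Omega> T. (\<forall>K\<in>T. divh T \<psi> (m K) = 0) \<longrightarrow> G \<psi> = 0"
    proof (intro ballI impI)
      fix \<psi> assume \<psi>: "\<psi> \<in> CR0 \<Omega> T" "\<forall>K\<in>T. divh T \<psi> (m K) = 0"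
      then show "G \<psi> = 0" using const[OF \<psi>(1)] by (intro ker) auto
    qed
  qed
  then obtain c where c: "\<And>\<psi>. \<psi> \<in> CR0 \<Omega> T \<Longrightarrow> G \<psi> = (\<Sum>K\<in>T. c K * divh T \<psi> (m K))" by blast
  \<comment> \<open>Dividing \<open>c K\<close> by the area turns coefficients into values of a
    density, and \<open>\<mu>\<close> is its mean. Subtracting it does not affect the pairing,
    because the area-weighted divergences sum to 0.\<close>
  define \<mu> where "\<mu> = (\<Sum>K\<in>T. c K) / (\<Sum>K\<in>T. area K)"
  define \<pi> where "\<pi> K = c K / area K - \<mu>" for K
  define p where "p x = \<pi> (SOME K. K \<in> T \<and> x \<in> interior K)" for x
  have p: "p x = \<pi> K" if "K \<in> T" "x \<in> interior K" for K x
  proof -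
    let ?K = "SOME K. K \<in> T \<and> x \<in> interior K"
    have "?K \<in> T \<and> x \<in> interior ?K" by (rule someI[of _ K]) (use that in auto)
    then have "?K = K" using interior_disjoint[of ?K K] that interior_subset[of K] by blast
    then show ?thesis by (simp add: p_def)
  qed
  have "T \<noteq> {}" using Union_T \<Omega>_nonempty closure_subset[of \<Omega>] by blast
  then have area_sum: "(\<Sum>K\<in>T. area K) > 0" using area_pos by (intro sum_pos) auto
  have area_\<pi>: "area K * \<pi> K = c K - \<mu> * area K" if "K \<in> T" for K
    using area_pos[OF that] by (simp add: \<pi>_def field_simps)
  have "(LINT x:\<Omega>|lebesgue. p x) = L2_inner \<Omega> (\<lambda>x. 1) p" by (simp add: L2_inner_def)
  also have "\<dots> = (\<Sum>K\<in>T. area K * (1 * \<pi> K))" by (rule L2_inner_pw_constant) (use p in auto)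
  also have "\<dots> = (\<Sum>K\<in>T. c K) - \<mu> * (\<Sum>K\<in>T. area K)"
    using area_\<pi> by (simp add: sum_subtractf sum_distrib_left)
  also have "\<dots> = 0" using area_sum by (simp add: \<mu>_def)
  finally have "p \<in> Qh \<Omega> T" using p unfolding Qh_def constant_on_def by blast
  moreover have "L2_inner \<Omega> (divh T \<psi>) p = G \<psi>" if \<psi>: "\<psi> \<in> CR0 \<Omega> T" for \<psi>
  proof -
    have "L2_inner \<Omega> (divh T \<psi>) p = (\<Sum>K\<in>T. area K * (divh T \<psi> (m K) * \<pi> K))"
      by (rule L2_inner_pw_constant) (use const[OF \<psi>] p in auto)
    also have "\<dots> = (\<Sum>K\<in>T. c K * divh T \<psi> (m K) - \<mu> * (area K * divh T \<psi> (m K)))"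
    proof (rule sum.cong)
      fix K assume K: "K \<in> T"
      have "area K * (divh T \<psi> (m K) * \<pi> K) = (area K * \<pi> K) * divh T \<psi> (m K)" by simp
      then show "area K * (divh T \<psi> (m K) * \<pi> K) =
          c K * divh T \<psi> (m K) - \<mu> * (area K * divh T \<psi> (m K))"
        unfolding area_\<pi>[OF K] by (simp add: algebra_simps)
    qed simp
    also have "\<dots> = G \<psi>"
      using mean0[OF \<psi>] c[OF \<psi>] by (simp add: sum_subtractf sum_distrib_left[symmetric])
    finally show ?thesis .
  qed
  ultimately show ?thesis by blast
qed

text \<open>Makes the divergence itself an admissible test function in the third equation, so that
  the discrete constraint holds pointwise.\<close>

lemma divh_CR0_in_Qh:
  assumes "\<phi> \<in> CR0 \<Omega> T"
  shows "divh T \<phi> \<in> Qh \<Omega> T"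
proof -
  obtain D where D: "\<forall>K\<in>T. \<forall>y\<in>interior K. \<phi> y = vaff (D K) y" using assms by (rule CR0_coeffs)
  have div: "divh T \<phi> x = D K 1 + D K 5" if "K \<in> T" "x \<in> interior K" for K x
    using divh_vaff[OF that] D that(1) by blast
  have "(LINT x:\<Omega>|lebesgue. divh T \<phi> x) = L2_inner \<Omega> (\<lambda>x. 1) (divh T \<phi>)" by (simp add: L2_inner_def)
  also have "\<dots> = (\<Sum>K\<in>T. area K * (1 * (D K 1 + D K 5)))"
    by (rule L2_inner_pw_constant) (use div in auto)
  also have "\<dots> = 0" using CR0_mean_divergence[OF assms D] by simp
  finally show ?thesis using div unfolding Qh_def constant_on_def by blast
qed

end

lemma weak_grad_in_L2:
  assumes "w \<in> H1 \<Omega>"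
  shows "weak_grad \<Omega> w \<in> L2 \<Omega>"
proof -
  have "\<exists>g. g \<in> L2 \<Omega> \<and> is_weak_gradient \<Omega> w g" using assms by (auto simp: H1_def)
  then have "weak_grad \<Omega> w \<in> L2 \<Omega> \<and> is_weak_gradient \<Omega> w (weak_grad \<Omega> w)"
    unfolding weak_grad_def by (rule someI_ex)
  then show ?thesis ..
qed

theorem lemma5p3:
  fixes \<Omega> :: "(real^2) set" and T :: "(real^2) set set"
    and \<gamma> \<epsilon> :: real and l :: nat
    and f w u :: "real^2 \<Rightarrow> real"
  assumes "convex_polygon \<Omega>"
    and "mesh \<Omega> T" and "shape_regular \<gamma> T"
    and "f \<in> L2 \<Omega>" and "\<epsilon> > 0" and "l \<in> {1, 2}"
    and "w \<in> Lagrange \<Omega> T l"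
    and "\<forall>\<xi>\<in>Lagrange \<Omega> T l. L2_inner \<Omega> (weak_grad \<Omega> w) (weak_grad \<Omega> \<xi>) = L2_inner \<Omega> f \<xi>"
  shows
    "(u \<in> Morley0 \<Omega> T \<and>
      (\<forall>v\<in>Morley0 \<Omega> T. \<epsilon>\<^sup>2 * a_h \<Omega> T u v + b_h \<Omega> T u v = L2_inner \<Omega> (weak_grad \<Omega> w) (gradh T v)))
     \<longleftrightarrow>
     (\<exists>z \<phi> p. z \<in> Morley \<Omega> T \<and> \<phi> \<in> CR0 \<Omega> T \<and> p \<in> Qh \<Omega> T \<and> u \<in> Morley \<Omega> T \<and>
      (\<forall>v\<in>Morley \<Omega> T. L2_inner \<Omega> (curlh T z) (curlh T v) = L2_inner \<Omega> (weak_grad \<Omega> w) (gradh T v)) \<and>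
      (\<forall>\<psi>\<in>CR0 \<Omega> T. L2_inner \<Omega> \<phi> \<psi> + \<epsilon>\<^sup>2 * L2_inner \<Omega> (vgradh T \<phi>) (vgradh T \<psi>)
           + L2_inner \<Omega> (divh T \<psi>) p = L2_inner \<Omega> (curlh T z) \<psi>) \<and>
      (\<forall>q\<in>Qh \<Omega> T. L2_inner \<Omega> (divh T \<phi>) q = 0) \<and>
      (\<forall>\<xi>\<in>Morley \<Omega> T. L2_inner \<Omega> (curlh T u) (curlh T \<xi>) = L2_inner \<Omega> \<phi> (curlh T \<xi>)))"
    (is "?L \<longleftrightarrow> ?R")
proof -
  interpret polygon_mesh \<Omega> T using assms(1,2) by unfold_locales
  let ?\<l> = "\<lambda>v. L2_inner \<Omega> (weak_grad \<Omega> w) (gradh T v)"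
  have W: "weak_grad \<Omega> w \<in> L2 \<Omega>"
    using assms(7) by (intro weak_grad_in_L2) (simp add: Lagrange_def H10_def)
  have M: "v \<in> Morley \<Omega> T" if "v \<in> Morley0 \<Omega> T" for v using that by (simp add: Morley0_def)
  show ?thesis
  proof
    assume ?L
    then have u: "u \<in> Morley0 \<Omega> T"
      and eq: "\<And>v. v \<in> Morley0 \<Omega> T \<Longrightarrow> \<epsilon>\<^sup>2 * a_h \<Omega> T u v + b_h \<Omega> T u v = ?\<l> v" by auto
    obtain z where z: "z \<in> Morley \<Omega> T" "\<And>v. v \<in> Morley \<Omega> T \<Longrightarrow> b_h \<Omega> T z v = ?\<l> v"
      using Morley_Poisson_solution[OF W] by blast
    define \<phi> where "\<phi> = curlh T u"
    have \<phi>: "\<phi> \<in> CR0 \<Omega> T" unfolding \<phi>_def by (rule curlh_Morley0_in_CR0[OF u])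
    \<comment> \<open>The residual of the Brinkman equation without its pressure term; the pressure
      has to represent it.\<close>
    define G where "G \<psi> = L2_inner \<Omega> (curlh T z) \<psi> - L2_inner \<Omega> \<phi> \<psi>
      - \<epsilon>\<^sup>2 * L2_inner \<Omega> (vgradh T \<phi>) (vgradh T \<psi>)" for \<psi>
    note L2 = pw_continuous_L2[OF pw_continuous_CR0(1)] pw_continuous_L2[OF pw_continuous_CR0(2)]
      pw_continuous_L2[OF pw_continuous_curlh[OF z(1)]]
    have "\<exists>p\<in>Qh \<Omega> T. \<forall>\<psi>\<in>CR0 \<Omega> T. L2_inner \<Omega> (divh T \<psi>) p = G \<psi>"
    proof (rule discrete_pressure)
      show "linear_form_on (CR0 \<Omega> T) G"
        unfolding linear_form_on_def
      proof (intro ballI allI)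
        fix \<psi> \<psi>' c assume \<psi>: "\<psi> \<in> CR0 \<Omega> T" "\<psi>' \<in> CR0 \<Omega> T"
        note L = L2_inner_linear_right[OF L2(3) L2(1)[OF \<psi>(1)] L2(1)[OF \<psi>(2)]]
          L2_inner_linear_right[OF L2(1)[OF \<phi>] L2(1)[OF \<psi>(1)] L2(1)[OF \<psi>(2)]]
          L2_inner_linear_right[OF L2(2)[OF \<phi>] L2(2)[OF \<psi>(1)] L2(2)[OF \<psi>(2)]]
        show "G (\<lambda>x. \<psi> x + c *\<^sub>R \<psi>' x) = G \<psi> + c * G \<psi>'"
          unfolding G_def vgradh_linear[OF \<psi>] L by (simp add: algebra_simps)
      qed
      fix \<psi> assume \<psi>: "\<psi> \<in> CR0 \<Omega> T" "\<And>K x. K \<in> T \<Longrightarrow> x \<in> interior K \<Longrightarrow> divh T \<psi> x = 0"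
      \<comment> \<open>A divergence-free test field is a rotated gradient from
        \<open>Morley0\<close>, so on it the residual is the difference of the equation for
        \<open>z\<close> and the original equation, both tested with \<open>v\<close>.\<close>
      obtain v where v: "v \<in> Morley0 \<Omega> T" "\<forall>K\<in>T. \<forall>x\<in>interior K. curlh T v x = \<psi> x"
        using Morley0_curl_potential[OF \<psi>(1)] \<psi>(2) by blast
      have cv: "curlh T v \<in> CR0 \<Omega> T" by (rule curlh_Morley0_in_CR0[OF v(1)])
      have "L2_inner \<Omega> h \<psi> = L2_inner \<Omega> h (curlh T v)" if "pw_continuous h" for h
        using that pw_continuous_CR0(1)[OF \<psi>(1)] that pw_continuous_CR0(1)[OF cv]
        by (rule L2_inner_cong_elements) (use v(2) in simp)
      moreover have vg: "vgradh T (curlh T v) x = vgradh T \<psi> x" if "K \<in> T" "x \<in> interior K" for K x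
        by (rule vgradh_cong[OF \<psi>(1) that]) (use v(2) that in blast)
      have "L2_inner \<Omega> (vgradh T \<phi>) (vgradh T \<psi>) = L2_inner \<Omega> (vgradh T \<phi>) (vgradh T (curlh T v))"
        using pw_continuous_CR0(2)[OF \<phi>] pw_continuous_CR0(2)[OF \<psi>(1)] pw_continuous_CR0(2)[OF \<phi>]
          pw_continuous_CR0(2)[OF cv]
        by (rule L2_inner_cong_elements) (simp add: vg)
      ultimately have "G \<psi> = b_h \<Omega> T z v - b_h \<Omega> T u v - \<epsilon>\<^sup>2 * a_h \<Omega> T u v"
        using pw_continuous_curlh[OF z(1)] pw_continuous_curlh[OF M[OF u]]
        by (simp add: G_def \<phi>_def L2_inner_curlh a_h_eq_vgradh_curlh M u v(1))
      then show "G \<psi> = 0" using eq[OF v(1)] z(2)[OF M[OF v(1)]] by simp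
    qed
    then obtain p where p: "p \<in> Qh \<Omega> T" "\<And>\<psi>. \<psi> \<in> CR0 \<Omega> T \<Longrightarrow> L2_inner \<Omega> (divh T \<psi>) p = G \<psi>" by blast
    show ?R
    proof (intro exI conjI ballI)
      show "z \<in> Morley \<Omega> T" "\<phi> \<in> CR0 \<Omega> T" "p \<in> Qh \<Omega> T" "u \<in> Morley \<Omega> T"
        using z \<phi> p M[OF u] by simp_all
      show "L2_inner \<Omega> (curlh T z) (curlh T v) = ?\<l> v" if "v \<in> Morley \<Omega> T" for v
        using z(2)[OF that] by (simp add: L2_inner_curlh)
      show "L2_inner \<Omega> \<phi> \<psi> + \<epsilon>\<^sup>2 * L2_inner \<Omega> (vgradh T \<phi>) (vgradh T \<psi>) + L2_inner \<Omega> (divh T \<psi>) p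
          = L2_inner \<Omega> (curlh T z) \<psi>" if "\<psi> \<in> CR0 \<Omega> T" for \<psi>
        using p(2)[OF that] by (simp add: G_def)
      show "L2_inner \<Omega> (divh T \<phi>) q = 0" for q
        by (simp add: \<phi>_def L2_inner_def set_lebesgue_integral_def divh_curlh[OF M[OF u]])
      show "L2_inner \<Omega> (curlh T u) (curlh T \<xi>) = L2_inner \<Omega> \<phi> (curlh T \<xi>)" for \<xi>
        by (simp add: \<phi>_def)
    qed
  next
    assume ?R
    then obtain z \<phi> p where z: "z \<in> Morley \<Omega> T" and \<phi>: "\<phi> \<in> CR0 \<Omega> T" and u: "u \<in> Morley \<Omega> T"
      and ez: "\<And>v. v \<in> Morley \<Omega> T \<Longrightarrow> L2_inner \<Omega> (curlh T z) (curlh T v) = ?\<l> v"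
      and e\<phi>: "\<And>\<psi>. \<psi> \<in> CR0 \<Omega> T \<Longrightarrow> L2_inner \<Omega> \<phi> \<psi> + \<epsilon>\<^sup>2 * L2_inner \<Omega> (vgradh T \<phi>) (vgradh T \<psi>)
           + L2_inner \<Omega> (divh T \<psi>) p = L2_inner \<Omega> (curlh T z) \<psi>"
      and ep: "\<And>q. q \<in> Qh \<Omega> T \<Longrightarrow> L2_inner \<Omega> (divh T \<phi>) q = 0"
      and eu: "\<And>\<xi>. \<xi> \<in> Morley \<Omega> T \<Longrightarrow> L2_inner \<Omega> (curlh T u) (curlh T \<xi>) = L2_inner \<Omega> \<phi> (curlh T \<xi>)"
      by blast
    \<comment> \<open>The third equation is tested with the divergence of \<open>\<phi>\<close>
      itself.\<close>
    have "divh T \<phi> x = 0" if "K \<in> T" "x \<in> interior K" for K x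
      by (rule L2_inner_self_eq_0[OF pw_continuous_CR0(3)[OF \<phi>] ep[OF divh_CR0_in_Qh[OF \<phi>]] that])
    then obtain v0 where v0: "v0 \<in> Morley0 \<Omega> T" "\<forall>K\<in>T. \<forall>x\<in>interior K. curlh T v0 x = \<phi> x"
      using Morley0_curl_potential[OF \<phi>] by blast
    \<comment> \<open>Tested with the difference of \<open>u\<close> and the potential of
      \<open>\<phi>\<close>, the last equation says that this difference has zero energy.\<close>
    define d where "d = (\<lambda>x. u x + (-1) *\<^sub>R v0 x)"
    have d: "d \<in> Morley \<Omega> T"
      unfolding d_def by (rule fun_subspaceD[OF fun_subspace_Morley u M[OF v0(1)]])
    have gd: "gradh T d = (\<lambda>x. gradh T u x + (-1) *\<^sub>R gradh T v0 x)"
      unfolding d_def real_scaleR_def by (rule gradh_linear[OF u M[OF v0(1)]])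
    have "L2_inner \<Omega> \<phi> (curlh T d) = L2_inner \<Omega> (curlh T v0) (curlh T d)"
      by (rule L2_inner_cong_elements)
        (use pw_continuous_CR0(1)[OF \<phi>] pw_continuous_curlh[OF d] pw_continuous_curlh[OF M[OF v0(1)]] v0(2) in simp_all)
    then have "b_h \<Omega> T d u = b_h \<Omega> T d v0"
      using eu[OF d] unfolding L2_inner_curlh b_h_def by (simp add: L2_inner_commute)
    moreover have "b_h \<Omega> T d d = b_h \<Omega> T d u + (-1) * b_h \<Omega> T d v0"
      unfolding b_h_def
      by (subst (2) gd, rule L2_inner_linear_right)
        (use pw_continuous_L2[OF pw_continuous_gradh] d u M[OF v0(1)] in blast)+
    ultimately have "gradh T d x = 0" for x by (intro gradh_eq_0[OF d]) simp
    then have grad_eq: "gradh T u = gradh T v0" unfolding gd by (simp add: fun_eq_iff)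
    \<comment> \<open>The boundary condition of \<open>Morley0\<close> depends on the gradient
      alone, so it passes from \<open>v0\<close> to \<open>u\<close> although the two functions may
      differ on the skeleton.\<close>
    then have u0: "u \<in> Morley0 \<Omega> T" using v0(1) u by (simp add: Morley0_def)
    have curl: "curlh T u x = \<phi> x" if "K \<in> T" "x \<in> interior K" for K x
      using v0(2) that grad_eq by (simp add: curlh_eq)
    have "\<epsilon>\<^sup>2 * a_h \<Omega> T u v + b_h \<Omega> T u v = ?\<l> v" if v: "v \<in> Morley0 \<Omega> T" for v
    proof -
      have cv: "curlh T v \<in> CR0 \<Omega> T" and cu: "curlh T u \<in> CR0 \<Omega> T"
        using curlh_Morley0_in_CR0 v u0 by auto
      have "L2_inner \<Omega> \<phi> (curlh T v) = L2_inner \<Omega> (curlh T u) (curlh T v)"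
        by (rule L2_inner_cong_elements) (use pw_continuous_CR0(1) \<phi> cu cv curl in auto)
      moreover have vg: "vgradh T (curlh T u) x = vgradh T \<phi> x" if "K \<in> T" "x \<in> interior K" for K x
        by (rule vgradh_cong[OF \<phi> that curl[OF that(1)]])
      have "L2_inner \<Omega> (vgradh T \<phi>) (vgradh T (curlh T v)) = L2_inner \<Omega> (vgradh T (curlh T u)) (vgradh T (curlh T v))"
        by (rule L2_inner_cong_elements)
          (use pw_continuous_CR0(2) \<phi> cu cv vg in auto)
      \<comment> \<open>Rotated gradients are divergence-free, so the pressure drops out.\<close>
      moreover have "L2_inner \<Omega> (divh T (curlh T v)) p = 0"
        by (simp add: L2_inner_def set_lebesgue_integral_def divh_curlh[OF M[OF v]])
      ultimately show ?thesis
        using e\<phi>[OF cv] ez[OF M[OF v]] a_h_eq_vgradh_curlh[OF u M[OF v]] by (simp add: L2_inner_curlh)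
    qed
    then show ?L using u0 by blast
  qed
qed

end
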